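(* Let $\Gamma$ and $\Gamma'$ be two plane branches in the same class of analytic conjugacy. Then there exist a nilpotent singular holomorphic vector field $X$ and a linear vector field $Y$ such that $(\exp(Y)\circ\exp(X))(\Gamma)=\Gamma'$.
   Context: A plane branch is a reduced irreducible germ of analytic curve at $(0,0)\in\mathbb{C}^2$. Two branches are in the same class of analytic conjugacy if some germ of biholomorphism of $(\mathbb{C}^2,0)$ fixing the origin maps one onto the other. A singular holomorphic vector field is a germ of holomorphic vector field at $(0,0)$ vanishing at $(0,0)$; it is nilpotent if its linear part at the origin is nilpotent (possibly zero). $\exp(X)$ denotes the time $1$ flow of $X$. *)

theory Defs
  imports "HOL-Analysis.Analysis"
begin

(* Germs are represented by total functions; only the values near the base point matter.
   holomorphic_at f p: on a neighbourhood of p, the real Frechet derivative of f exists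
   and is complex linear. *)
definition holomorphic_at :: "(complex^2 \<Rightarrow> complex) \<Rightarrow> complex^2 \<Rightarrow> bool" where
  "holomorphic_at f p \<longleftrightarrow>
     (\<forall>\<^sub>F q in nhds p. \<exists>a b. (f has_derivative (\<lambda>h. a * h $ 1 + b * h $ 2)) (at q))"

definition holomorphic_map_at :: "(complex^2 \<Rightarrow> complex^2) \<Rightarrow> complex^2 \<Rightarrow> bool" where
  "holomorphic_map_at F p \<longleftrightarrow> (\<forall>i. holomorphic_at (\<lambda>z. F z $ i) p)"

definition biholomorphism_germ :: "(complex^2 \<Rightarrow> complex^2) \<Rightarrow> bool" where
  "biholomorphism_germ \<phi> \<longleftrightarrow>
     holomorphic_map_at \<phi> 0 \<and> \<phi> 0 = 0 \<and>
     (\<exists>\<psi>. holomorphic_map_at \<psi> 0 \<and> \<psi> 0 = 0 \<and>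
          (\<forall>\<^sub>F z in nhds 0. \<psi> (\<phi> z) = z) \<and> (\<forall>\<^sub>F z in nhds 0. \<phi> (\<psi> z) = z))"

definition unit_germ :: "(complex^2 \<Rightarrow> complex) \<Rightarrow> bool" where
  "unit_germ u \<longleftrightarrow>
     holomorphic_at u 0 \<and> (\<exists>v. holomorphic_at v 0 \<and> (\<forall>\<^sub>F z in nhds 0. u z * v z = 1))"

definition irreducible_germ :: "(complex^2 \<Rightarrow> complex) \<Rightarrow> bool" where
  "irreducible_germ f \<longleftrightarrow>
     holomorphic_at f 0 \<and> \<not> (\<forall>\<^sub>F z in nhds 0. f z = 0) \<and> \<not> unit_germ f \<and>
     (\<forall>g h. holomorphic_at g 0 \<and> holomorphic_at h 0 \<and> (\<forall>\<^sub>F z in nhds 0. f z = g z * h z)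
        \<longrightarrow> unit_germ g \<or> unit_germ h)"

(* The germ at the origin of a set A, encoded as the filter generated by the sets A \<inter> U, where
   U ranges over the neighbourhoods of the origin. The two lemmas below justify the encoding:
   equality of filters is equality of germs, and filtermap is the image of a germ of set
   under a germ of homeomorphism. *)
definition set_germ :: "(complex^2) set \<Rightarrow> (complex^2) filter" where
  "set_germ A = inf (nhds 0) (principal A)"

lemma set_germ_eq_iff: "set_germ A = set_germ B \<longleftrightarrow> (\<forall>\<^sub>F z in nhds 0. z \<in> A \<longleftrightarrow> z \<in> B)"
proof
  assume eq: "set_germ A = set_germ B"
  have "eventually (\<lambda>z. z \<in> B) (set_germ A)"
    unfolding eq by (simp add: set_germ_def eventually_inf_principal)
  moreover have "eventually (\<lambda>z. z \<in> A) (set_germ B)"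
    unfolding eq[symmetric] by (simp add: set_germ_def eventually_inf_principal)
  ultimately show "\<forall>\<^sub>F z in nhds 0. z \<in> A \<longleftrightarrow> z \<in> B"
    unfolding set_germ_def eventually_inf_principal by eventually_elim blast
next
  assume *: "\<forall>\<^sub>F z in nhds 0. z \<in> A \<longleftrightarrow> z \<in> B"
  show "set_germ A = set_germ B"
    unfolding set_germ_def filter_eq_iff eventually_inf_principal
  proof (intro allI iffI)
    fix P
    show "\<forall>\<^sub>F z in nhds 0. z \<in> B \<longrightarrow> P z" if "\<forall>\<^sub>F z in nhds 0. z \<in> A \<longrightarrow> P z"
      using * that by eventually_elim blast
    show "\<forall>\<^sub>F z in nhds 0. z \<in> A \<longrightarrow> P z" if "\<forall>\<^sub>F z in nhds 0. z \<in> B \<longrightarrow> P z"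
      using * that by eventually_elim blast
  qed
qed

lemma filtermap_set_germ:
  assumes "open U" "0 \<in> U" "open V" "\<phi> 0 = 0" "homeomorphism U V \<phi> \<psi>"
  shows "filtermap \<phi> (set_germ A) = set_germ (\<phi> ` (A \<inter> U))"
proof -
  note hom = assms(5)[unfolded homeomorphism_def]
  have "0 \<in> V" and \<psi>0: "\<psi> 0 = 0"
    using hom assms(2,4) by force+
  have \<phi>: "filterlim \<phi> (nhds 0) (nhds 0)" and \<psi>: "filterlim \<psi> (nhds 0) (nhds 0)"
    using hom assms \<open>0 \<in> V\<close> \<psi>0 continuous_on_eq_continuous_at[of U \<phi>]
      continuous_on_eq_continuous_at[of V \<psi>] by (metis isCont_def tendsto_at_iff_tendsto_nhds)+
  have U: "\<forall>\<^sub>F z in nhds 0. z \<in> U" and V: "\<forall>\<^sub>F z in nhds 0. z \<in> V"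
    using assms \<open>0 \<in> V\<close> by (auto intro: eventually_nhds_in_open)
  show ?thesis
    unfolding set_germ_def filter_eq_iff eventually_filtermap eventually_inf_principal
  proof (intro allI iffI)
    fix P
    assume "\<forall>\<^sub>F z in nhds 0. z \<in> A \<longrightarrow> P (\<phi> z)"
    then have "\<forall>\<^sub>F z in nhds 0. \<psi> z \<in> A \<longrightarrow> P (\<phi> (\<psi> z))"
      using \<psi> by (rule eventually_compose_filterlim)
    with V show "\<forall>\<^sub>F z in nhds 0. z \<in> \<phi> ` (A \<inter> U) \<longrightarrow> P z"
      by eventually_elim (use hom in force)
  next
    fix P
    assume "\<forall>\<^sub>F z in nhds 0. z \<in> \<phi> ` (A \<inter> U) \<longrightarrow> P z"
    then have "\<forall>\<^sub>F z in nhds 0. \<phi> z \<in> \<phi> ` (A \<inter> U) \<longrightarrow> P (\<phi> z)"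
      using \<phi> by (rule eventually_compose_filterlim)
    with U show "\<forall>\<^sub>F z in nhds 0. z \<in> A \<longrightarrow> P (\<phi> z)"
      by eventually_elim blast
  qed
qed

(* A reduced curve germ is determined by its zero set; it is irreducible iff its reduced
   equation is an irreducible germ. *)
definition plane_branch :: "(complex^2) filter \<Rightarrow> bool" where
  "plane_branch \<Gamma> \<longleftrightarrow> (\<exists>f. irreducible_germ f \<and> \<Gamma> = set_germ {z. f z = 0})"

definition analytically_conjugate :: "(complex^2) filter \<Rightarrow> (complex^2) filter \<Rightarrow> bool" where
  "analytically_conjugate \<Gamma> \<Gamma>' \<longleftrightarrow> (\<exists>\<phi>. biholomorphism_germ \<phi> \<and> filtermap \<phi> \<Gamma> = \<Gamma>')"

definition singular_vector_field :: "(complex^2 \<Rightarrow> complex^2) \<Rightarrow> bool" where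
  "singular_vector_field X \<longleftrightarrow> holomorphic_map_at X 0 \<and> X 0 = 0"

definition nilpotent_vector_field :: "(complex^2 \<Rightarrow> complex^2) \<Rightarrow> bool" where
  "nilpotent_vector_field X \<longleftrightarrow>
     singular_vector_field X \<and> (\<exists>L n. (X has_derivative L) (at 0) \<and> L ^^ n = (\<lambda>_. 0))"

definition linear_vector_field :: "(complex^2 \<Rightarrow> complex^2) \<Rightarrow> bool" where
  "linear_vector_field Y \<longleftrightarrow> (\<exists>B :: complex^2^2. Y = (\<lambda>z. B *v z))"

(* c is an integral curve of X over [0,1] staying in the domain of holomorphy of the chosen
   representative X. *)
definition integral_curve :: "(complex^2 \<Rightarrow> complex^2) \<Rightarrow> (real \<Rightarrow> complex^2) \<Rightarrow> bool" where
  "integral_curve X c \<longleftrightarrow>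
     (\<forall>t\<in>{0..1}. holomorphic_map_at X (c t) \<and>
                 (c has_vector_derivative X (c t)) (at t within {0..1}))"

(* exp(X), the time-one flow. By uniqueness of integral curves the description is proper
   wherever an integral curve over [0,1] exists; for X vanishing at the origin this holds on
   a neighbourhood of the origin, and the germ there depends only on the germ of X. *)
definition exp_vf :: "(complex^2 \<Rightarrow> complex^2) \<Rightarrow> complex^2 \<Rightarrow> complex^2" where
  "exp_vf X p = (THE q. \<exists>c. integral_curve X c \<and> c 0 = p \<and> c 1 = q)"

end

theory Submission
  imports Defs "HOL-Complex_Analysis.Complex_Analysis"
begin

text \<open>
  Write the conjugacy as \<open>L \<circ> \<psi>\<close> with \<open>L\<close> linear, hence \<open>L = exp Y\<close>, and \<open>\<psi>\<close> tangent to the identity.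
  Let \<open>f = 0\<close> be an equation of the branch and put \<open>\<kappa> = \<psi>\<^sup>-\<^sup>1\<close>, so that \<open>P = f \<circ> \<kappa>\<close> is an
  equation of the image. If \<open>P\<close> divides \<open>f\<close>, the branch is invariant and \<open>X = 0\<close> works.

  Otherwise, for a suitable direction \<open>e\<close>, neither \<open>f\<close> nor the derivative \<open>D\<^sub>e P\<close> is divisible by
  the irreducible germ \<open>P\<close>, so the ideal \<open>(P, f \<cdot> D\<^sub>e P)\<close> contains a power of the maximal ideal.
  The formal infinitesimal generator of \<open>\<kappa>\<close> may diverge, but Newton-like corrections
  \<open>X \<mapsto> X + (\<kappa> - exp X)\<close> give a holomorphic \<open>X\<close> of order two with \<open>exp X = \<kappa>\<close> up to any
  prescribed order. Then \<open>r = f \<circ> exp X - P\<close> lies in that ideal, and the path method along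
  \<open>P + t r\<close>, with a time-dependent vector field divisible by \<open>f\<close>, yields a biholomorphism \<open>\<theta>\<close> that
  preserves \<open>f = 0\<close> and maps \<open>P = 0\<close> to \<open>f \<circ> exp X = 0\<close>. Pulling \<open>-X\<close> back by \<open>\<theta>\<close> gives a vector
  field whose time one flow \<open>\<theta>\<^sup>-\<^sup>1 \<circ> exp (-X) \<circ> \<theta>\<close> maps \<open>f = 0\<close> onto \<open>P = 0\<close>, exactly.
\<close>

no_notation fps_nth (infixl "$" 75)

section \<open>Holomorphic functions of two variables\<close>

text \<open>Only the image of one curve has to be matched, not the map \<kappa>, and a change of
  coordinates preserving \<open>f = 0\<close> is free, since it conjugates a flow to a flow. This
  freedom replaces the missing convergence by a condition of finite order. The ideal
  \<open>(P, f * D_e P)\<close> consists of the available infinitesimal moves: multiples of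
  \<open>P\<close> rescale the equation, and a field \<open>b * f * e\<close> moves \<open>P\<close>
  by a multiple of \<open>f * D_e P\<close> while its flow keeps \<open>f = 0\<close>. Finite
  codimension of the ideal means that agreement with \<kappa> to sufficiently high order can be
  corrected to an exact match. The direction \<open>e\<close> is one along which \<open>P\<close> is
  not identically zero: an identity \<open>D_e P = a * P\<close> would be a linear differential
  equation with zero initial value on that line. Equations count only up to units, so it suffices
  that they solve scalar linear differential equations along a flow, whose solutions are zero at all
  times or at none. All fields except \<open>Y\<close> have order at least two. This makes their
  Lipschitz constants small near the origin, their flows tangent to the identity, and
  \<open>X\<close> nilpotent with zero linear part.\<close>

lemma continuous_on_deriv_param:
  fixes g :: "'a::t2_space \<Rightarrow> complex \<Rightarrow> complex"
  assumes cont: "continuous_on (T \<times> U) (\<lambda>(t, z). g t z)" and "open U"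
    and hol: "\<And>t. t \<in> T \<Longrightarrow> g t holomorphic_on U"
  shows "continuous_on (T \<times> U) (\<lambda>(t, z). deriv (g t) z)"
proof -
  have "continuous (at (t0, z0) within T \<times> U) (\<lambda>(t, z). deriv (g t) z)"
    if t0: "t0 \<in> T" and z0: "z0 \<in> U" for t0 z0
  proof -
    obtain R where R: "R > 0" "cball z0 R \<subseteq> U"
      using \<open>open U\<close> z0 open_contains_cball by blast
    \<comment> \<open>Cauchy's formula for the derivative, over a circle fixed around
      \<open>z0\<close>. For \<open>z\<close> in the open disc the denominator does not vanish, so
      the integrand is continuous in all variables and continuity passes through the
      integral.\<close>
    define G where "G = (\<lambda>x s. (case x of (t, z) \<Rightarrow> g t (circlepath z0 R s) / (circlepath z0 R s - z)^2
        * vector_derivative (circlepath z0 R) (at s)))"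
    have circ: "circlepath z0 R s \<in> cball z0 R" "dist z0 (circlepath z0 R s) = R" for s
      using R by (auto simp: circlepath dist_norm norm_mult)
    have cg: "continuous_on ((T \<times> ball z0 R) \<times> cbox 0 1) (\<lambda>(x, s). G x s)"
    proof -
      have "continuous_on ((T \<times> ball z0 R) \<times> cbox (0::real) 1)
          ((\<lambda>(t, z). g t z) \<circ> (\<lambda>((t, z), s). (t, circlepath z0 R s)))"
        apply (intro continuous_on_compose continuous_on_subset[OF cont])
        subgoal unfolding circlepath case_prod_beta by (intro continuous_intros)
        subgoal using circ R by auto
        done
      moreover have "circlepath z0 R s - z \<noteq> 0" if "z \<in> ball z0 R" for z s
        using circ(2)[of s] that by auto
      ultimately show ?thesis
        unfolding G_def vector_derivative_circlepath
        apply (simp add: case_prod_beta o_def)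
        apply (intro continuous_intros)
            apply (auto simp: circlepath intro!: continuous_intros)
        done
    qed
    have "continuous_on (T \<times> ball z0 R) (\<lambda>x. integral (cbox 0 1) (G x))"
      using cg by (rule integral_continuous_on_param)
    hence "continuous_on (T \<times> ball z0 R)
        (\<lambda>x. 1 / (2 * of_real pi * \<i>) * integral (cbox 0 1) (G x))"
      by (intro continuous_intros)
    moreover have "1 / (2 * of_real pi * \<i>) * integral (cbox 0 1) (G x) = (\<lambda>(t, z). deriv (g t) z) x"
      if "x \<in> T \<times> ball z0 R" for x
    proof -
      obtain t z where x: "x = (t, z)" "t \<in> T" "z \<in> ball z0 R" using \<open>x \<in> _\<close> by auto
      have "(g t has_field_derivative (1 / (2 * of_real pi * \<i>) *
          contour_integral (circlepath z0 R) (\<lambda>u. g t u / (u - z)^2))) (at z)"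
        using x holomorphic_on_subset[OF hol[OF x(2)] R(2)]
        by (intro Cauchy_derivative_integral_circlepath)
          (auto intro: holomorphic_on_subset[OF _ ball_subset_cball] holomorphic_on_imp_continuous_on)
      from DERIV_imp_deriv[OF this] show ?thesis
        by (simp add: x(1) G_def contour_integral_integral)
    qed
    ultimately have "continuous_on (T \<times> ball z0 R) (\<lambda>(t, z). deriv (g t) z)"
      by (metis (mono_tags, lifting) continuous_on_cong)
    hence "continuous (at (t0, z0) within T \<times> ball z0 R) (\<lambda>(t, z). deriv (g t) z)"
      using t0 R by (simp add: continuous_on_eq_continuous_within)
    moreover have "at (t0, z0) within T \<times> U = at (t0, z0) within T \<times> ball z0 R"
    proof (rule at_within_nhd[where S="UNIV \<times> ball z0 R"])
      show "open (UNIV \<times> ball z0 R)" by (intro open_Times) auto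
      have "ball z0 R \<subseteq> U" using R(2) ball_subset_cball by blast
      then show "T \<times> U \<inter> UNIV \<times> ball z0 R - {(t0, z0)} = T \<times> ball z0 R \<inter> UNIV \<times> ball z0 R - {(t0, z0)}"
        by auto
    qed (use R in auto)
    ultimately show ?thesis by simp
  qed
  thus ?thesis by (auto simp: continuous_on_eq_continuous_within)
qed

text \<open>Differentiation under the integral sign needs a jointly continuous derivative, which
  \<open>continuous_on_deriv_param\<close> supplies from joint continuity of \<open>g\<close> and
  holomorphy in \<open>z\<close>.\<close>

lemma holomorphic_on_integral_param:
  fixes g :: "real \<Rightarrow> complex \<Rightarrow> complex"
  assumes cont: "continuous_on ({a..b} \<times> U) (\<lambda>(t, z). g t z)" and "open U"
    and hol: "\<And>t. t \<in> {a..b} \<Longrightarrow> g t holomorphic_on U"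
  shows "(\<lambda>z. integral {a..b} (\<lambda>t. g t z)) holomorphic_on U"
proof -
  have "(\<lambda>z. integral {a..b} (\<lambda>t. g t z)) field_differentiable at z0" if "z0 \<in> U" for z0
  proof -
    obtain R where R: "R > 0" "ball z0 R \<subseteq> U"
      using \<open>open U\<close> \<open>z0 \<in> U\<close> open_contains_ball by blast
    have sw: "continuous_on (ball z0 R \<times> cbox a b) (\<lambda>(z, t). h t z)"
      if "continuous_on ({a..b} \<times> U) (\<lambda>(t, z). h t z)" for h :: "real \<Rightarrow> complex \<Rightarrow> complex"
    proof -
      have "continuous_on (ball z0 R \<times> cbox a b) ((\<lambda>(t, z). h t z) \<circ> (\<lambda>(z, t). (t, z)))"
        using R by (intro continuous_on_compose continuous_on_subset[OF that])
          (auto simp: case_prod_beta intro!: continuous_intros)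
      thus ?thesis by (simp add: o_def case_prod_beta)
    qed
    have "(\<lambda>z. integral (cbox a b) (\<lambda>t. g t z)) holomorphic_on ball z0 R"
    proof (rule leibniz_rule_holomorphic[where fx="\<lambda>z t. deriv (g t) z"])
      show "((\<lambda>x. g t x) has_field_derivative deriv (g t) x) (at x within ball z0 R)"
        if "x \<in> ball z0 R" "t \<in> cbox a b" for x t
        using that R hol[of t] \<open>open U\<close>
        by (metis box_real(2) has_field_derivative_at_within holomorphic_derivI subsetD)
      show "continuous_on (ball z0 R \<times> cbox a b) (\<lambda>(x, t). deriv (g t) x)"
        by (rule sw) (use assms in \<open>intro continuous_on_deriv_param\<close>)
      show "(\<lambda>t. g t x) integrable_on cbox a b" if "x \<in> ball z0 R" for x
      proof (rule integrable_continuous)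
        have "continuous_on (cbox a b) ((\<lambda>(z, t). g t z) \<circ> (\<lambda>t. (x, t)))"
          using that by (intro continuous_on_compose continuous_on_subset[OF sw[OF cont]])
            (auto intro!: continuous_intros)
        thus "continuous_on (cbox a b) (\<lambda>t. g t x)" by (simp add: o_def)
      qed
    qed auto
    thus ?thesis using R
      by (metis box_real(2) centre_in_ball holomorphic_on_imp_differentiable_at open_ball)
  qed
  thus ?thesis by (simp add: field_differentiable_at_within holomorphic_on_def)
qed

section \<open>Complex differentiability in two variables and Osgood's lemma\<close>

definition holo :: "(complex^2 \<Rightarrow> complex) \<Rightarrow> (complex^2) set \<Rightarrow> bool" where
  "holo f U \<longleftrightarrow> (\<forall>q\<in>U. \<exists>a b. (f has_derivative (\<lambda>h. a * h $ 1 + b * h $ 2)) (at q))"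

text \<open>Taking the derivative of a slice makes the one-variable Cauchy estimates directly
  available. Where \<open>f\<close> is \<open>holo\<close>, the value is the complex linear
  differential applied to \<open>v\<close>.\<close>

definition ddir :: "complex^2 \<Rightarrow> (complex^2 \<Rightarrow> complex) \<Rightarrow> complex^2 \<Rightarrow> complex" where
  "ddir v f z = deriv (\<lambda>\<tau>. f (z + \<tau> *s v)) 0"

abbreviation ex :: "complex^2" where "ex \<equiv> axis 1 1"
abbreviation ey :: "complex^2" where "ey \<equiv> axis 2 1"

lemma holomorphic_at_iff: "holomorphic_at f p \<longleftrightarrow> (\<exists>U. open U \<and> p \<in> U \<and> holo f U)"
  unfolding holomorphic_at_def eventually_nhds holo_def by auto

lemma norm_smult: "norm (\<tau> *s (v::complex^2)) = norm \<tau> * norm v"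
  by (simp add: norm_vec_def L2_set_def norm_mult power_mult_distrib UNIV_2 flip: distrib_left)
     (simp add: real_sqrt_mult)

lemma bounded_linear_smult_left: "bounded_linear (\<lambda>\<tau>. \<tau> *s (v::complex^2))"
  by (rule bounded_linear_intro[where K="norm v"])
     (auto simp: vec_eq_iff algebra_simps norm_smult)

lemma smult_eq: "\<tau> *s (v::complex^2) = (\<chi> i. \<tau> * v $ i)"
  by (simp add: vec_eq_iff)

lemma continuous_on_smult [continuous_intros]:
  fixes g :: "'a::topological_space \<Rightarrow> complex^2"
  assumes "continuous_on S f" "continuous_on S g"
  shows "continuous_on S (\<lambda>x. f x *s g x)"
  unfolding smult_eq by (intro continuous_intros assms)

lemma vec2_eq: "(h::complex^2) = h $ 1 *s ex + h $ 2 *s ey"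
  by (simp add: vec_eq_iff forall_2 axis_def)

text \<open>Total differentiability at a point follows from the two partial derivatives once one of
  them is continuous nearby; here it is the partial derivative in \<open>y\<close>, continuous by
  Cauchy's formula. Limits and integrals are later shown to be holomorphic by checking continuity
  and slices only.\<close>

lemma osgood:
  assumes "open U" and cont: "continuous_on U f"
    and dx: "\<And>z. z \<in> U \<Longrightarrow> (\<lambda>\<tau>. f (z + \<tau> *s ex)) field_differentiable at 0"
    and dy: "\<And>z. z \<in> U \<Longrightarrow> (\<lambda>\<tau>. f (z + \<tau> *s ey)) field_differentiable at 0"
  shows "holo f U"
  unfolding holo_def
proof
  fix q assume "q \<in> U"
  then obtain R0 where "R0 > 0" "ball q R0 \<subseteq> U"
    using \<open>open U\<close> open_contains_ball[of U] by auto
  \<comment> \<open>Twice the radius, so that moving a point of \<open>ball q R\<close> by less than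
    \<open>R\<close> along an axis stays in \<open>U\<close>.\<close>
  hence "\<exists>R>0. ball q (2*R) \<subseteq> U" by (intro exI[of _ "R0/2"]) auto
  then obtain R where R: "R > 0" "ball q (2*R) \<subseteq> U" by blast
  have nrm: "norm (\<tau> *s ex) = norm \<tau>" "norm (\<tau> *s ey) = norm \<tau>" for \<tau>
    by (auto simp: norm_smult)
  have slice: "(\<lambda>\<tau>. f (z + \<tau> *s e)) field_differentiable at \<tau>0"
    if "z + \<tau>0 *s e \<in> U" "e = ex \<or> e = ey" for z \<tau>0 e
  proof -
    have "(\<lambda>\<tau>. f (z + \<tau>0 *s e + \<tau> *s e)) field_differentiable at 0"
      using dx[OF that(1)] dy[OF that(1)] that(2) by metis
    then obtain D where "((\<lambda>\<tau>. f (z + \<tau>0 *s e + \<tau> *s e)) has_field_derivative D) (at (0::complex))"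
      by (auto simp: field_differentiable_def)
    hence "((\<lambda>\<tau>. f (z + \<tau>0 *s e + \<tau> *s e)) has_field_derivative D) (at (\<tau>0 - \<tau>0))" unfolding diff_self .
    hence "((\<lambda>\<tau>. f (z + \<tau>0 *s e + (\<tau> - \<tau>0) *s e)) has_field_derivative D * 1) (at \<tau>0)"
      by (rule DERIV_chain2) (auto intro!: derivative_eq_intros)
    moreover have "z + \<tau>0 *s e + (\<tau> - \<tau>0) *s e = z + \<tau> *s e" for \<tau>
      by (simp add: vec_eq_iff algebra_simps)
    ultimately show ?thesis by (auto simp: field_differentiable_def)
  qed
  have inU: "z + \<tau> *s e \<in> U" if "z \<in> ball q R" "\<tau> \<in> ball 0 R" "e = ex \<or> e = ey" for z \<tau> e
  proof -
    have "dist q (z + \<tau> *s e) \<le> dist q z + norm (\<tau> *s e)"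
      by (metis add_diff_cancel_left' dist_norm dist_triangle norm_minus_commute)
    also have "\<dots> < 2 * R" using that nrm[of \<tau>] by auto
    finally show ?thesis using R by auto
  qed
  \<comment> \<open>The base point \<open>z\<close> of the slice takes the role of the parameter;
    joint continuity in \<open>z\<close> and \<tau> is then restricted to \<tau> = 0.\<close>
  have cd: "continuous_on (ball q R) (ddir ey f)"
  proof -
    have "continuous_on (ball q R \<times> ball 0 R) (\<lambda>(z, \<tau>). deriv (\<lambda>\<tau>. f (z + \<tau> *s ey)) \<tau>)"
    proof (rule continuous_on_deriv_param)
      have "continuous_on (ball q R \<times> ball 0 R) (f \<circ> (\<lambda>(z, \<tau>). z + \<tau> *s ey))"
        by (intro continuous_on_compose continuous_on_subset[OF cont])
          (auto simp: case_prod_beta intro!: continuous_intros inU)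
      thus "continuous_on (ball q R \<times> ball 0 R) (\<lambda>(z, \<tau>). f (z + \<tau> *s ey))"
        by (simp add: o_def case_prod_beta)
      show "(\<lambda>\<tau>. f (z + \<tau> *s ey)) holomorphic_on ball 0 R" if "z \<in> ball q R" for z
        unfolding holomorphic_on_def
        by (intro ballI field_differentiable_at_within[OF slice] inU that disjI2 refl)
    qed auto
    note cd' = this
    have c0: "continuous_on (ball q R) (\<lambda>z. (z, 0::complex))" by (intro continuous_intros)
    have "(\<lambda>z. (z, 0)) ` ball q R \<subseteq> ball q R \<times> ball 0 R" using R by auto
    from continuous_on_compose2[OF cd' c0 this] show ?thesis
      by (simp add: ddir_def[abs_def])
  qed
  define F where "F = (\<lambda>x y. f (x *s ex + y *s ey))"
  define p where "p = (\<lambda>x y. x *s ex + y *s ey :: complex^2)"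
  have p_comp [simp]: "p x y $ 1 = x" "p x y $ 2 = y" for x y by (auto simp: p_def axis_def)
  have q: "q = p (q$1) (q$2)" by (simp add: p_def flip: vec2_eq)
  define r where "r = R / 2"
  have r: "r > 0" using R by (simp add: r_def)
  have pb: "p x y \<in> ball q R" if "x \<in> ball (q$1) r" "y \<in> ball (q$2) r" for x y
  proof -
    have "p x y - q = (x - q$1) *s ex + (y - q$2) *s ey"
      by (simp add: vec_eq_iff forall_2 axis_def)
    hence "norm (p x y - q) \<le> norm (x - q$1) + norm (y - q$2)"
      by (metis norm_triangle_ineq nrm)
    also have "\<dots> < R" using that by (simp add: dist_norm norm_minus_commute r_def)
    finally show ?thesis by (simp add: dist_norm norm_minus_commute)
  qed
  have ballU: "ball q R \<subseteq> U" using R by (intro subset_trans[OF subset_ball R(2)]) simp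
  have d2: "((\<lambda>(x, y). F x y) has_derivative
      (\<lambda>(tx, ty). (deriv (\<lambda>\<tau>. f (q + \<tau> *s ex)) 0) * tx + blinfun_mult_right (ddir ey f (p (q$1) (q$2))) ty))
      (at (q$1, q$2) within ball (q$1) r \<times> ball (q$2) r)"
  proof (rule has_derivative_partialsI[where fy="\<lambda>x y. blinfun_mult_right (ddir ey f (p x y))"])
    have "((\<lambda>x. F x (q$2)) has_field_derivative (deriv (\<lambda>\<tau>. f (q + \<tau> *s ex)) 0)) (at (q$1))"
    proof -
      have "((\<lambda>\<tau>. f (q + \<tau> *s ex)) has_field_derivative (deriv (\<lambda>\<tau>. f (q + \<tau> *s ex)) 0)) (at (q$1 - q$1))"
        using dx[OF \<open>q \<in> U\<close>] by (simp add: DERIV_deriv_iff_field_differentiable)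
      hence "((\<lambda>x. f (q + (x - q$1) *s ex)) has_field_derivative (deriv (\<lambda>\<tau>. f (q + \<tau> *s ex)) 0) * 1) (at (q$1))"
        by (rule DERIV_chain2) (auto intro!: derivative_eq_intros)
      moreover have "q + (x - q$1) *s ex = x *s ex + q$2 *s ey" for x
        by (simp add: vec_eq_iff forall_2 axis_def)
      ultimately show ?thesis by (simp only: F_def mult_1_right)
    qed
    thus "((\<lambda>x. F x (q $ 2)) has_derivative (*) (deriv (\<lambda>\<tau>. f (q + \<tau> *s ex)) 0)) (at (q $ 1) within ball (q $ 1) r)"
      by (simp add: has_field_derivative_def has_derivative_at_withinI)
    show "((\<lambda>y. F x y) has_derivative blinfun_apply (blinfun_mult_right (ddir ey f (p x y)))) (at y within ball (q $ 2) r)"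
      if "x \<in> ball (q$1) r" "y \<in> ball (q$2) r" for x y
    proof -
      have "((\<lambda>\<tau>. f (p x y + \<tau> *s ey)) has_field_derivative (ddir ey f (p x y))) (at (y - y))"
        using dy[of "p x y"] pb[OF that] ballU
        by (auto simp add: DERIV_deriv_iff_field_differentiable ddir_def)
      hence "((\<lambda>y'. f (p x y + (y' - y) *s ey)) has_field_derivative (ddir ey f (p x y)) * 1) (at y)"
        by (rule DERIV_chain2) (auto intro!: derivative_eq_intros)
      moreover have "p x y + (y' - y) *s ey = x *s ex + y' *s ey" for y'
        by (simp add: vec_eq_iff forall_2 axis_def)
      ultimately have "((\<lambda>y. F x y) has_field_derivative (ddir ey f (p x y))) (at y)" by (simp only: F_def mult_1_right)
      thus ?thesis by (auto simp: has_field_derivative_def intro: has_derivative_at_withinI)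
    qed
    have "continuous_on (ball (q$1) r \<times> ball (q$2) r) (ddir ey f \<circ> (\<lambda>(x, y). p x y))"
      by (intro continuous_on_compose continuous_on_subset[OF cd])
        (auto simp: case_prod_beta p_def[abs_def] intro!: continuous_intros pb[unfolded p_def])
    hence "continuous_on (ball (q$1) r \<times> ball (q$2) r) (\<lambda>(x, y). blinfun_mult_right (ddir ey f (p x y)))"
      by (auto simp: o_def case_prod_beta intro!: continuous_intros)
    thus "continuous (at (q $ 1, q $ 2) within ball (q $ 1) r \<times> ball (q $ 2) r)
        (\<lambda>(x, y). blinfun_mult_right (ddir ey f (p x y)))"
      using r by (auto simp: continuous_on_eq_continuous_within)
  qed (use r in auto)
  have "at (q$1, q$2) within ball (q$1) r \<times> ball (q$2) r = at (q$1, q$2)"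
    using r by (intro at_within_open open_Times) auto
  with d2 have d3: "((\<lambda>(x, y). F x y) has_derivative
      (\<lambda>(tx, ty). (deriv (\<lambda>\<tau>. f (q + \<tau> *s ex)) 0) * tx + ddir ey f q * ty)) (at (q$1, q$2))"
    using q by simp
  have "((\<lambda>z::complex^2. (z$1, z$2)) has_derivative (\<lambda>z. (z$1, z$2))) (at q)"
    by (intro has_derivative_Pair bounded_linear_imp_has_derivative bounded_linear_vec_nth)
  from has_derivative_compose[OF this d3]
  have "((\<lambda>z. F (z$1) (z$2)) has_derivative
      (\<lambda>h. (deriv (\<lambda>\<tau>. f (q + \<tau> *s ex)) 0) * h$1 + ddir ey f q * h$2)) (at q)"
    by simp
  moreover have "F (z$1) (z$2) = f z" for z by (simp add: F_def flip: vec2_eq)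
  ultimately show "\<exists>a b. (f has_derivative (\<lambda>h. a * h $ 1 + b * h $ 2)) (at q)" by auto
qed

lemma holo_subset: "holo f U \<Longrightarrow> V \<subseteq> U \<Longrightarrow> holo f V"
  by (auto simp: holo_def)

lemma holo_cong:
  assumes "open U" "\<And>z. z \<in> U \<Longrightarrow> f z = g z" "holo f U"
  shows "holo g U"
  unfolding holo_def
proof
  fix q assume "q \<in> U"
  with assms(3) obtain a b where "(f has_derivative (\<lambda>h. a * h $ 1 + b * h $ 2)) (at q)"
    by (auto simp: holo_def)
  hence "(g has_derivative (\<lambda>h. a * h $ 1 + b * h $ 2)) (at q)"
    by (rule has_derivative_transform_within_open[OF _ assms(1) \<open>q \<in> U\<close>]) (use assms(2) in auto)
  thus "\<exists>a b. (g has_derivative (\<lambda>h. a * h $ 1 + b * h $ 2)) (at q)" by blast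
qed

lemma slice_derivative:
  fixes f :: "complex^2 \<Rightarrow> complex"
  assumes "(f has_derivative (\<lambda>h. a * h $ 1 + b * h $ 2)) (at (z + \<tau>0 *s v))"
  shows "((\<lambda>\<tau>. f (z + \<tau> *s v)) has_field_derivative (a * v $ 1 + b * v $ 2)) (at \<tau>0)"
proof -
  have "((\<lambda>\<tau>. z + \<tau> *s v) has_derivative (\<lambda>h. h *s v)) (at \<tau>0)"
    using has_derivative_add[OF has_derivative_const[of z "at \<tau>0"]
      bounded_linear_imp_has_derivative[OF bounded_linear_smult_left]]
    by simp
  from has_derivative_compose[OF this assms]
  have "((\<lambda>\<tau>. f (z + \<tau> *s v)) has_derivative (\<lambda>h. a * (h *s v) $ 1 + b * (h *s v) $ 2)) (at \<tau>0)" .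
  moreover have "(\<lambda>h. a * (h *s v) $ 1 + b * (h *s v) $ 2) = (*) (a * v $ 1 + b * v $ 2)"
    by (auto simp: algebra_simps)
  ultimately show ?thesis by (simp only: has_field_derivative_def)
qed

lemma holo_ddir_rep:
  assumes "holo f U" "q \<in> U"
  obtains a b where "(f has_derivative (\<lambda>h. a * h $ 1 + b * h $ 2)) (at q)"
    "\<And>v. ddir v f q = a * v $ 1 + b * v $ 2"
proof -
  from assms obtain a b where *: "(f has_derivative (\<lambda>h. a * h $ 1 + b * h $ 2)) (at q)"
    by (auto simp: holo_def)
  have "ddir v f q = a * v $ 1 + b * v $ 2" for v
    unfolding ddir_def using slice_derivative[of f a b q 0 v] * by (simp add: DERIV_imp_deriv)
  with * show ?thesis using that by blast
qed

lemma holo_has_derivative: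
  assumes "holo f U" "q \<in> U"
  shows "(f has_derivative (\<lambda>h. ddir h f q)) (at q)"
proof -
  from holo_ddir_rep[OF assms] obtain a b where ab: "(f has_derivative (\<lambda>h. a * h $ 1 + b * h $ 2)) (at q)"
    "\<And>v. ddir v f q = a * v $ 1 + b * v $ 2" by blast
  show ?thesis unfolding ab(2) by (rule ab(1))
qed

lemma ddir_eq:
  assumes "holo f U" "q \<in> U"
  shows "ddir v f q = v $ 1 * ddir ex f q + v $ 2 * ddir ey f q"
proof -
  from holo_ddir_rep[OF assms] obtain a b where "\<And>v. ddir v f q = a * v $ 1 + b * v $ 2" by blast
  thus ?thesis by (simp add: axis_def)
qed

lemma holo_has_derivative_xy:
  assumes "holo f U" "q \<in> U"
  shows "(f has_derivative (\<lambda>h. ddir ex f q * h $ 1 + ddir ey f q * h $ 2)) (at q)"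
proof -
  from holo_ddir_rep[OF assms] obtain a b where ab: "(f has_derivative (\<lambda>h. a * h $ 1 + b * h $ 2)) (at q)"
    "\<And>v. ddir v f q = a * v $ 1 + b * v $ 2" by blast
  from ab(1) show ?thesis by (simp add: ab(2) axis_def)
qed

lemma ddir_smult:
  assumes "holo f U" "q \<in> U"
  shows "ddir (c *s v) f q = c * ddir v f q"
  using ddir_eq[OF assms, of "c *s v"] ddir_eq[OF assms, of v] by (simp add: algebra_simps)

lemma holo_slice:
  assumes "holo f U" "z + \<tau>0 *s v \<in> U"
  shows "((\<lambda>\<tau>. f (z + \<tau> *s v)) has_field_derivative ddir v f (z + \<tau>0 *s v)) (at \<tau>0)"
proof -
  from holo_ddir_rep[OF assms] obtain a b where ab:
    "(f has_derivative (\<lambda>h. a * h $ 1 + b * h $ 2)) (at (z + \<tau>0 *s v))"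
    "\<And>v'. ddir v' f (z + \<tau>0 *s v) = a * v' $ 1 + b * v' $ 2" by blast
  show ?thesis unfolding ab(2) by (rule slice_derivative[OF ab(1)])
qed

lemma holo_slice_holomorphic:
  assumes "holo f U" "\<And>\<tau>. \<tau> \<in> T \<Longrightarrow> z + \<tau> *s v \<in> U"
  shows "(\<lambda>\<tau>. f (z + \<tau> *s v)) holomorphic_on T"
proof -
  have "\<exists>D. ((\<lambda>\<tau>. f (z + \<tau> *s v)) has_field_derivative D) (at x within T)" if "x \<in> T" for x
    using holo_slice[OF assms(1) assms(2)[OF that]] has_field_derivative_at_within by blast
  thus ?thesis by (auto simp: holomorphic_on_def field_differentiable_def)
qed

lemma holo_continuous_on: "holo f U \<Longrightarrow> continuous_on U f"
  by (meson continuous_at_imp_continuous_on has_derivative_continuous holo_has_derivative)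

lemma holo_const [simp]: "holo (\<lambda>z. c) U"
  unfolding holo_def by (auto intro!: exI[of _ 0] derivative_eq_intros)

lemma holo_nth [simp]: "holo (\<lambda>z. z $ i) U"
proof -
  have *: "((\<lambda>z::complex^2. z $ i) has_derivative (\<lambda>h. h $ i)) (at q)" for q i
    by (rule bounded_linear_imp_has_derivative[OF bounded_linear_vec_nth])
  show ?thesis
  proof (cases "i = 1")
    case True thus ?thesis unfolding holo_def by (intro ballI exI[of _ 1] exI[of _ 0]) (simp add: *)
  next
    case False hence "i = 2" using exhaust_2 by blast
    thus ?thesis unfolding holo_def by (intro ballI exI[of _ 0] exI[of _ 1]) (simp add: *)
  qed
qed

lemma holo_add:
  assumes "holo f U" "holo g U" shows "holo (\<lambda>z. f z + g z) U"
  unfolding holo_def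
proof
  fix q assume q: "q \<in> U"
  show "\<exists>a b. ((\<lambda>z. f z + g z) has_derivative (\<lambda>h. a * h $ 1 + b * h $ 2)) (at q)"
    using has_derivative_add[OF holo_has_derivative_xy[OF assms(1) q] holo_has_derivative_xy[OF assms(2) q]]
    by (intro exI[of _ "ddir ex f q + ddir ex g q"] exI[of _ "ddir ey f q + ddir ey g q"])
      (simp add: algebra_simps)
qed

lemma holo_mult:
  assumes "holo f U" "holo g U" shows "holo (\<lambda>z. f z * g z) U"
  unfolding holo_def
proof
  fix q assume q: "q \<in> U"
  show "\<exists>a b. ((\<lambda>z. f z * g z) has_derivative (\<lambda>h. a * h $ 1 + b * h $ 2)) (at q)"
    using has_derivative_mult[OF holo_has_derivative_xy[OF assms(1) q] holo_has_derivative_xy[OF assms(2) q]]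
    by (intro exI[of _ "f q * ddir ex g q + ddir ex f q * g q"]
          exI[of _ "f q * ddir ey g q + ddir ey f q * g q"])
      (simp add: algebra_simps)
qed

lemma holo_compose_fun:
  assumes "g holomorphic_on S" "open S" "holo f U" "\<And>z. z \<in> U \<Longrightarrow> f z \<in> S"
  shows "holo (\<lambda>z. g (f z)) U"
  unfolding holo_def
proof
  fix q assume q: "q \<in> U"
  have "(g has_derivative (*) (deriv g (f q))) (at (f q))"
    using holomorphic_derivI[OF assms(1,2), of "f q"] assms(4)[OF q] by (simp add: has_field_derivative_def)
  from has_derivative_compose[OF holo_has_derivative_xy[OF assms(3) q] this]
  show "\<exists>a b. ((\<lambda>z. g (f z)) has_derivative (\<lambda>h. a * h $ 1 + b * h $ 2)) (at q)"
    by (intro exI[of _ "deriv g (f q) * ddir ex f q"] exI[of _ "deriv g (f q) * ddir ey f q"])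
      (simp add: algebra_simps)
qed

lemma holo_minus: "holo f U \<Longrightarrow> holo (\<lambda>z. - f z) U"
  using holo_mult[of "\<lambda>z. -1" U f] by simp

lemma holo_diff: "holo f U \<Longrightarrow> holo g U \<Longrightarrow> holo (\<lambda>z. f z - g z) U"
  using holo_add[of f U "\<lambda>z. - g z"] holo_minus[of g U] by simp

lemma holo_inverse: "holo f U \<Longrightarrow> (\<And>z. z \<in> U \<Longrightarrow> f z \<noteq> 0) \<Longrightarrow> holo (\<lambda>z. inverse (f z)) U"
  by (rule holo_compose_fun[of inverse "-{0}" f U])
    (auto intro!: holomorphic_on_inverse[of "\<lambda>z. z"] holomorphic_on_ident)

lemma holo_divide:
  "holo f U \<Longrightarrow> holo g U \<Longrightarrow> (\<And>z. z \<in> U \<Longrightarrow> g z \<noteq> 0) \<Longrightarrow> holo (\<lambda>z. f z / g z) U"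
  unfolding divide_inverse by (intro holo_mult holo_inverse)

lemma holo_power: "holo f U \<Longrightarrow> holo (\<lambda>z. f z ^ n) U"
  by (induction n) (auto intro: holo_mult)

lemma map_has_derivative:
  fixes F :: "complex^2 \<Rightarrow> complex^2"
  assumes "\<And>i. holo (\<lambda>z. F z $ i) U" "q \<in> U"
  shows "(F has_derivative (\<lambda>h. \<chi> i. ddir ex (\<lambda>z. F z $ i) q * h $ 1 + ddir ey (\<lambda>z. F z $ i) q * h $ 2)) (at q)"
proof -
  have "((\<lambda>z. F z $ i *s axis i 1) has_derivative (\<lambda>h. (ddir ex (\<lambda>z. F z $ i) q * h $ 1
      + ddir ey (\<lambda>z. F z $ i) q * h $ 2) *s axis i 1)) (at q)" for i
    by (rule has_derivative_compose[OF holo_has_derivative_xy[OF assms(1,2)]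
        bounded_linear_imp_has_derivative[OF bounded_linear_smult_left]])
  from has_derivative_add[OF this[of 1] this[of 2]] show ?thesis
    unfolding vec2_eq[symmetric]
    by (rule has_derivative_eq_rhs) (auto simp: fun_eq_iff vec_eq_iff forall_2 axis_def)
qed

lemma holo_compose:
  fixes F :: "complex^2 \<Rightarrow> complex^2"
  assumes "holo f V" "\<And>i. holo (\<lambda>z. F z $ i) U" "\<And>z. z \<in> U \<Longrightarrow> F z \<in> V"
  shows "holo (\<lambda>z. f (F z)) U"
  unfolding holo_def
proof
  fix q assume q: "q \<in> U"
  show "\<exists>a b. ((\<lambda>z. f (F z)) has_derivative (\<lambda>h. a * h $ 1 + b * h $ 2)) (at q)"
    using has_derivative_compose[OF map_has_derivative[of F, OF assms(2) q]
        holo_has_derivative_xy[OF assms(1) assms(3)[OF q]]]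
    by (intro exI[of _ "ddir ex (\<lambda>z. F z $ 1) q * ddir ex f (F q) + ddir ex (\<lambda>z. F z $ 2) q * ddir ey f (F q)"]
          exI[of _ "ddir ey (\<lambda>z. F z $ 1) q * ddir ex f (F q) + ddir ey (\<lambda>z. F z $ 2) q * ddir ey f (F q)"])
      (simp add: algebra_simps)
qed

text \<open>By Osgood's lemma it is enough to apply Weierstrass's theorem on limits of holomorphic
  functions to each slice.\<close>

lemma holo_uniform_limit:
  assumes "open U" "\<And>n. holo (f n) U" "uniform_limit U f g sequentially"
  shows "holo g U"
proof (rule osgood[OF \<open>open U\<close>])
  show "continuous_on U g"
    by (rule uniform_limit_theorem[OF _ assms(3)]) (auto intro!: always_eventually holo_continuous_on assms(2))
  have "(\<lambda>\<tau>. g (z + \<tau> *s e)) field_differentiable at 0" if "z \<in> U" "norm e = 1" for z e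
  proof -
    obtain R where R: "R > 0" "cball z R \<subseteq> U" using \<open>open U\<close> \<open>z \<in> U\<close> open_contains_cball by blast
    have inU: "z + \<tau> *s e \<in> U" if "\<tau> \<in> cball 0 R" for \<tau>
      using that R \<open>norm e = 1\<close> by (auto simp: dist_norm norm_smult intro!: subsetD[OF R(2)])
    have ul: "uniform_limit (cball 0 R) (\<lambda>n \<tau>. f n (z + \<tau> *s e)) (\<lambda>\<tau>. g (z + \<tau> *s e)) sequentially"
      by (rule uniform_limit_compose'[OF assms(3)]) (use inU in auto)
    have hol: "(\<lambda>\<tau>. f n (z + \<tau> *s e)) holomorphic_on cball 0 R" for n
      by (rule holo_slice_holomorphic[OF assms(2)]) (rule inU)
    have "(\<lambda>\<tau>. g (z + \<tau> *s e)) holomorphic_on ball 0 R"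
      by (rule holomorphic_uniform_limit[OF _ ul])
        (auto intro!: always_eventually holomorphic_on_imp_continuous_on[OF hol]
          holomorphic_on_subset[OF hol ball_subset_cball])
    thus ?thesis using R by (intro holomorphic_on_imp_differentiable_at[of _ "ball 0 R"]) auto
  qed
  thus "\<And>z. z \<in> U \<Longrightarrow> (\<lambda>\<tau>. g (z + \<tau> *s ex)) field_differentiable at 0"
    "\<And>z. z \<in> U \<Longrightarrow> (\<lambda>\<tau>. g (z + \<tau> *s ey)) field_differentiable at 0" by auto
qed

lemma continuous_on_case_prod_compose:
  assumes "continuous_on (T \<times> U) (\<lambda>(t, z). f t z)" "continuous_on S g" "continuous_on S h"
    "\<And>x. x \<in> S \<Longrightarrow> g x \<in> T \<and> h x \<in> U"
  shows "continuous_on S (\<lambda>x. f (g x) (h x))"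
  using continuous_on_compose2[OF assms(1), of S "\<lambda>x. (g x, h x)"] assms
  by (auto intro!: continuous_intros)

text \<open>Joint continuity makes the integral continuous in \<open>z\<close>, and each slice is a
  one-variable integral with parameter, so Osgood's lemma applies.\<close>

lemma holo_integral:
  fixes f :: "real \<Rightarrow> complex^2 \<Rightarrow> complex"
  assumes "open U" and cont: "continuous_on ({a..b} \<times> U) (\<lambda>(t, z). f t z)"
    and hol: "\<And>t. t \<in> {a..b} \<Longrightarrow> holo (f t) U"
  shows "holo (\<lambda>z. integral {a..b} (\<lambda>t. f t z)) U"
proof (rule osgood[OF \<open>open U\<close>])
  have "continuous_on (U \<times> cbox a b) (\<lambda>(z, t). f t z)"
    unfolding case_prod_beta
    by (rule continuous_on_case_prod_compose[OF cont]) (auto intro!: continuous_intros)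
  from integral_continuous_on_param[OF this]
  show "continuous_on U (\<lambda>z. integral {a..b} (\<lambda>t. f t z))" by simp
  have "(\<lambda>\<tau>. integral {a..b} (\<lambda>t. f t (z + \<tau> *s e))) field_differentiable at 0"
    if "z \<in> U" "norm e = 1" for z e
  proof -
    obtain R where R: "R > 0" "cball z R \<subseteq> U" using \<open>open U\<close> \<open>z \<in> U\<close> open_contains_cball by blast
    have inU: "z + \<tau> *s e \<in> U" if "\<tau> \<in> ball 0 R" for \<tau>
      using that R \<open>norm e = 1\<close> by (auto simp: dist_norm norm_smult intro!: subsetD[OF R(2)])
    have "(\<lambda>\<tau>. integral {a..b} (\<lambda>t. f t (z + \<tau> *s e))) holomorphic_on ball 0 R"
    proof (rule holomorphic_on_integral_param)
      show "continuous_on ({a..b} \<times> ball 0 R) (\<lambda>(t, \<tau>). f t (z + \<tau> *s e))"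
        unfolding case_prod_beta
        by (rule continuous_on_case_prod_compose[OF cont]) (use inU in \<open>auto intro!: continuous_intros\<close>)
      show "(\<lambda>\<tau>. f t (z + \<tau> *s e)) holomorphic_on ball 0 R" if "t \<in> {a..b}" for t
        by (rule holo_slice_holomorphic[OF hol[OF that]]) (rule inU)
    qed simp
    thus ?thesis using R by (intro holomorphic_on_imp_differentiable_at[of _ "ball 0 R"]) auto
  qed
  thus "\<And>z. z \<in> U \<Longrightarrow> (\<lambda>\<tau>. integral {a..b} (\<lambda>t. f t (z + \<tau> *s ex))) field_differentiable at 0"
    "\<And>z. z \<in> U \<Longrightarrow> (\<lambda>\<tau>. integral {a..b} (\<lambda>t. f t (z + \<tau> *s ey))) field_differentiable at 0" by auto
qed

lemma holo_local:
  assumes "\<And>z. z \<in> U \<Longrightarrow> \<exists>V. open V \<and> z \<in> V \<and> holo f V" shows "holo f U"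
  unfolding holo_def
proof
  fix q assume "q \<in> U"
  from assms[OF this] show "\<exists>a b. (f has_derivative (\<lambda>h. a * h $ 1 + b * h $ 2)) (at q)"
    by (auto simp: holo_def)
qed

lemma smult_add_cball:
  fixes z v :: "complex^2"
  shows "norm \<tau> * norm v \<le> r \<Longrightarrow> z + \<tau> *s v \<in> cball z r"
  by (auto simp: dist_norm norm_smult)

text \<open>Cauchy's formula on the slice expresses the derivative as an integral of translates of
  \<open>f\<close> over a circle, and each translate is holomorphic in \<open>z\<close>.\<close>

lemma holo_ddir:
  assumes "open U" "holo f U"
  shows "holo (ddir v f) U"
proof (rule holo_local)
  fix q assume "q \<in> U"
  then obtain R0 where R0: "R0 > 0" "cball q R0 \<subseteq> U" using \<open>open U\<close> open_contains_cball by blast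
  define R where "R = R0 / 2"
  define r where "r = R / (norm v + 1)"
  have R: "R > 0" "r > 0" "r * norm v \<le> R"
    using R0 by (auto simp: R_def r_def field_simps add_pos_nonneg)
  have inU: "z + \<tau> *s v \<in> U" if "z \<in> ball q R" "\<tau> \<in> cball 0 r" for z \<tau>
  proof -
    have "norm \<tau> * norm v \<le> r * norm v" using that by (intro mult_right_mono) auto
    hence "norm (z - q + \<tau> *s v) \<le> 2 * R"
      using norm_triangle_ineq[of "z - q" "\<tau> *s v"] that R by (auto simp: norm_smult dist_norm norm_minus_commute)
    thus ?thesis using R0(2) by (auto simp: R_def dist_norm norm_minus_commute algebra_simps)
  qed
  define g where "g = (\<lambda>s z. 1 / (2 * of_real pi * \<i>) *
    (f (z + circlepath 0 r s *s v) / circlepath 0 r s ^ 2 * vector_derivative (circlepath 0 r) (at s)))"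
  have c: "circlepath 0 r s \<noteq> 0" "circlepath 0 r s \<in> cball 0 r" for s
    using R by (auto simp: circlepath norm_mult)
  have "holo (\<lambda>z. integral {0..1} (\<lambda>s. g s z)) (ball q R)"
  proof (rule holo_integral)
    have "continuous_on ({0..1} \<times> ball q R) (\<lambda>x. f (snd x + circlepath 0 r (fst x) *s v))"
      by (rule continuous_on_compose2[OF holo_continuous_on[OF assms(2)]])
        (use R in \<open>auto simp: circlepath norm_mult intro!: continuous_intros inU\<close>)
    thus "continuous_on ({0..1} \<times> ball q R) (\<lambda>(s, z). g s z)"
      unfolding g_def case_prod_beta vector_derivative_circlepath
      using c by (intro continuous_intros) (auto simp: circlepath intro!: continuous_intros)
    show "holo (g s) (ball q R)" for s
      unfolding g_def using c
      by (intro holo_mult holo_divide holo_compose[OF assms(2)]) (auto intro!: inU holo_add)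
  qed simp
  moreover have "integral {0..1} (\<lambda>s. g s z) = ddir v f z" if "z \<in> ball q R" for z
  proof -
    have hol: "(\<lambda>\<tau>. f (z + \<tau> *s v)) holomorphic_on cball 0 r"
      by (rule holo_slice_holomorphic[OF assms(2)]) (rule inU[OF that])
    have "((\<lambda>\<tau>. f (z + \<tau> *s v)) has_field_derivative (1 / (2 * of_real pi * \<i>) *
        contour_integral (circlepath 0 r) (\<lambda>u. f (z + u *s v) / (u - 0)^2))) (at 0)"
      using R hol by (intro Cauchy_derivative_integral_circlepath)
          (auto intro: holomorphic_on_subset[OF _ ball_subset_cball] holomorphic_on_imp_continuous_on)
    from DERIV_imp_deriv[OF this] show ?thesis
      unfolding ddir_def g_def contour_integral_integral by (simp only: diff_zero integral_mult_right)
  qed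
  ultimately have "holo (ddir v f) (ball q R)"
    by (rule holo_cong[OF open_ball, rotated])
  thus "\<exists>V. open V \<and> q \<in> V \<and> holo (ddir v f) V" using R by (intro exI[of _ "ball q R"]) auto
qed

text \<open>Cauchy's inequality on the disc of radius \<open>r / norm v\<close>, which the slice
  maps into the ball of radius \<open>r\<close>.\<close>

lemma ddir_bound:
  assumes "holo f U" "r > 0" "cball z r \<subseteq> U" "\<And>w. w \<in> cball z r \<Longrightarrow> norm (f w) \<le> B"
  shows "norm (ddir v f z) \<le> B / r * norm v"
proof (cases "v = 0")
  case True
  have "z \<in> U" using assms by auto
  from ddir_smult[OF assms(1) this, of 0 v] True show ?thesis by simp
next
  case False
  define s where "s = r / norm v"
  have s: "s > 0" "s * norm v = r" using False assms by (auto simp: s_def)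
  have inB: "z + \<tau> *s v \<in> cball z r" if "norm \<tau> \<le> s" for \<tau>
    using mult_right_mono[OF that, of "norm v"] s by (intro smult_add_cball) auto
  have hol: "(\<lambda>\<tau>. f (z + \<tau> *s v)) holomorphic_on cball 0 s"
    by (rule holo_slice_holomorphic[OF assms(1)]) (use inB assms(3) in auto)
  have "norm ((deriv ^^ 1) (\<lambda>\<tau>. f (z + \<tau> *s v)) 0) \<le> fact 1 * B / s ^ 1"
    using s inB assms(4) hol
    by (intro Cauchy_inequality)
      (auto intro: holomorphic_on_subset[OF _ ball_subset_cball] holomorphic_on_imp_continuous_on)
  thus ?thesis using s False by (simp add: ddir_def s_def field_simps)
qed

lemma holo_lipschitz:
  assumes "holo f U" "convex S" "S \<subseteq> U" "\<And>w v. w \<in> S \<Longrightarrow> norm (ddir v f w) \<le> B * norm v"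
    and "x \<in> S" "y \<in> S"
  shows "norm (f x - f y) \<le> B * norm (x - y)"
proof (rule differentiable_bound[OF assms(2)])
  fix w assume w: "w \<in> S"
  show "(f has_derivative (\<lambda>h. ddir h f w)) (at w within S)"
    using holo_has_derivative[OF assms(1)] w assms(3) by (blast intro: has_derivative_at_withinI)
  show "onorm (\<lambda>h. ddir h f w) \<le> B"
    by (rule onorm_le) (rule assms(4)[OF w])
qed (use assms in auto)

text \<open>Each point of the ball of radius \<open>r\<close> is the centre of a ball of radius
  \<open>r\<close> inside the ball of radius \<open>2 * r\<close>, so Cauchy's inequality bounds the
  differential. The constant has size \<open>r ^ (k - 1)\<close>, which is small for
  \<open>k\<close> at least two; the contraction estimates for flows rest on this.\<close>

lemma holo_lipschitz_order:
  assumes "holo f (ball 0 R)" "\<And>w. w \<in> ball 0 R \<Longrightarrow> norm (f w) \<le> C * norm w ^ k"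
    and "0 < r" "2 * r < R" "C \<ge> 0" "x \<in> cball 0 r" "y \<in> cball 0 r"
  shows "norm (f x - f y) \<le> C * (2 * r) ^ k / r * norm (x - y)"
proof (rule holo_lipschitz[OF assms(1), of "cball 0 r"])
  fix w v :: "complex^2" assume w: "w \<in> cball 0 r"
  have sub: "norm u \<le> 2 * r" if "u \<in> cball w r" for u :: "complex^2"
    using that w norm_triangle_ineq[of w "u - w"] by (auto simp: dist_norm norm_minus_commute)
  show "norm (ddir v f w) \<le> C * (2 * r) ^ k / r * norm v"
  proof (rule ddir_bound[OF assms(1)])
    show "cball w r \<subseteq> ball 0 R" using sub assms by force
    show "norm (f u) \<le> C * (2 * r) ^ k" if "u \<in> cball w r" for u
    proof -
      have "norm (f u) \<le> C * norm u ^ k" using assms(2)[of u] sub[OF that] assms(4) by simp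
      also have "\<dots> \<le> C * (2 * r) ^ k"
        using sub[OF that] assms(5) by (intro mult_left_mono power_mono) auto
      finally show ?thesis .
    qed
  qed fact
qed (use assms in auto)

section \<open>Germs and their order of vanishing\<close>

lemma eventually_nhds_compose:
  assumes "isCont F p" "\<forall>\<^sub>F z in nhds (F p). P z"
  shows "\<forall>\<^sub>F z in nhds p. P (F z)"
  using assms(1)[unfolded isCont_def tendsto_at_iff_tendsto_nhds] assms(2) by (simp add: filterlim_iff)

lemma eventually_nhds_ballI:
  assumes "R > 0" "\<And>z. z \<in> ball p R \<Longrightarrow> P z"
  shows "\<forall>\<^sub>F z in nhds p. P z"
  unfolding eventually_nhds using assms by (intro exI[of _ "ball p R"]) auto

lemma eventually_nhds_ballE:
  assumes "\<forall>\<^sub>F z in nhds (p::'a::metric_space). P z"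
  obtains R where "R > 0" "\<And>z. z \<in> ball p R \<Longrightarrow> P z"
  using assms unfolding eventually_nhds_metric by (auto simp: dist_commute)

lemma holomorphic_atE:
  assumes "holomorphic_at f p"
  obtains R where "R > 0" "holo f (ball p R)"
  using assms holo_subset unfolding holomorphic_at_iff by (meson open_contains_ball)

lemma holomorphic_atI: "holo f U \<Longrightarrow> open U \<Longrightarrow> p \<in> U \<Longrightarrow> holomorphic_at f p"
  by (auto simp: holomorphic_at_iff)

lemma holomorphic_at_ballI: "holo f (ball p R) \<Longrightarrow> R > 0 \<Longrightarrow> holomorphic_at f p"
  by (rule holomorphic_atI) auto

lemma holomorphic_at_binop:
  assumes "holomorphic_at f p" "holomorphic_at g p"
    and "\<And>U. holo f U \<Longrightarrow> holo g U \<Longrightarrow> holo h U"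
  shows "holomorphic_at h p"
proof -
  obtain U V where "open U" "p \<in> U" "holo f U" "open V" "p \<in> V" "holo g V"
    using assms(1,2) unfolding holomorphic_at_iff by blast
  hence "holo h (U \<inter> V)" "open (U \<inter> V)" "p \<in> U \<inter> V"
    using assms(3) holo_subset by (blast, auto)
  thus ?thesis by (rule holomorphic_atI)
qed

lemma holomorphic_at_const [simp, intro]: "holomorphic_at (\<lambda>z. c) p"
  by (rule holomorphic_atI[OF holo_const open_UNIV]) simp

lemma holomorphic_at_nth [simp, intro]: "holomorphic_at (\<lambda>z. z $ i) p"
  by (rule holomorphic_atI[OF holo_nth open_UNIV]) simp

lemma holomorphic_at_add [intro]:
  "holomorphic_at f p \<Longrightarrow> holomorphic_at g p \<Longrightarrow> holomorphic_at (\<lambda>z. f z + g z) p"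
  by (rule holomorphic_at_binop[of f p g]) (auto intro: holo_add)

lemma holomorphic_at_diff [intro]:
  "holomorphic_at f p \<Longrightarrow> holomorphic_at g p \<Longrightarrow> holomorphic_at (\<lambda>z. f z - g z) p"
  by (rule holomorphic_at_binop[of f p g]) (auto intro: holo_diff)

lemma holomorphic_at_mult [intro]:
  "holomorphic_at f p \<Longrightarrow> holomorphic_at g p \<Longrightarrow> holomorphic_at (\<lambda>z. f z * g z) p"
  by (rule holomorphic_at_binop[of f p g]) (auto intro: holo_mult)

lemma holomorphic_at_minus [intro]: "holomorphic_at f p \<Longrightarrow> holomorphic_at (\<lambda>z. - f z) p"
  by (rule holomorphic_at_binop[of f p f]) (auto intro: holo_minus)

lemma holomorphic_at_power [intro]: "holomorphic_at f p \<Longrightarrow> holomorphic_at (\<lambda>z. f z ^ n) p"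
  by (rule holomorphic_at_binop[of f p f]) (auto intro: holo_power)

lemma holomorphic_at_ddir [intro]: "holomorphic_at f p \<Longrightarrow> holomorphic_at (ddir v f) p"
  unfolding holomorphic_at_iff by (blast intro: holo_ddir)

lemma holomorphic_at_isCont: "holomorphic_at f p \<Longrightarrow> isCont f p"
  unfolding holomorphic_at_iff
  by (auto dest!: holo_continuous_on simp: continuous_on_eq_continuous_at)

lemma holomorphic_at_inverse:
  assumes "holomorphic_at f p" "f p \<noteq> 0"
  shows "holomorphic_at (\<lambda>z. inverse (f z)) p"
proof -
  obtain U where U: "open U" "p \<in> U" "holo f U"
    using assms(1) unfolding holomorphic_at_iff by blast
  define V where "V = f -` (-{0}) \<inter> U"
  have "open V" unfolding V_def
    using continuous_on_open_vimage[OF U(1)] holo_continuous_on[OF U(3)]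
    by (metis open_Compl closed_singleton)
  moreover have "holo (\<lambda>z. inverse (f z)) V"
    by (rule holo_inverse[OF holo_subset[OF U(3)]]) (auto simp: V_def)
  moreover have "p \<in> V" using U assms by (auto simp: V_def)
  ultimately show ?thesis by (blast intro: holomorphic_atI)
qed

lemma holomorphic_map_atE:
  fixes F :: "complex^2 \<Rightarrow> complex^2"
  assumes "holomorphic_map_at F p"
  obtains R where "R > 0" "\<And>i. holo (\<lambda>z. F z $ i) (ball p R)"
proof -
  from assms have 1: "holomorphic_at (\<lambda>z. F z $ 1) p" and 2: "holomorphic_at (\<lambda>z. F z $ 2) p"
    unfolding holomorphic_map_at_def by auto
  from holomorphic_atE[OF 1] obtain R1 where R1: "R1 > 0" "holo (\<lambda>z. F z $ 1) (ball p R1)" .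
  from holomorphic_atE[OF 2] obtain R2 where R2: "R2 > 0" "holo (\<lambda>z. F z $ 2) (ball p R2)" .
  have "holo (\<lambda>z. F z $ i) (ball p (min R1 R2))" for i
    using exhaust_2[of i] holo_subset[OF R1(2), of "ball p (min R1 R2)"]
      holo_subset[OF R2(2), of "ball p (min R1 R2)"] by (auto simp: subset_ball)
  with R1 R2 show ?thesis by (intro that[of "min R1 R2"]) auto
qed

lemma holomorphic_map_at_isCont: "holomorphic_map_at F p \<Longrightarrow> isCont F p"
  unfolding holomorphic_map_at_def isCont_def
  by (rule vec_tendstoI) (metis holomorphic_at_isCont isCont_def)

lemma holomorphic_map_at_ballI:
  fixes F :: "complex^2 \<Rightarrow> complex^2"
  shows   "(\<And>i. holo (\<lambda>z. F z $ i) (ball p R)) \<Longrightarrow> R > 0 \<Longrightarrow> holomorphic_map_at F p"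
  unfolding holomorphic_map_at_def by (blast intro: holomorphic_at_ballI)

lemma holomorphic_at_compose:
  assumes "holomorphic_at f (F p)" "holomorphic_map_at F p"
  shows "holomorphic_at (\<lambda>z. f (F z)) p"
proof -
  obtain V where V: "open V" "F p \<in> V" "holo f V"
    using assms(1) unfolding holomorphic_at_iff by blast
  obtain R where R: "R > 0" "\<And>i. holo (\<lambda>z. F z $ i) (ball p R)"
    using holomorphic_map_atE[OF assms(2)] by blast
  from eventually_nhds_compose[OF holomorphic_map_at_isCont[OF assms(2)]
      eventually_nhds_in_open[OF V(1,2)]]
  obtain d where d: "d > 0" "\<And>z. z \<in> ball p d \<Longrightarrow> F z \<in> V"
    by (rule eventually_nhds_ballE) blast
  have "holo (\<lambda>z. f (F z)) (ball p (min R d))"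
    by (rule holo_compose[OF V(3)]) (use R d in \<open>auto intro!: holo_subset[OF R(2)]\<close>)
  thus ?thesis by (rule holomorphic_at_ballI) (use R d in auto)
qed

lemma holomorphic_map_at_compose:
  assumes "holomorphic_map_at G (F p)" "holomorphic_map_at F p"
  shows "holomorphic_map_at (\<lambda>z. G (F z)) p"
  using assms(1) holomorphic_at_compose[OF _ assms(2)] unfolding holomorphic_map_at_def by blast

text \<open>A growth condition in place of Taylor coefficients: it applies unchanged to
  vector-valued maps, to compositions and to differences of flows. For holomorphic germs it is
  membership in the \<open>k\<close>-th power of the maximal ideal, as iterating
  \<open>vanish_split\<close> shows.\<close>

definition vanish :: "nat \<Rightarrow> (complex^2 \<Rightarrow> 'a::real_normed_vector) \<Rightarrow> bool" where
  "vanish k f \<longleftrightarrow> (\<exists>C. \<forall>\<^sub>F z in nhds 0. norm (f z) \<le> C * norm z ^ k)"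

lemma vanishE:
  assumes "vanish k f"
  obtains R C where "R > 0" "C \<ge> 0" "\<And>z. z \<in> ball 0 R \<Longrightarrow> norm (f z) \<le> C * norm z ^ k"
proof -
  from assms obtain C where C: "\<forall>\<^sub>F z in nhds 0. norm (f z) \<le> C * norm z ^ k"
    unfolding vanish_def by blast
  then obtain R where R: "R > 0" "\<And>z. z \<in> ball 0 R \<Longrightarrow> norm (f z) \<le> C * norm z ^ k"
    by (rule eventually_nhds_ballE) blast
  have "norm (f z) \<le> \<bar>C\<bar> * norm z ^ k" if "z \<in> ball 0 R" for z
    using R(2)[OF that] mult_right_mono[OF abs_ge_self, of "norm z ^ k" C] by simp
  thus ?thesis using that R(1) by (metis abs_ge_zero)
qed

lemma vanishI:
  "R > 0 \<Longrightarrow> (\<And>z. z \<in> ball 0 R \<Longrightarrow> norm (f z) \<le> C * norm z ^ k) \<Longrightarrow> vanish k f"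
  unfolding vanish_def by (intro exI[of _ C] eventually_nhds_ballI)

lemma vanish_bound:
  assumes "vanish k f" "\<forall>\<^sub>F z in nhds 0. norm (g z) \<le> C * norm (f z)" "C \<ge> 0"
  shows "vanish k g"
proof -
  from assms(1) obtain K where "\<forall>\<^sub>F z in nhds 0. norm (f z) \<le> K * norm z ^ k"
    unfolding vanish_def by blast
  with assms(2) have "\<forall>\<^sub>F z in nhds 0. norm (g z) \<le> (C * K) * norm z ^ k"
  proof eventually_elim
    case (elim z)
    show ?case using mult_left_mono[OF elim(2) assms(3)] elim(1) by (simp add: mult.assoc)
  qed
  thus ?thesis unfolding vanish_def by blast
qed

lemma vanish_mono:
  assumes "vanish k f" "l \<le> k" shows "vanish l f"
proof -
  obtain R C where R: "R > 0" "C \<ge> 0" "\<And>z. z \<in> ball 0 R \<Longrightarrow> norm (f z) \<le> C * norm z ^ k"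
    using vanishE[OF assms(1)] by blast
  show ?thesis
  proof (rule vanishI[of "min R 1" _ C])
    fix z :: "complex^2" assume z: "z \<in> ball 0 (min R 1)"
    have "norm (f z) \<le> C * norm z ^ k" using R z by auto
    also have "\<dots> \<le> C * norm z ^ l"
      using z R assms(2) by (intro mult_left_mono power_decreasing) auto
    finally show "norm (f z) \<le> C * norm z ^ l" .
  qed (use R in auto)
qed

lemma vanish_add:
  assumes "vanish k f" "vanish k g" shows "vanish k (\<lambda>z. f z + g z)"
proof -
  obtain C D where "\<forall>\<^sub>F z in nhds 0. norm (f z) \<le> C * norm z ^ k" "\<forall>\<^sub>F z in nhds 0. norm (g z) \<le> D * norm z ^ k"
    using assms unfolding vanish_def by blast
  hence "\<forall>\<^sub>F z in nhds 0. norm (f z + g z) \<le> (C + D) * norm z ^ k"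
  proof eventually_elim
    case (elim z)
    thus ?case using norm_triangle_ineq[of "f z" "g z"] by (simp add: algebra_simps)
  qed
  thus ?thesis unfolding vanish_def by blast
qed

lemma vanish_minus: "vanish k f \<Longrightarrow> vanish k (\<lambda>z. - f z)"
  unfolding vanish_def by simp

lemma vanish_diff:
  "vanish k f \<Longrightarrow> vanish k g \<Longrightarrow> vanish k (\<lambda>z. f z - g z)"
  using vanish_add[of k f "\<lambda>z. - g z"] vanish_minus[of k g] by simp

lemma vanish_mult:
  fixes f g :: "complex^2 \<Rightarrow> complex"
  assumes "vanish k f" "vanish l g" shows "vanish (k + l) (\<lambda>z. f z * g z)"
proof -
  obtain R C where R: "R > 0" "C \<ge> 0" "\<And>z. z \<in> ball 0 R \<Longrightarrow> norm (f z) \<le> C * norm z ^ k"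
    using vanishE[OF assms(1)] by blast
  obtain S D where S: "S > 0" "D \<ge> 0" "\<And>z. z \<in> ball 0 S \<Longrightarrow> norm (g z) \<le> D * norm z ^ l"
    using vanishE[OF assms(2)] by blast
  show ?thesis
  proof (rule vanishI[of "min R S" _ "C * D"])
    fix z :: "complex^2" assume z: "z \<in> ball 0 (min R S)"
    have "norm (f z * g z) \<le> (C * norm z ^ k) * (D * norm z ^ l)"
      unfolding norm_mult using R(2) R(3)[of z] S(3)[of z] z by (intro mult_mono) auto
    thus "norm (f z * g z) \<le> C * D * norm z ^ (k + l)" by (simp add: power_add mult_ac)
  qed (use R S in auto)
qed

lemma vanish_nth:
  fixes F :: "complex^2 \<Rightarrow> complex^2"
  shows "vanish k F \<Longrightarrow> vanish k (\<lambda>z. F z $ i)"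
  by (erule vanish_bound[where C=1]) (auto intro!: always_eventually simp: Finite_Cartesian_Product.norm_nth_le)

lemma norm_vec2_le: "norm (z::complex^2) \<le> norm (z $ 1) + norm (z $ 2)"
  using norm_triangle_ineq[of "z $ 1 *s ex" "z $ 2 *s ey"]
  unfolding vec2_eq[symmetric] by (simp add: norm_smult)

lemma vanish_vecI:
  fixes F :: "complex^2 \<Rightarrow> complex^2"
  assumes "\<And>i. vanish k (\<lambda>z. F z $ i)" shows "vanish k F"
proof -
  obtain C D where "\<forall>\<^sub>F z in nhds 0. norm (F z $ 1) \<le> C * norm z ^ k" "\<forall>\<^sub>F z in nhds 0. norm (F z $ 2) \<le> D * norm z ^ k"
    using assms unfolding vanish_def by blast
  hence "\<forall>\<^sub>F z in nhds 0. norm (F z) \<le> (C + D) * norm z ^ k"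
  proof eventually_elim
    case (elim z)
    thus ?case using norm_vec2_le[of "F z"] by (simp add: algebra_simps)
  qed
  thus ?thesis unfolding vanish_def by blast
qed

lemma vanish_0: "isCont f 0 \<Longrightarrow> vanish 0 f"
proof -
  assume "isCont f 0"
  hence "\<forall>\<^sub>F z in nhds 0. dist (f z) (f 0) < 1"
    unfolding isCont_def tendsto_at_iff_tendsto_nhds by (rule tendstoD) simp
  hence "\<forall>\<^sub>F z in nhds 0. norm (f z) \<le> (norm (f 0) + 1) * norm z ^ 0"
  proof eventually_elim
    case (elim z)
    thus ?case using norm_triangle_sub[of "f z" "f 0"] by (simp add: dist_norm)
  qed
  thus ?thesis unfolding vanish_def by blast
qed

lemma vanish_compose:
  assumes "vanish k f" "vanish 1 F" "isCont F 0"
  shows "vanish k (\<lambda>z. f (F z))"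
proof -
  obtain R C where R: "R > 0" "C \<ge> 0" "\<And>z. z \<in> ball 0 R \<Longrightarrow> norm (f z) \<le> C * norm z ^ k"
    using vanishE[OF assms(1)] by blast
  obtain S D where S: "S > 0" "D \<ge> 0" "\<And>z. z \<in> ball 0 S \<Longrightarrow> norm (F z) \<le> D * norm z ^ 1"
    using vanishE[OF assms(2)] by blast
  have "F 0 = 0" using S(3)[of 0] S(1) by simp
  have "\<forall>\<^sub>F z in nhds 0. F z \<in> ball 0 R"
    by (rule eventually_nhds_compose[OF assms(3)], rule eventually_nhds_in_open)
      (use R \<open>F 0 = 0\<close> in auto)
  moreover have "\<forall>\<^sub>F z in nhds 0. z \<in> ball (0::complex^2) S"
    by (rule eventually_nhds_in_open) (use S in auto)
  ultimately have "\<forall>\<^sub>F z in nhds 0. norm (f (F z)) \<le> (C * D ^ k) * norm z ^ k"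
  proof eventually_elim
    case (elim z)
    have "norm (f (F z)) \<le> C * norm (F z) ^ k" using R(3) elim by auto
    also have "\<dots> \<le> C * (D * norm z) ^ k" using S(3)[OF elim(2)] R(2)
      by (intro mult_left_mono power_mono) auto
    finally show ?case by (simp add: power_mult_distrib)
  qed
  thus ?thesis unfolding vanish_def by blast
qed

lemma vanish_zero:
  assumes "vanish k f" "k > 0" shows "f 0 = 0"
proof -
  obtain R C where R: "R > 0" "\<And>z. z \<in> ball 0 R \<Longrightarrow> norm (f z) \<le> C * norm z ^ k"
    using vanishE[OF assms(1)] by blast
  have "norm (f 0) \<le> C * norm (0::complex^2) ^ k" by (rule R(2)) (use R(1) in simp)
  thus ?thesis using assms(2) by (cases k) auto
qed

lemma vanish_1I:
  assumes "holomorphic_at f 0" "f 0 = 0" shows "vanish 1 f"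
proof -
  obtain R where R: "R > 0" "holo f (ball 0 R)" using holomorphic_atE[OF assms(1)] by blast
  obtain S C where S: "S > 0" "C \<ge> 0" "\<And>z. z \<in> ball 0 S \<Longrightarrow> norm (f z) \<le> C * norm z ^ 0"
    using vanishE[OF vanish_0[OF holomorphic_at_isCont[OF assms(1)]]] by blast
  define r where "r = min R S / 3"
  have r: "r > 0" "2 * r < min R S" using R S by (auto simp: r_def)
  show ?thesis
  proof (rule vanishI[OF r(1), of _ "C * (2 * r) ^ 0 / r"])
    fix z :: "complex^2" assume "z \<in> ball 0 r"
    hence "norm (f z - f 0) \<le> C * (2 * r) ^ 0 / r * norm (z - 0)"
      using R S r by (intro holo_lipschitz_order[of _ "min R S"] holo_subset[OF R(2)]) auto
    thus "norm (f z) \<le> C * (2 * r) ^ 0 / r * norm z ^ 1" using assms by simp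
  qed
qed

text \<open>On the ball of radius \<open>norm z\<close> around \<open>z\<close> the function has
  size \<open>norm z ^ Suc k\<close>, and Cauchy's inequality divides by the radius, losing exactly
  one order.\<close>

lemma vanish_ddir:
  assumes "holomorphic_at f 0" "vanish (Suc k) f" shows "vanish k (ddir v f)"
proof -
  obtain R where R: "R > 0" "holo f (ball 0 R)" using holomorphic_atE[OF assms(1)] by blast
  obtain S C where S: "S > 0" "C \<ge> 0" "\<And>z. z \<in> ball 0 S \<Longrightarrow> norm (f z) \<le> C * norm z ^ Suc k"
    using vanishE[OF assms(2)] by blast
  define r where "r = min R S / 3"
  have r: "r > 0" "2 * r < min R S" using R S by (auto simp: r_def)
  define K where "K = C * 2 ^ Suc k * norm v"
  have *: "norm (ddir v f z) \<le> K * norm z ^ k" if "z \<in> ball 0 r" "z \<noteq> 0" for z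
  proof -
    have sub: "norm w \<le> 2 * norm z" if "w \<in> cball z (norm z)" for w
      using that norm_triangle_ineq[of z "w - z"] by (auto simp: dist_norm norm_minus_commute)
    have "norm (ddir v f z) \<le> (C * (2 * norm z) ^ Suc k) / norm z * norm v"
    proof (rule ddir_bound[OF R(2)])
      show "cball z (norm z) \<subseteq> ball 0 R" using sub that r by fastforce
      fix w assume w: "w \<in> cball z (norm z)"
      have "norm (f w) \<le> C * norm w ^ Suc k" using sub[OF w] that r by (intro S(3)) auto
      also have "\<dots> \<le> C * (2 * norm z) ^ Suc k"
        using sub[OF w] S(2) by (intro mult_left_mono power_mono) auto
      finally show "norm (f w) \<le> C * (2 * norm z) ^ Suc k" .
    qed (use that in auto)
    also have "\<dots> = K * norm z ^ k" using that by (simp add: K_def power_mult_distrib field_simps)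
    finally show ?thesis .
  qed
  \<comment> \<open>At the origin the ball above shrinks to a point, so the estimate is obtained
    there as a limit.\<close>
  have "norm (ddir v f 0) \<le> K * norm (0::complex^2) ^ k"
  proof (rule tendsto_le[of "at (0::complex^2)"])
    show "((\<lambda>z. norm (ddir v f z)) \<longlongrightarrow> norm (ddir v f 0)) (at 0)"
      using holomorphic_at_isCont[OF holomorphic_at_ddir[OF assms(1)], of v]
      by (intro tendsto_norm) (simp add: isCont_def)
    show "((\<lambda>z::complex^2. K * norm z ^ k) \<longlongrightarrow> K * norm (0::complex^2) ^ k) (at 0)"
    proof -
      have "isCont (\<lambda>z::complex^2. K * norm z ^ k) 0" by (intro continuous_intros)
      thus ?thesis unfolding isCont_def .
    qed
    show "\<forall>\<^sub>F z in at 0. norm (ddir v f z) \<le> K * norm z ^ k"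
      unfolding eventually_at using r * by (intro exI[of _ r]) auto
  qed auto
  with * have "norm (ddir v f z) \<le> K * norm z ^ k" if "z \<in> ball 0 r" for z
    using that by (cases "z = 0") auto
  with r(1) show ?thesis by (rule vanishI)
qed

text \<open>The differential has size \<open>norm z ^ k\<close> on the whole ball of radius
  \<open>norm z\<close>, so the mean value inequality from the origin gains one order.\<close>

lemma vanish_integrate:
  assumes "holomorphic_at f 0" "f 0 = 0" "vanish k (ddir ex f)" "vanish k (ddir ey f)"
  shows "vanish (Suc k) f"
proof -
  obtain R where R: "R > 0" "holo f (ball 0 R)" using holomorphic_atE[OF assms(1)] by blast
  obtain S C where S: "S > 0" "C \<ge> 0" "\<And>z. z \<in> ball 0 S \<Longrightarrow> norm (ddir ex f z) \<le> C * norm z ^ k"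
    using vanishE[OF assms(3)] by blast
  obtain T D where T: "T > 0" "D \<ge> 0" "\<And>z. z \<in> ball 0 T \<Longrightarrow> norm (ddir ey f z) \<le> D * norm z ^ k"
    using vanishE[OF assms(4)] by blast
  show ?thesis
  proof (rule vanishI[of "min R (min S T)" _ "C + D"])
    fix z :: "complex^2" assume z: "z \<in> ball 0 (min R (min S T))"
    have "norm (f z - f 0) \<le> ((C + D) * norm z ^ k) * norm (z - 0)"
    proof (rule holo_lipschitz[OF R(2), of "cball 0 (norm z)"])
      fix w v :: "complex^2" assume w: "w \<in> cball 0 (norm z)"
      have inR: "w \<in> ball 0 R" using w z by auto
      have "norm (ddir v f w) \<le> norm (v $ 1) * norm (ddir ex f w) + norm (v $ 2) * norm (ddir ey f w)"
        unfolding ddir_eq[OF R(2) inR, of v] norm_mult[symmetric] by (rule norm_triangle_ineq)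
      also have "\<dots> \<le> norm v * (C * norm w ^ k) + norm v * (D * norm w ^ k)"
        using S(3)[of w] T(3)[of w] w z
        by (intro add_mono mult_mono Finite_Cartesian_Product.norm_nth_le) auto
      also have "\<dots> = ((C + D) * norm w ^ k) * norm v" by (simp add: algebra_simps)
      also have "\<dots> \<le> ((C + D) * norm z ^ k) * norm v"
        using w S T by (intro mult_right_mono mult_left_mono power_mono) auto
      finally show "norm (ddir v f w) \<le> ((C + D) * norm z ^ k) * norm v" .
    qed (use z in auto)
    thus "norm (f z) \<le> (C + D) * norm z ^ Suc k" using assms by (simp add: mult_ac)
  qed (use R S T in auto)
qed

text \<open>Hadamard's lemma: the derivative of \<open>f\<close> along the segment from the origin
  to \<open>z\<close> is integrated, and the averages of the two partial derivatives over the
  segment serve as \<open>a\<close> and \<open>b\<close>. They inherit the order of the partial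
  derivatives.\<close>

lemma vanish_split:
  assumes "holomorphic_at f 0" "vanish (Suc k) f"
  obtains a b where "holomorphic_at a 0" "holomorphic_at b 0" "vanish k a" "vanish k b"
    "\<forall>\<^sub>F z in nhds 0. f z = z $ 1 * a z + z $ 2 * b z"
proof -
  obtain R where R: "R > 0" "holo f (ball 0 R)" using holomorphic_atE[OF assms(1)] by blast
  have f0: "f 0 = 0" using vanish_zero[OF assms(2)] by simp
  define A where "A = (\<lambda>v z. integral {0..1} (\<lambda>t. ddir v f (t *\<^sub>R z)))"
  have inb: "t *\<^sub>R z \<in> ball 0 R" if "t \<in> {0..1}" "z \<in> ball 0 R" for t and z :: "complex^2"
    using that mult_left_le_one_le[of "norm z" t] by (auto simp: abs_of_nonneg)
  have hol: "holo (ddir v f) (ball 0 R)" for v by (rule holo_ddir[OF open_ball R(2)])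
  have cont: "continuous_on ({0..1} \<times> ball 0 R) (\<lambda>(t, z). ddir v f (t *\<^sub>R z))" for v
    unfolding case_prod_beta
    by (rule continuous_on_compose2[OF holo_continuous_on[OF hol]])
      (use inb in \<open>auto intro!: continuous_intros\<close>)
  have "holo (A v) (ball 0 R)" for v
    unfolding A_def
  proof (rule holo_integral[OF open_ball cont])
    fix t :: real assume t: "t \<in> {0..1}"
    show "holo (\<lambda>z. ddir v f (t *\<^sub>R z)) (ball 0 R)"
      by (rule holo_compose[OF hol])
        (use inb[OF t] in \<open>auto simp: scaleR_conv_of_real intro!: holo_mult\<close>)
  qed
  hence "holomorphic_at (A v) 0" for v using R by (blast intro: holomorphic_at_ballI)
  moreover have "vanish k (A v)" for v
  proof -
    obtain S C where S: "S > 0" "C \<ge> 0" "\<And>z. z \<in> ball 0 S \<Longrightarrow> norm (ddir v f z) \<le> C * norm z ^ k"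
      using vanishE[OF vanish_ddir[OF assms]] by blast
    show ?thesis
    proof (rule vanishI[of "min R S" _ C])
      fix z :: "complex^2" assume z: "z \<in> ball 0 (min R S)"
      have "norm (A v z) \<le> (C * norm z ^ k) * (1 - 0)"
        unfolding A_def
      proof (rule integral_bound)
        show "continuous_on {0..1} (\<lambda>t. ddir v f (t *\<^sub>R z))"
          by (rule continuous_on_compose2[OF holo_continuous_on[OF hol]])
            (use inb z in \<open>auto intro!: continuous_intros\<close>)
        fix t :: real assume t: "t \<in> {0..1}"
        have le: "norm (t *\<^sub>R z) \<le> norm z" using t mult_left_le_one_le[of "norm z" t] by simp
        have "norm (ddir v f (t *\<^sub>R z)) \<le> C * norm (t *\<^sub>R z) ^ k"
          using le z by (intro S(3)) auto
        also have "\<dots> \<le> C * norm z ^ k" using le S by (intro mult_left_mono power_mono) auto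
        finally show "norm (ddir v f (t *\<^sub>R z)) \<le> C * norm z ^ k" .
      qed simp
      thus "norm (A v z) \<le> C * norm z ^ k" by simp
    qed (use R S in auto)
  qed
  moreover have "f z = z $ 1 * A ex z + z $ 2 * A ey z" if z: "z \<in> ball 0 R" for z
  proof -
    have "((\<lambda>t. f (t *\<^sub>R z)) has_vector_derivative ddir z f (t *\<^sub>R z)) (at t within {0..1})"
      if "t \<in> {0..1}" for t
    proof -
      have d: "((\<lambda>t. t *\<^sub>R z) has_derivative (\<lambda>h. h *\<^sub>R z)) (at t within {0..1})"
        by (intro bounded_linear_imp_has_derivative bounded_linear_scaleR_left)
      have "ddir (h *\<^sub>R z) f (t *\<^sub>R z) = h *\<^sub>R ddir z f (t *\<^sub>R z)" for h
        using ddir_smult[OF R(2) inb[OF that z], of "of_real h" z]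
        by (simp add: scaleR_conv_of_real smult_eq scaleR_vec_def)
      with has_derivative_compose[OF d holo_has_derivative[OF R(2) inb[OF that z]]]
      show ?thesis by (simp add: has_vector_derivative_def)
    qed
    hence "((\<lambda>t. ddir z f (t *\<^sub>R z)) has_integral (f (1 *\<^sub>R z) - f (0 *\<^sub>R z))) {0..1}"
      by (intro fundamental_theorem_of_calculus) auto
    hence "f z = integral {0..1} (\<lambda>t. ddir z f (t *\<^sub>R z))"
      using f0 by (simp add: integral_unique)
    also have "\<dots> = integral {0..1} (\<lambda>t. z $ 1 * ddir ex f (t *\<^sub>R z) + z $ 2 * ddir ey f (t *\<^sub>R z))"
      by (rule integral_cong) (rule ddir_eq[OF R(2) inb[OF _ z]])
    also have "\<dots> = z $ 1 * A ex z + z $ 2 * A ey z"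
    proof -
      have "(\<lambda>t. ddir v f (t *\<^sub>R z)) integrable_on {0..1}" for v
        by (intro integrable_continuous_real continuous_on_compose2[OF holo_continuous_on[OF hol]])
          (use inb z in \<open>auto intro!: continuous_intros\<close>)
      thus ?thesis unfolding A_def by (subst integral_add) (auto intro: integrable_on_mult_right)
    qed
    finally show ?thesis .
  qed
  hence "\<forall>\<^sub>F z in nhds 0. f z = z $ 1 * A ex z + z $ 2 * A ey z"
    by (rule eventually_nhds_ballI[OF R(1)])
  ultimately show ?thesis using that by blast
qed

section \<open>Flows\<close>

lemma vector_derivative_bound:
  fixes f :: "real \<Rightarrow> 'a::real_normed_vector"
  assumes "\<And>t. t \<in> {0..1} \<Longrightarrow> (f has_vector_derivative f' t) (at t within {0..1})"
    and "\<And>t. t \<in> {0..1} \<Longrightarrow> norm (f' t) \<le> B" and "t \<in> {0..1}" "s \<in> {0..1}"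
  shows "norm (f t - f s) \<le> B * \<bar>t - s\<bar>"
proof -
  have "norm (f t - f s) \<le> B * norm (t - s)"
  proof (rule differentiable_bound[of "{0..1}" f "\<lambda>t h. h *\<^sub>R f' t"])
    show "onorm (\<lambda>h. h *\<^sub>R f' x) \<le> B" if "x \<in> {0..1}" for x
    proof (rule onorm_le)
      fix h :: real
      show "norm (h *\<^sub>R f' x) \<le> B * norm h"
        using mult_right_mono[OF assms(2)[OF that] abs_ge_zero[of h]] by (simp add: mult.commute)
    qed
  qed (use assms in \<open>auto simp: has_vector_derivative_def\<close>)
  thus ?thesis by simp
qed

text \<open>The factor two comes from adding the bounds of the two components.\<close>

lemma map_lipschitz_order:
  fixes X :: "complex^2 \<Rightarrow> complex^2"
  assumes "\<And>i. holo (\<lambda>z. X z $ i) (ball 0 R)" "\<And>w. w \<in> ball 0 R \<Longrightarrow> norm (X w) \<le> C * norm w ^ k"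
    and "0 < r" "2 * r < R" "C \<ge> 0" "x \<in> cball 0 r" "y \<in> cball 0 r"
  shows "norm (X x - X y) \<le> 2 * (C * (2 * r) ^ k / r) * norm (x - y)"
proof -
  have "norm (X x $ i - X y $ i) \<le> C * (2 * r) ^ k / r * norm (x - y)" for i
    using order_trans[OF Finite_Cartesian_Product.norm_nth_le assms(2)]
    by (intro holo_lipschitz_order[OF assms(1) _ assms(3-7)]) auto
  from this[of 1] this[of 2] show ?thesis
    using norm_vec2_le[of "X x - X y"] by simp
qed

text \<open>The Picard integral over \<open>[0, t]\<close> is rescaled to \<open>[0, 1]\<close>, so that the facts on integrals
  depending on a parameter apply to the pair \<open>(t, p)\<close>.\<close>

lemma picard_flow:
  fixes X :: "real \<Rightarrow> complex^2 \<Rightarrow> complex^2"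
  assumes R: "R > 0" and cont: "continuous_on ({0..1} \<times> ball 0 R) (\<lambda>(t, z). X t z)"
    and hol: "\<And>t i. t \<in> {0..1} \<Longrightarrow> holo (\<lambda>z. X t z $ i) (ball 0 R)"
    and bd: "\<And>t z. t \<in> {0..1} \<Longrightarrow> z \<in> ball 0 R \<Longrightarrow> norm (X t z) \<le> norm z / 4"
    and lip: "\<And>t x y. t \<in> {0..1} \<Longrightarrow> x \<in> ball 0 R \<Longrightarrow> y \<in> ball 0 R \<Longrightarrow> norm (X t x - X t y) \<le> norm (x - y) / 4"
  obtains c where
    "\<And>p. p \<in> ball 0 (R/2) \<Longrightarrow> c 0 p = p"
    "\<And>t p. t \<in> {0..1} \<Longrightarrow> p \<in> ball 0 (R/2) \<Longrightarrow> norm (c t p) \<le> 2 * norm p"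
    "\<And>t p. t \<in> {0..1} \<Longrightarrow> p \<in> ball 0 (R/2) \<Longrightarrow>
      ((\<lambda>t. c t p) has_vector_derivative X t (c t p)) (at t within {0..1})"
    "\<And>t i. t \<in> {0..1} \<Longrightarrow> holo (\<lambda>p. c t p $ i) (ball 0 (R/2))"
proof -
  define B where "B = ball (0::complex^2) (R/2)"
  define A where "A = {0..1::real} \<times> B"
  define c where "c = rec_nat (\<lambda>t p. p) (\<lambda>n f t p. p + t *\<^sub>R integral {0..1} (\<lambda>u. X (t * u) (f (t * u) p)))"
  have c0: "c 0 = (\<lambda>t p. p)" and cS: "c (Suc n) = (\<lambda>t p. p + t *\<^sub>R integral {0..1} (\<lambda>u. X (t * u) (c n (t * u) p)))" for n
    by (simp_all add: c_def)
  have tu: "t * u \<in> {0..1}" if "t \<in> {0..1}" "u \<in> {0..1}" for t u :: real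
    using that by (auto simp: mult_le_one)
  have inb: "z \<in> ball 0 R" if "p \<in> B" "norm z \<le> 2 * norm p" for p z :: "complex^2"
    using that by (auto simp: B_def)
  define G where "G = (\<lambda>n t p. integral {0..1} (\<lambda>u. X (t * u) (c n (t * u) p)))"
  \<comment> \<open>The bound by \<open>2 * norm p\<close> keeps the iterates of points of
    \<open>B\<close> inside \<open>ball 0 R\<close>: the integrand is at most a quarter of
    \<open>2 * norm p\<close>, so that the integral adds at most \<open>norm p / 2\<close> to
    \<open>p\<close>. Bound, continuity and holomorphy go through one induction because the next
    integral relies on all three.\<close>
  have main: "continuous_on A (\<lambda>(t, p). c n t p) \<and> (\<forall>t\<in>{0..1}. \<forall>p\<in>B. norm (c n t p) \<le> 2 * norm p)
    \<and> (\<forall>t\<in>{0..1}. \<forall>i. holo (\<lambda>p. c n t p $ i) B)" for n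
  proof (induction n)
    case 0 thus ?case by (auto simp: c0 A_def case_prod_beta intro!: continuous_intros)
  next
    case (Suc n)
    hence IHc: "continuous_on A (\<lambda>(t, p). c n t p)"
      and IHb: "\<And>t p. t \<in> {0..1} \<Longrightarrow> p \<in> B \<Longrightarrow> norm (c n t p) \<le> 2 * norm p"
      and IHh: "\<And>t i. t \<in> {0..1} \<Longrightarrow> holo (\<lambda>p. c n t p $ i) B" by auto
    have ci: "continuous_on (A \<times> {0..1}) (\<lambda>(x, u). X (fst x * u) (c n (fst x * u) (snd x)))"
      unfolding case_prod_beta
    proof (rule continuous_on_case_prod_compose[OF cont])
      show "continuous_on (A \<times> {0..1}) (\<lambda>x. c n (fst (fst x) * snd x) (snd (fst x)))"
        by (rule continuous_on_case_prod_compose[OF IHc[unfolded A_def]])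
          (use tu in \<open>auto simp: A_def intro!: continuous_intros\<close>)
    qed (use tu IHb inb in \<open>auto simp: A_def intro!: continuous_intros\<close>)
    have "continuous_on A (\<lambda>x. integral (cbox 0 1) (\<lambda>u. X (fst x * u) (c n (fst x * u) (snd x))))"
      by (rule integral_continuous_on_param) (use ci in simp)
    hence 1: "continuous_on A (\<lambda>(t, p). c (Suc n) t p)"
      unfolding cS case_prod_beta by (intro continuous_intros) auto
    have 2: "norm (c (Suc n) t p) \<le> 2 * norm p" and 3: "holo (\<lambda>p. c (Suc n) t p $ i) B"
      if t: "t \<in> {0..1}" and p: "p \<in> B" for t p i
    proof -
      have cu: "continuous_on {0..1} (\<lambda>u. X (t * u) (c n (t * u) q))" if "q \<in> B" for q
        using continuous_on_case_prod_compose[OF ci, of "{0..1}" "\<lambda>u. (t, q)" "\<lambda>u. u"] t that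
        by (simp add: A_def)
      have nb: "norm (X (t * u) (c n (t * u) p)) \<le> norm p / 2" if "u \<in> {0..1}" for u
      proof -
        have "norm (X (t * u) (c n (t * u) p)) \<le> norm (c n (t * u) p) / 4"
          by (rule bd[OF tu[OF t that] inb[OF p IHb[OF tu[OF t that] p]]])
        thus ?thesis using IHb[OF tu[OF t that] p] by simp
      qed
      have "norm (integral {0..1} (\<lambda>u. X (t * u) (c n (t * u) p))) \<le> norm p / 2 * (1 - 0)"
        by (rule integral_bound[OF _ cu[OF p] nb]) auto
      hence "norm (t *\<^sub>R integral {0..1} (\<lambda>u. X (t * u) (c n (t * u) p))) \<le> 1 * (norm p / 2)"
        unfolding norm_scaleR using t by (intro mult_mono) auto
      moreover have "norm (c (Suc n) t p) \<le> norm p + norm (t *\<^sub>R integral {0..1} (\<lambda>u. X (t * u) (c n (t * u) p)))"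
        unfolding cS by (rule norm_triangle_ineq)
      ultimately show "norm (c (Suc n) t p) \<le> 2 * norm p" using norm_ge_zero[of p] by linarith
      have "holo (\<lambda>p. p $ i + of_real t * integral {0..1} (\<lambda>u. X (t * u) (c n (t * u) p) $ i)) B"
      proof (intro holo_add holo_mult holo_const holo_nth holo_integral)
        show "open B" by (simp add: B_def)
        have "continuous_on ({0..1} \<times> B) (\<lambda>x. (\<lambda>(x, u). X (fst x * u) (c n (fst x * u) (snd x))) ((t, snd x), fst x))"
          by (rule continuous_on_compose2[OF ci]) (use t in \<open>auto simp: A_def intro!: continuous_intros\<close>)
        thus "continuous_on ({0..1} \<times> B) (\<lambda>(u, p). X (t * u) (c n (t * u) p) $ i)"
          unfolding case_prod_beta by (intro continuous_intros) simp
        show "holo (\<lambda>p. X (t * u) (c n (t * u) p) $ i) B" if "u \<in> {0..1}" for u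
          by (rule holo_compose[OF hol[OF tu[OF t that]] IHh[OF tu[OF t that]]])
            (use inb IHb[OF tu[OF t that]] in blast)
      qed
      moreover have "open B" by (simp add: B_def)
      moreover have "q $ i + of_real t * integral {0..1} (\<lambda>u. X (t * u) (c n (t * u) q) $ i) = c (Suc n) t q $ i"
        if "q \<in> B" for q
      proof -
        have "integral {0..1} (\<lambda>u. X (t * u) (c n (t * u) q) $ i)
          = integral {0..1} (\<lambda>u. X (t * u) (c n (t * u) q)) $ i"
          using integral_linear[OF integrable_continuous_real[OF cu[OF that]] bounded_linear_vec_nth[of i]]
          by (simp add: o_def)
        thus ?thesis by (simp add: cS scaleR_vec_def scaleR_conv_of_real)
      qed
      ultimately show "holo (\<lambda>p. c (Suc n) t p $ i) B"
        by (rule holo_cong[rotated 2])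
    qed
    have "0 \<in> B" using R by (simp add: B_def)
    with 1 2 3 show ?case by blast
  qed
  have mc: "continuous_on A (\<lambda>(t, p). c n t p)"
    and mb: "\<And>t p. t \<in> {0..1} \<Longrightarrow> p \<in> B \<Longrightarrow> norm (c n t p) \<le> 2 * norm p"
    and mh: "\<And>t i. t \<in> {0..1} \<Longrightarrow> holo (\<lambda>p. c n t p $ i) B" for n
    using main[of n] by auto
  have cut: "continuous_on {0..1} (\<lambda>u. c n (t * u) p)" if "t \<in> {0..1}" "p \<in> B" for n t p
    by (rule continuous_on_case_prod_compose[OF mc[unfolded A_def]])
      (use tu[OF that(1)] that in \<open>auto intro!: continuous_intros\<close>)
  have cuX: "continuous_on {0..1} (\<lambda>u. X (t * u) (c n (t * u) p))" if "t \<in> {0..1}" "p \<in> B" for n t p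
    by (rule continuous_on_case_prod_compose[OF cont])
      (use tu[OF that(1)] that inb[OF that(2) mb[OF tu[OF that(1)] that(2)]]
        in \<open>auto intro!: continuous_intros cut\<close>)
  \<comment> \<open>Time has length one and the Lipschitz constant is \<open>1/4\<close>, so every
    iteration contracts by \<open>1/4\<close> and the increments are dominated by a geometric series
    uniformly in \<open>(t, p)\<close>.\<close>
  have diff: "norm (c (Suc n) t p - c n t p) \<le> R * (1/4) ^ n" if "t \<in> {0..1}" "p \<in> B" for n t p
    using that(1)
  proof (induction n arbitrary: t)
    case 0
    have "norm (integral {0..1} (\<lambda>u. X (t * u) (c 0 (t * u) p))) \<le> R * (1 - 0)"
    proof (rule integral_bound[OF _ cuX[OF 0 that(2)]])
      show "norm (X (t * u) (c 0 (t * u) p)) \<le> R" if "u \<in> {0..1}" for u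
        using bd[OF tu[OF 0 that], of p] \<open>p \<in> B\<close> R by (simp add: c0 B_def)
    qed simp
    hence "norm (t *\<^sub>R integral {0..1} (\<lambda>u. X (t * u) (c 0 (t * u) p))) \<le> 1 * R"
      unfolding norm_scaleR using 0 by (intro mult_mono) auto
    thus ?case by (simp add: cS c0)
  next
    case (Suc n)
    have "norm (integral {0..1} (\<lambda>u. X (t * u) (c (Suc n) (t * u) p) - X (t * u) (c n (t * u) p)))
      \<le> R * (1/4) ^ n / 4 * (1 - 0)"
    proof (rule integral_bound)
      show "continuous_on {0..1} (\<lambda>u. X (t * u) (c (Suc n) (t * u) p) - X (t * u) (c n (t * u) p))"
        by (intro continuous_on_diff cuX Suc.prems that)
      show "norm (X (t * u) (c (Suc n) (t * u) p) - X (t * u) (c n (t * u) p)) \<le> R * (1/4) ^ n / 4"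
        if u: "u \<in> {0..1}" for u
      proof -
        note tu' = tu[OF Suc.prems u]
        have "norm (X (t * u) (c (Suc n) (t * u) p) - X (t * u) (c n (t * u) p))
          \<le> norm (c (Suc n) (t * u) p - c n (t * u) p) / 4"
          by (intro lip tu' inb[OF \<open>p \<in> B\<close>] mb \<open>p \<in> B\<close>)
        with Suc.IH[OF tu'] show ?thesis by simp
      qed
    qed simp
    hence "norm (t *\<^sub>R integral {0..1} (\<lambda>u. X (t * u) (c (Suc n) (t * u) p) - X (t * u) (c n (t * u) p)))
      \<le> 1 * (R * (1/4) ^ n / 4)"
      unfolding norm_scaleR using Suc.prems R by (intro mult_mono) auto
    moreover have "c (Suc (Suc n)) t p - c (Suc n) t p
      = t *\<^sub>R integral {0..1} (\<lambda>u. X (t * u) (c (Suc n) (t * u) p) - X (t * u) (c n (t * u) p))"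
      by (subst integral_diff)
        (auto simp: cS[of "Suc n"] cS[of n] scaleR_diff_right
          intro!: integrable_continuous_real cuX Suc.prems that cuX[of t p "Suc n", unfolded cS])
    ultimately show ?case by simp
  qed
  define d where "d = (\<lambda>n x. case x of (t, p) \<Rightarrow> c (Suc n) t p - c n t p)"
  define cl where "cl = (\<lambda>t p. p + suminf (\<lambda>n. d n (t, p)))"
  have "uniform_limit A (\<lambda>n x. \<Sum>i<n. d i x) (\<lambda>x. suminf (\<lambda>i. d i x)) sequentially"
  proof (rule Weierstrass_m_test)
    show "norm (d n x) \<le> R * (1/4) ^ n" if "x \<in> A" for n x
      using that diff by (auto simp: A_def d_def)
    show "summable (\<lambda>n. R * (1 / 4) ^ n)" by (intro summable_mult summable_geometric) simp
  qed
  hence "uniform_limit A (\<lambda>n x. snd x + (\<Sum>i<n. d i x)) (\<lambda>x. snd x + suminf (\<lambda>i. d i x)) sequentially"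
    by (intro uniform_limit_intros)
  note ul0 = this
  have "snd x + (\<Sum>i<n. d i x) = (\<lambda>(t, p). c n t p) x" for n x
  proof -
    obtain t p where "x = (t, p)" by (cases x)
    moreover have "p + (\<Sum>i<n. c (Suc i) t p - c i t p) = c n t p"
      by (simp add: sum_lessThan_telescope[of "\<lambda>i. c i t p" n] c0)
    ultimately show ?thesis by (simp add: d_def)
  qed
  hence e1: "(\<lambda>n x. snd x + (\<Sum>i<n. d i x)) = (\<lambda>n (t, p). c n t p)" by (intro ext)
  have e2: "(\<lambda>x. snd x + suminf (\<lambda>i. d i x)) = (\<lambda>(t, p). cl t p)"
    by (auto simp: cl_def fun_eq_iff)
  from ul0 have ul: "uniform_limit A (\<lambda>n (t, p). c n t p) (\<lambda>(t, p). cl t p) sequentially"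
    unfolding e1 e2 .
  have clc: "continuous_on A (\<lambda>(t, p). cl t p)"
    by (rule uniform_limit_theorem[OF _ ul]) (auto intro!: always_eventually mc)
  have ptl: "(\<lambda>n. c n t p) \<longlonglongrightarrow> cl t p" if "t \<in> {0..1}" "p \<in> B" for t p
    using tendsto_uniform_limitI[OF ul, of "(t, p)"] that by (simp add: A_def)
  have clb: "norm (cl t p) \<le> 2 * norm p" if "t \<in> {0..1}" "p \<in> B" for t p
    by (rule LIMSEQ_le_const2[OF tendsto_norm[OF ptl[OF that]]]) (use mb that in auto)
  have clh: "holo (\<lambda>p. cl t p $ i) B" if t: "t \<in> {0..1}" for t i
  proof (rule holo_uniform_limit)
    show "open B" by (simp add: B_def)
    show "holo (\<lambda>p. c n t p $ i) B" for n by (rule mh[OF t])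
    have "uniform_limit B (\<lambda>n x. (\<lambda>(t, p). c n t p) (t, x)) (\<lambda>x. (\<lambda>(t, p). cl t p) (t, x)) sequentially"
      by (rule uniform_limit_compose'[OF ul]) (use t in \<open>auto simp: A_def\<close>)
    hence "uniform_limit B (\<lambda>n p. c n t p) (\<lambda>p. cl t p) sequentially" by simp
    thus "uniform_limit B (\<lambda>n p. c n t p $ i) (\<lambda>p. cl t p $ i) sequentially"
      by (rule bounded_linear.uniform_limit[OF bounded_linear_vec_nth])
  qed
  have cli: "cl t p = p + t *\<^sub>R integral {0..1} (\<lambda>u. X (t * u) (cl (t * u) p))"
    if t: "t \<in> {0..1}" and p: "p \<in> B" for t p
  proof -
    have cX: "continuous_on {0..1} (\<lambda>u. X (t * u) (cl (t * u) p))"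
    proof (rule continuous_on_case_prod_compose[OF cont])
      show "continuous_on {0..1} (\<lambda>u. cl (t * u) p)"
        by (rule continuous_on_case_prod_compose[OF clc[unfolded A_def]])
          (use tu[OF t] p in \<open>auto intro!: continuous_intros\<close>)
    qed (use tu[OF t] p inb[OF p clb[OF tu[OF t] p]] in \<open>auto intro!: continuous_intros\<close>)
    have "uniform_limit (cbox 0 1) (\<lambda>n u. X (t * u) (c n (t * u) p)) (\<lambda>u. X (t * u) (cl (t * u) p)) sequentially"
    proof (rule uniform_limitI)
      fix e :: real assume "e > 0"
      from uniform_limitD[OF ul this] have "\<forall>\<^sub>F n in sequentially. \<forall>x\<in>A. dist ((\<lambda>(t, p). c n t p) x) ((\<lambda>(t, p). cl t p) x) < e" .
      thus "\<forall>\<^sub>F n in sequentially. \<forall>u\<in>cbox 0 1. dist (X (t * u) (c n (t * u) p)) (X (t * u) (cl (t * u) p)) < e"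
      proof eventually_elim
        case (elim n)
        show ?case
        proof
          fix u :: real assume "u \<in> cbox 0 1"
          hence u: "t * u \<in> {0..1}" using tu[OF t] by auto
          have "norm (X (t * u) (c n (t * u) p) - X (t * u) (cl (t * u) p)) \<le> norm (c n (t * u) p - cl (t * u) p) / 4"
            by (intro lip u inb[OF p] mb clb p)
          moreover have "norm (c n (t * u) p - cl (t * u) p) < e"
            using elim[rule_format, of "(t * u, p)"] u p by (simp add: A_def dist_norm)
          ultimately show "dist (X (t * u) (c n (t * u) p)) (X (t * u) (cl (t * u) p)) < e"
            unfolding dist_norm using norm_ge_zero[of "c n (t * u) p - cl (t * u) p"] by linarith
        qed
      qed
    qed
    then obtain I J where IJ: "\<And>n. ((\<lambda>u. X (t * u) (c n (t * u) p)) has_integral I n) (cbox 0 1)"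
      "((\<lambda>u. X (t * u) (cl (t * u) p)) has_integral J) (cbox 0 1)" "(I \<longlongrightarrow> J) sequentially"
      by (rule uniform_limit_integral_cbox) (use cuX[OF t p] in auto)
    have "(\<lambda>n. p + t *\<^sub>R I n) \<longlonglongrightarrow> p + t *\<^sub>R J" by (intro tendsto_intros IJ)
    moreover have "p + t *\<^sub>R I n = c (Suc n) t p" for n
      using integral_unique[OF IJ(1)[of n]] by (simp add: cS)
    ultimately have "(\<lambda>n. c (Suc n) t p) \<longlonglongrightarrow> p + t *\<^sub>R J" by simp
    moreover have "(\<lambda>n. c (Suc n) t p) \<longlonglongrightarrow> cl t p" by (rule LIMSEQ_Suc[OF ptl[OF t p]])
    ultimately show ?thesis using LIMSEQ_unique integral_unique[OF IJ(2)] by fastforce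
  qed
  have cld: "((\<lambda>t. cl t p) has_vector_derivative X t (cl t p)) (at t within {0..1})"
    if t: "t \<in> {0..1}" and p: "p \<in> B" for t p
  proof -
    have cX: "continuous_on {0..1} (\<lambda>s. X s (cl s p))"
    proof (rule continuous_on_case_prod_compose[OF cont])
      show "continuous_on {0..1} (\<lambda>s. cl s p)"
        by (rule continuous_on_case_prod_compose[OF clc[unfolded A_def]])
          (use p in \<open>auto intro!: continuous_intros\<close>)
    qed (use p inb[OF p clb] in \<open>auto intro!: continuous_intros\<close>)
    \<comment> \<open>Substituting \<open>s * u\<close> undoes the rescaling, after which the
      fundamental theorem of calculus yields the differential equation. The substitution degenerates
      at \<open>s = 0\<close>.\<close>
    have eq: "p + integral {0..s} (\<lambda>s. X s (cl s p)) = cl s p" if s: "s \<in> {0..1}" for s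
    proof (cases "s = 0")
      case True thus ?thesis using cli[OF s p] by simp
    next
      case False
      hence s0: "s > 0" using s by simp
      have "((\<lambda>s. X s (cl s p)) has_integral integral {0..s} (\<lambda>s. X s (cl s p))) {0..s}"
        by (intro integrable_integral integrable_continuous_real continuous_on_subset[OF cX]) (use s in auto)
      from has_integral_stretch_real[OF this, of s] s0
      have "((\<lambda>u. X (s * u) (cl (s * u) p)) has_integral (1 / s) *\<^sub>R integral {0..s} (\<lambda>s. X s (cl s p))) ((\<lambda>x. x / s) ` {0..s})"
        by simp
      moreover have "(\<lambda>x. x / s) ` {0..s} = {0..1}"
      proof -
        have "(\<lambda>x. x / s) ` {0..s} = {0 / s..s / s}"
          using s0 image_divide_atLeastAtMost[of s 0 s] by simp
        thus ?thesis using s0 by simp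
      qed
      ultimately have "integral {0..1} (\<lambda>u. X (s * u) (cl (s * u) p)) = (1 / s) *\<^sub>R integral {0..s} (\<lambda>s. X s (cl s p))"
        by (simp add: integral_unique)
      thus ?thesis using cli[OF s p] s0 by simp
    qed
    have "((\<lambda>s. p + integral {0..s} (\<lambda>s. X s (cl s p))) has_vector_derivative 0 + X t (cl t p)) (at t within {0..1})"
      by (intro has_vector_derivative_add has_vector_derivative_const integral_has_vector_derivative[OF cX t])
    hence "((\<lambda>s. p + integral {0..s} (\<lambda>s. X s (cl s p))) has_vector_derivative X t (cl t p)) (at t within {0..1})" by simp
    thus ?thesis
      by (rule has_vector_derivative_transform_within[OF _ zero_less_one t]) (use eq in auto)
  qed
  have cl0: "cl 0 p = p" if "p \<in> B" for p using cli[of 0 p] that by simp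
  show ?thesis
    using that[of cl] cl0 clb cld clh unfolding B_def by blast
qed

text \<open>Near the origin a field of order two is small and has a small Lipschitz constant, also
  when it depends on time, so \<open>picard_flow\<close> applies on a small ball. The displacement
  bound integrates the speed, at most \<open>C * (2 * norm p)^2\<close>, over unit time.\<close>

lemma flow_quadratic:
  fixes X :: "real \<Rightarrow> complex^2 \<Rightarrow> complex^2"
  assumes R: "R > 0" and cont: "continuous_on ({0..1} \<times> ball 0 R) (\<lambda>(t, z). X t z)"
    and hol: "\<And>t i. t \<in> {0..1} \<Longrightarrow> holo (\<lambda>z. X t z $ i) (ball 0 R)"
    and C: "C \<ge> 0" and bd: "\<And>t z. t \<in> {0..1} \<Longrightarrow> z \<in> ball 0 R \<Longrightarrow> norm (X t z) \<le> C * norm z ^ 2"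
  obtains d c where "0 < d" "2 * d \<le> R"
    "\<And>p. p \<in> ball 0 d \<Longrightarrow> c 0 p = p"
    "\<And>t p. t \<in> {0..1} \<Longrightarrow> p \<in> ball 0 d \<Longrightarrow> norm (c t p) \<le> 2 * norm p"
    "\<And>t p. t \<in> {0..1} \<Longrightarrow> p \<in> ball 0 d \<Longrightarrow> norm (c t p - p) \<le> 4 * C * norm p ^ 2"
    "\<And>t p. t \<in> {0..1} \<Longrightarrow> p \<in> ball 0 d \<Longrightarrow>
      ((\<lambda>t. c t p) has_vector_derivative X t (c t p)) (at t within {0..1})"
    "\<And>t i. t \<in> {0..1} \<Longrightarrow> holo (\<lambda>p. c t p $ i) (ball 0 d)"
proof -
  \<comment> \<open>\<open>R / 3\<close> leaves room for Cauchy's inequality on the doubled ball.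
    The other bound makes the Lipschitz constant \<open>8 * C * r\<close> at most
    \<open>1/4\<close>; \<open>C + 1\<close> covers the case \<open>C = 0\<close>.\<close>
  define r where "r = min (R / 3) (1 / (32 * (C + 1)))"
  have r: "r > 0" "2 * r < R" "r \<le> 1 / (32 * (C + 1))" using R C by (auto simp: r_def)
  have "32 * (C + 1) * r \<le> 1" using r(3) C by (simp add: field_simps)
  hence Cr: "8 * C * r \<le> 1 / 4" "C * r \<le> 1 / 4"
    using mult_nonneg_nonneg[OF C less_imp_le[OF r(1)]] r(1) by (simp_all add: algebra_simps)
  obtain c where c: "\<And>p. p \<in> ball 0 (r/2) \<Longrightarrow> c 0 p = p"
    "\<And>t p. t \<in> {0..1} \<Longrightarrow> p \<in> ball 0 (r/2) \<Longrightarrow> norm (c t p) \<le> 2 * norm p"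
    "\<And>t p. t \<in> {0..1} \<Longrightarrow> p \<in> ball 0 (r/2) \<Longrightarrow>
      ((\<lambda>t. c t p) has_vector_derivative X t (c t p)) (at t within {0..1})"
    "\<And>t i. t \<in> {0..1} \<Longrightarrow> holo (\<lambda>p. c t p $ i) (ball 0 (r/2))"
  proof (rule picard_flow[of r X, OF r(1)])
    show "continuous_on ({0..1} \<times> ball 0 r) (\<lambda>(t, z). X t z)"
      by (rule continuous_on_subset[OF cont]) (use r in auto)
    show "holo (\<lambda>z. X t z $ i) (ball 0 r)" if "t \<in> {0..1}" for t i
      by (rule holo_subset[OF hol[OF that]]) (use r in auto)
    show "norm (X t z) \<le> norm z / 4" if "t \<in> {0..1}" "z \<in> ball 0 r" for t z
    proof -
      have "norm (X t z) \<le> C * norm z ^ 2" using that r by (intro bd) auto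
      also have "\<dots> = (C * norm z) * norm z" by (simp add: power2_eq_square)
      also have "\<dots> \<le> (C * r) * norm z" using that C by (intro mult_right_mono mult_left_mono) auto
      also have "\<dots> \<le> 1 / 4 * norm z" using Cr by (intro mult_right_mono) auto
      finally show ?thesis by simp
    qed
    show "norm (X t x - X t y) \<le> norm (x - y) / 4"
      if "t \<in> {0..1}" "x \<in> ball 0 r" "y \<in> ball 0 r" for t x y
    proof -
      have "norm (X t x - X t y) \<le> 2 * (C * (2 * r) ^ 2 / r) * norm (x - y)"
        by (rule map_lipschitz_order[OF hol bd]) (use that r C in auto)
      also have "2 * (C * (2 * r) ^ 2 / r) = 8 * C * r" using r by (simp add: power2_eq_square)
      also have "8 * C * r * norm (x - y) \<le> 1 / 4 * norm (x - y)" using Cr by (intro mult_right_mono) auto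
      finally show ?thesis by simp
    qed
  qed blast
  have "norm (c t p - p) \<le> 4 * C * norm p ^ 2" if "t \<in> {0..1}" "p \<in> ball 0 (r/2)" for t p
  proof -
    have "norm (c t p - c 0 p) \<le> 4 * C * norm p ^ 2 * \<bar>t - 0\<bar>"
    proof (rule vector_derivative_bound[OF c(3)])
      fix s :: real assume s: "s \<in> {0..1}"
      have "norm (X s (c s p)) \<le> C * norm (c s p) ^ 2"
        using c(2)[OF s that(2)] that(2) r by (intro bd s) auto
      also have "\<dots> \<le> C * (2 * norm p) ^ 2"
        using c(2)[OF s that(2)] C by (intro mult_left_mono power_mono) auto
      finally show "norm (X s (c s p)) \<le> 4 * C * norm p ^ 2" by (simp add: power_mult_distrib)
    qed (use that in auto)
    also have "\<dots> \<le> 4 * C * norm p ^ 2 * 1"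
      using that C by (intro mult_left_mono) auto
    finally show ?thesis using c(1)[OF that(2)] by simp
  qed
  with c r show ?thesis by (intro that[of "r/2" c]) auto
qed

section \<open>Uniqueness of integral curves and the time one map\<close>

lemma map_lipschitz_local:
  fixes X :: "complex^2 \<Rightarrow> complex^2"
  assumes "holomorphic_map_at X p"
  obtains r L where "r > 0" "L \<ge> 0" "\<And>x y. x \<in> ball p r \<Longrightarrow> y \<in> ball p r \<Longrightarrow> norm (X x - X y) \<le> L * norm (x - y)"
proof -
  \<comment> \<open>Translation to the origin, where plain boundedness is the case
    \<open>k = 0\<close> of the order estimate.\<close>
  define Z where "Z = (\<lambda>z. X (p + z))"
  obtain R where R: "R > 0" "\<And>i. holo (\<lambda>z. X z $ i) (ball p R)"
    using holomorphic_map_atE[OF assms] by blast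
  have Zh: "holo (\<lambda>z. Z z $ i) (ball 0 R)" for i
    unfolding Z_def by (rule holo_compose[OF R(2)]) (auto intro!: holo_add simp: dist_norm)
  hence "holomorphic_map_at Z 0" using R(1) by (blast intro: holomorphic_map_at_ballI)
  hence "vanish 0 Z" by (intro vanish_0 holomorphic_map_at_isCont)
  then obtain S C where S: "S > 0" "C \<ge> 0" "\<And>z. z \<in> ball 0 S \<Longrightarrow> norm (Z z) \<le> C * norm z ^ 0"
    by (rule vanishE) blast
  define r where "r = min R S / 3"
  have r: "r > 0" "2 * r < min R S" using R S by (auto simp: r_def)
  define L where "L = 2 * (C * (2 * r) ^ 0 / r)"
  have "norm (X x - X y) \<le> L * norm (x - y)" if "x \<in> ball p r" "y \<in> ball p r" for x y
  proof -
    have "norm (Z (x - p) - Z (y - p)) \<le> L * norm ((x - p) - (y - p))"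
      unfolding L_def using that r S
      by (intro map_lipschitz_order[of Z "min R S"] holo_subset[OF Zh])
        (auto simp: dist_norm norm_minus_commute)
    thus ?thesis by (simp add: Z_def)
  qed
  moreover have "L \<ge> 0" using S r by (simp add: L_def)
  ultimately show ?thesis using that r(1) by blast
qed

text \<open>The set of times at which the curves agree is closed by continuity and open by a
  contraction estimate on a short time window; connectedness of the interval concludes. The estimate
  is local because a Lipschitz constant for \<open>X\<close> is available only near points of the
  curve.\<close>

lemma integral_curve_unique:
  assumes c1: "integral_curve X c1" and c2: "integral_curve X c2" and eq0: "c1 0 = c2 0"
    and t: "t \<in> {0..1}"
  shows "c1 t = c2 t"
proof -
  have d1: "(c1 has_vector_derivative X (c1 t)) (at t within {0..1})"
    and d2: "(c2 has_vector_derivative X (c2 t)) (at t within {0..1})"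
    and h1: "holomorphic_map_at X (c1 t)" if "t \<in> {0..1}" for t
    using c1 c2 that by (auto simp: integral_curve_def)
  have cont: "continuous_on {0..1} c1" "continuous_on {0..1} c2"
    using d1 d2 by (meson continuous_on_eq_continuous_within has_vector_derivative_continuous)+
  define E where "E = {t \<in> {0..1}. c1 t - c2 t = 0}"
  have "closedin (top_of_set {0..1}) E"
    unfolding E_def by (intro continuous_closedin_preimage_constant continuous_intros cont)
  moreover have "openin (top_of_set {0..1}) E"
    unfolding openin_contains_ball
  proof (intro conjI ballI)
    show "E \<subseteq> {0..1}" by (auto simp: E_def)
    fix s assume "s \<in> E"
    hence s: "s \<in> {0..1}" "c1 s = c2 s" by (auto simp: E_def)
    obtain r L where rL: "r > 0" "L \<ge> 0"
      "\<And>x y. x \<in> ball (c1 s) r \<Longrightarrow> y \<in> ball (c1 s) r \<Longrightarrow> norm (X x - X y) \<le> L * norm (x - y)"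
      using map_lipschitz_local[OF h1[OF s(1)]] by blast
    obtain e1 where e1: "e1 > 0" "\<And>t. t \<in> {0..1} \<Longrightarrow> dist t s < e1 \<Longrightarrow> dist (c1 t) (c1 s) < r"
      using cont(1) s(1) rL(1) unfolding continuous_on_iff by metis
    obtain e2 where e2: "e2 > 0" "\<And>t. t \<in> {0..1} \<Longrightarrow> dist t s < e2 \<Longrightarrow> dist (c2 t) (c2 s) < r"
      using cont(2) s(1) rL(1) unfolding continuous_on_iff by metis
    \<comment> \<open>Short enough that both curves stay in the ball where \<open>X\<close> has
      Lipschitz constant \<open>L\<close>, and that \<open>e * L\<close> is at most
      \<open>1/2\<close>. The largest distance \<open>M\<close> in the window then satisfies
      \<open>M \<le> M / 2\<close>.\<close>
    define e where "e = min (min e1 e2) (1 / (2 * (L + 1))) / 2"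
    have e: "e > 0" "e < e1" "e < e2" "e * L \<le> 1 / 2"
    proof -
      show "e > 0" using e1 e2 rL by (auto simp: e_def)
      show "e < e1" "e < e2" using \<open>e > 0\<close> by (auto simp: e_def)
      have "e \<le> 1 / (2 * (L + 1))" 
      proof -
        have "e \<le> 1 / (2 * (L + 1)) / 2" unfolding e_def by (intro divide_right_mono) auto
        moreover have "0 \<le> 1 / (2 * (L + 1))" using rL(2) by simp
        moreover have "q / 2 \<le> q" if "0 \<le> q" for q :: real using that by simp
        ultimately show ?thesis by (meson order_trans)
      qed
      hence "e * (2 * (L + 1)) \<le> 1" using rL(2) by (simp add: field_simps)
      thus "e * L \<le> 1 / 2" using \<open>e > 0\<close> by (simp add: algebra_simps)
    qed
    define K where "K = {0..1} \<inter> cball s e"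
    have K: "compact K" "s \<in> K" "convex K"
      using e s by (auto simp: K_def intro!: compact_Int_closed convex_Int)
    have "continuous_on K (\<lambda>t. norm (c1 t - c2 t))"
      by (intro continuous_intros continuous_on_subset[OF cont(1)] continuous_on_subset[OF cont(2)]) (auto simp: K_def)
    then obtain m where m: "m \<in> K" "\<And>t. t \<in> K \<Longrightarrow> norm (c1 t - c2 t) \<le> norm (c1 m - c2 m)"
      using continuous_attains_sup[OF K(1)] K(2) by blast
    define M where "M = norm (c1 m - c2 m)"
    have "norm ((c1 m - c2 m) - (c1 s - c2 s)) \<le> (L * M) * norm (m - s)"
    proof (rule differentiable_bound[of K "\<lambda>t. c1 t - c2 t" "\<lambda>t h. h *\<^sub>R (X (c1 t) - X (c2 t))"])
      fix x assume x: "x \<in> K"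
      hence x': "x \<in> {0..1}" "dist x s \<le> e" by (auto simp: K_def dist_commute)
      show "((\<lambda>t. c1 t - c2 t) has_derivative (\<lambda>h. h *\<^sub>R (X (c1 x) - X (c2 x)))) (at x within K)"
        using has_vector_derivative_diff[OF d1[OF x'(1)] d2[OF x'(1)]]
        unfolding has_vector_derivative_def by (rule has_derivative_subset) (auto simp: K_def)
      have "norm (X (c1 x) - X (c2 x)) \<le> L * norm (c1 x - c2 x)"
        using e1(2)[OF x'(1)] e2(2)[OF x'(1)] e x' s(2) by (intro rL(3)) (auto simp: dist_commute)
      also have "\<dots> \<le> L * M" unfolding M_def using m(2)[OF x] rL(2) by (intro mult_left_mono)
      finally have *: "norm (X (c1 x) - X (c2 x)) \<le> L * M" .
      show "onorm (\<lambda>h. h *\<^sub>R (X (c1 x) - X (c2 x))) \<le> L * M"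
      proof (rule onorm_le)
        fix h :: real
        show "norm (h *\<^sub>R (X (c1 x) - X (c2 x))) \<le> L * M * norm h"
          using mult_right_mono[OF * abs_ge_zero[of h]] by (simp add: mult.commute)
      qed
    qed (use K m in auto)
    also have "\<dots> \<le> (L * M) * e"
      using m(1) rL(2) by (intro mult_left_mono) (auto simp: K_def dist_norm norm_minus_commute M_def)
    also have "\<dots> = (e * L) * M" by simp
    also have "\<dots> \<le> 1 / 2 * M" using e by (intro mult_right_mono) (auto simp: M_def)
    finally have "M \<le> 1 / 2 * M" using s(2) by (simp add: M_def)
    hence "M \<le> 0" by simp
    hence "ball s e \<inter> {0..1} \<subseteq> E" using m(2) by (force simp: E_def K_def M_def)
    thus "\<exists>e>0. ball s e \<inter> {0..1} \<subseteq> E" using e(1) by blast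
  qed
  ultimately have "E = {} \<or> E = {0..1}"
    using connected_clopen[of "{0..1::real}"] by auto
  moreover have "0 \<in> E" using eq0 by (simp add: E_def)
  ultimately have "t \<in> E" using t by blast
  thus ?thesis by (simp add: E_def)
qed

text \<open>Uniqueness makes the definite description in \<open>exp_vf\<close> denote the endpoint
  of any integral curve at hand. Every later evaluation of \<open>exp_vf\<close> rests on
  this.\<close>

lemma exp_vf_eq:
  assumes "integral_curve X c" shows "exp_vf X (c 0) = c 1"
  unfolding exp_vf_def
proof (rule the_equality)
  show "\<exists>c'. integral_curve X c' \<and> c' 0 = c 0 \<and> c' 1 = c 1" using assms by blast
  fix q assume "\<exists>c'. integral_curve X c' \<and> c' 0 = c 0 \<and> c' 1 = q"
  then obtain c' where c': "integral_curve X c'" "c' 0 = c 0" "c' 1 = q" by blast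
  from integral_curve_unique[OF c'(1) assms c'(2), of 1] c'(3) show "q = c 1" by simp
qed

lemma integral_curve_reverse:
  assumes "integral_curve X c" "\<And>p. holomorphic_map_at X p \<Longrightarrow> holomorphic_map_at (\<lambda>z. - X z) p"
  shows "integral_curve (\<lambda>z. - X z) (\<lambda>t. c (1 - t))"
  unfolding integral_curve_def
proof (intro ballI conjI)
  fix t :: real assume t: "t \<in> {0..1}"
  hence t': "1 - t \<in> {0..1}" by auto
  show "holomorphic_map_at (\<lambda>z. - X z) (c (1 - t))"
    using assms t' by (auto simp: integral_curve_def)
  have "(\<lambda>t::real. 1 - t) ` {0..1} = {0..1}" by (auto simp: image_iff intro: bexI[of _ "1 - x" for x])
  moreover have "((\<lambda>t. 1 - t) has_vector_derivative (0 - 1)) (at t within {0..1})"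
    by (intro has_vector_derivative_diff has_vector_derivative_const has_vector_derivative_id)
  moreover have "(c has_vector_derivative X (c (1 - t))) (at (1 - t) within {0..1})"
    using assms(1) t' by (auto simp: integral_curve_def)
  ultimately have "((c \<circ> (\<lambda>t. 1 - t)) has_vector_derivative (0 - 1) *\<^sub>R X (c (1 - t))) (at t within {0..1})"
    by (intro vector_diff_chain_within) auto
  thus "((\<lambda>t. c (1 - t)) has_vector_derivative - X (c (1 - t))) (at t within {0..1})"
    by (simp add: o_def)
qed

lemma holomorphic_map_at_minus: "holomorphic_map_at X p \<Longrightarrow> holomorphic_map_at (\<lambda>z. - X z) p"
  by (auto simp: holomorphic_map_at_def)

text \<open>Along with the endpoint, the whole curve is kept with bounds on its size and
  displacement, because the later comparisons of flows argue along the curves.\<close>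

lemma exp_flow:
  assumes "holomorphic_map_at X 0" "vanish 2 X"
  obtains d C where "d > 0" "C \<ge> 0"
    "\<forall>p\<in>ball 0 d. \<exists>c. integral_curve X c \<and> c 0 = p \<and> c 1 = exp_vf X p \<and>
      (\<forall>t\<in>{0..1}. norm (c t) \<le> 2 * norm p \<and> norm (c t - p) \<le> C * norm p ^ 2)"
    "\<forall>i. holo (\<lambda>p. exp_vf X p $ i) (ball 0 d)"
proof -
  obtain R where R: "R > 0" "\<And>i. holo (\<lambda>z. X z $ i) (ball 0 R)"
    using holomorphic_map_atE[OF assms(1)] by blast
  obtain S C where S: "S > 0" "C \<ge> 0" "\<And>z. z \<in> ball 0 S \<Longrightarrow> norm (X z) \<le> C * norm z ^ 2"
    using vanishE[OF assms(2)] by blast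
  define T where "T = min R S"
  have T: "T > 0" "\<And>i. holo (\<lambda>z. X z $ i) (ball 0 T)"
    using R S holo_subset[OF R(2), of "ball 0 T"] by (auto simp: T_def subset_ball)
  have cX: "continuous_on (ball 0 T) X"
    by (subst continuous_on_componentwise, subst Basis_vec_def)
      (auto simp: inner_axis inner_complex_def intro!: continuous_intros holo_continuous_on[OF T(2)])
  have cX': "continuous_on ({0..1} \<times> ball 0 T) (\<lambda>(t::real, z). X z)"
    unfolding case_prod_beta by (rule continuous_on_compose2[OF cX]) (auto intro!: continuous_intros)
  have bd: "norm (X z) \<le> C * norm z ^ 2" if "z \<in> ball 0 T" for z
    using that by (intro S(3)) (auto simp: T_def)
  obtain d c where dc: "0 < d" "2 * d \<le> T"
    "\<And>p. p \<in> ball 0 d \<Longrightarrow> c 0 p = p"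
    "\<And>t p. t \<in> {0..1} \<Longrightarrow> p \<in> ball 0 d \<Longrightarrow> norm (c t p) \<le> 2 * norm p"
    "\<And>t p. t \<in> {0..1} \<Longrightarrow> p \<in> ball 0 d \<Longrightarrow> norm (c t p - p) \<le> 4 * C * norm p ^ 2"
    "\<And>t p. t \<in> {0..1} \<Longrightarrow> p \<in> ball 0 d \<Longrightarrow>
      ((\<lambda>t. c t p) has_vector_derivative X (c t p)) (at t within {0..1})"
    "\<And>t i. t \<in> {0..1} \<Longrightarrow> holo (\<lambda>p. c t p $ i) (ball 0 d)"
    using flow_quadratic[of T "\<lambda>_. X" C, OF T(1) cX' T(2) S(2) bd] by blast
  have ic: "integral_curve X (\<lambda>t. c t p)" if "p \<in> ball 0 d" for p
    unfolding integral_curve_def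
  proof (intro ballI conjI dc(6) that)
    fix t :: real assume t: "t \<in> {0..1}"
    have "c t p \<in> ball 0 T" using dc(4)[OF t that] dc(2) that by auto
    thus "holomorphic_map_at X (c t p)"
      unfolding holomorphic_map_at_def by (blast intro: holomorphic_atI T(2) open_ball)
  qed
  have ex: "exp_vf X p = c 1 p" if "p \<in> ball 0 d" for p
    using exp_vf_eq[OF ic[OF that]] dc(3)[OF that] by simp
  have "holo (\<lambda>p. exp_vf X p $ i) (ball 0 d)" for i
    by (rule holo_cong[OF open_ball _ dc(7)[of 1]]) (auto simp: ex)
  moreover have "\<exists>c. integral_curve X c \<and> c 0 = p \<and> c 1 = exp_vf X p \<and>
      (\<forall>t\<in>{0..1}. norm (c t) \<le> 2 * norm p \<and> norm (c t - p) \<le> 4 * C * norm p ^ 2)" if "p \<in> ball 0 d" for p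
    using ic[OF that] dc(3)[OF that] ex[OF that] dc(4,5)[OF _ that]
    by (intro exI[of _ "\<lambda>t. c t p"] conjI ballI) simp_all
  moreover have "4 * C \<ge> 0" using S(2) by simp
  ultimately show ?thesis using dc(1) by (intro that) blast+
qed

lemma exp_vf_holomorphic:
  assumes "holomorphic_map_at X 0" "vanish 2 X"
  shows "holomorphic_map_at (exp_vf X) 0" "exp_vf X 0 = 0" "vanish 2 (\<lambda>z. exp_vf X z - z)"
proof -
  obtain d C where d: "d > 0" "C \<ge> 0"
    "\<forall>p\<in>ball 0 d. \<exists>c. integral_curve X c \<and> c 0 = p \<and> c 1 = exp_vf X p \<and>
      (\<forall>t\<in>{0..1}. norm (c t) \<le> 2 * norm p \<and> norm (c t - p) \<le> C * norm p ^ 2)"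
    "\<forall>i. holo (\<lambda>p. exp_vf X p $ i) (ball 0 d)"
    using exp_flow[OF assms] by blast
  show "holomorphic_map_at (exp_vf X) 0" using d(4,1) by (blast intro: holomorphic_map_at_ballI)
  have *: "norm (exp_vf X p - p) \<le> C * norm p ^ 2" if "p \<in> ball 0 d" for p
  proof -
    from bspec[OF d(3) that] obtain c where "integral_curve X c" "c 0 = p" and c: "c 1 = exp_vf X p"
      "\<forall>t\<in>{0..1}. norm (c t) \<le> 2 * norm p \<and> norm (c t - p) \<le> C * norm p ^ 2" by blast
    from c(2)[rule_format, of 1] show ?thesis unfolding c(1) by simp
  qed
  thus "vanish 2 (\<lambda>z. exp_vf X z - z)" using d(1) by (intro vanishI) auto
  show "exp_vf X 0 = 0" using *[of 0] d(1) by simp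
qed

text \<open>An integral curve of \<open>X\<close> run backwards in time is an integral curve of
  \<open>- X\<close>.\<close>

lemma exp_vf_minus:
  assumes "holomorphic_map_at X 0" "vanish 2 X"
  shows "\<forall>\<^sub>F z in nhds 0. exp_vf (\<lambda>z. - X z) (exp_vf X z) = z"
proof -
  obtain d C where d: "d > 0" "C \<ge> 0"
    "\<forall>p\<in>ball 0 d. \<exists>c. integral_curve X c \<and> c 0 = p \<and> c 1 = exp_vf X p \<and>
      (\<forall>t\<in>{0..1}. norm (c t) \<le> 2 * norm p \<and> norm (c t - p) \<le> C * norm p ^ 2)"
    "\<forall>i. holo (\<lambda>p. exp_vf X p $ i) (ball 0 d)"
    using exp_flow[OF assms] by blast
  show ?thesis
  proof (rule eventually_nhds_ballI[OF d(1)])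
    fix p :: "complex^2" assume "p \<in> ball 0 d"
    from bspec[OF d(3) this] obtain c where c: "integral_curve X c" "c 0 = p" "c 1 = exp_vf X p" by blast
    from exp_vf_eq[OF integral_curve_reverse[OF c(1) holomorphic_map_at_minus]] c(2,3)
    show "exp_vf (\<lambda>z. - X z) (exp_vf X p) = p" by simp
  qed
qed

section \<open>Weierstrass division\<close>

definition pt :: "complex \<Rightarrow> complex \<Rightarrow> complex^2" where
  "pt x y = x *s ex + y *s ey"

lemma pt_nth [simp]: "pt x y $ 1 = x" "pt x y $ 2 = y"
  by (simp_all add: pt_def axis_def)

lemma pt_collapse [simp]: "pt (z $ 1) (z $ 2) = z"
  by (simp add: pt_def flip: vec2_eq)

lemma pt_0 [simp]: "pt 0 0 = 0"
  by (simp add: vec_eq_iff forall_2)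

lemma norm_pt_le: "norm (pt x y) \<le> norm x + norm y"
  using norm_vec2_le[of "pt x y"] by simp

lemma holo_pt:
  assumes "holo f V" "holo g U" "holo h U" "\<And>z. z \<in> U \<Longrightarrow> pt (g z) (h z) \<in> V"
  shows "holo (\<lambda>z. f (pt (g z) (h z))) U"
proof (rule holo_compose[OF assms(1)])
  show "holo (\<lambda>z. pt (g z) (h z) $ i) U" for i
    using assms(2,3) exhaust_2[of i] by auto
qed (rule assms(4))

lemma continuous_on_pt [continuous_intros]:
  fixes f g :: "'a::topological_space \<Rightarrow> complex"
  assumes "continuous_on S f" "continuous_on S g"
  shows "continuous_on S (\<lambda>x. pt (f x) (g x))"
  unfolding pt_def by (intro continuous_intros assms)

lemma holomorphic_on_pt_left:
  assumes "holo f U" "\<And>x. x \<in> T \<Longrightarrow> pt x y \<in> U"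
  shows "(\<lambda>x. f (pt x y)) holomorphic_on T"
proof -
  have "pt x y = y *s ey + x *s ex" for x by (simp add: pt_def add.commute)
  with assms show ?thesis using holo_slice_holomorphic[OF assms(1), of T "y *s ey" ex] by simp
qed

lemma holomorphic_on_pt_right:
  assumes "holo f U" "\<And>y. y \<in> T \<Longrightarrow> pt x y \<in> U"
  shows "(\<lambda>y. f (pt x y)) holomorphic_on T"
  using assms holo_slice_holomorphic[OF assms(1), of T "x *s ex" ey] by (simp add: pt_def)

text \<open>Two separate radii, because in Weierstrass division \<open>x\<close> is made small after
  the circle in \<open>y\<close> has been fixed.\<close>

definition bidisc :: "real \<Rightarrow> real \<Rightarrow> (complex^2) set" where
  "bidisc a b = {z. norm (z $ 1) < a \<and> norm (z $ 2) < b}"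

lemma open_bidisc: "open (bidisc a b)"
  unfolding bidisc_def by (intro open_Collect_conj open_Collect_less continuous_intros)

lemma bidisc_0: "a > 0 \<Longrightarrow> b > 0 \<Longrightarrow> 0 \<in> bidisc a b"
  by (simp add: bidisc_def)

lemma pt_bidisc [simp]: "pt x y \<in> bidisc a b \<longleftrightarrow> norm x < a \<and> norm y < b"
  by (simp add: bidisc_def)

lemma bidisc_subset_ball: "a + b \<le> R \<Longrightarrow> bidisc a b \<subseteq> ball 0 R"
proof
  fix z assume "a + b \<le> R" "z \<in> bidisc a b"
  thus "z \<in> ball 0 R" using norm_vec2_le[of z] by (auto simp: bidisc_def)
qed

text \<open>Hadamard's lemma in the variable \<open>x\<close> alone. The quotient is an integral
  over the segment from the axis \<open>x = 0\<close> and therefore lives on the whole bidisc, so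
  that division can be iterated without shrinking.\<close>

lemma divide_by_x:
  assumes hol: "holo r (bidisc a b)" and zero: "\<And>y. norm y < b \<Longrightarrow> r (pt 0 y) = 0"
  obtains g where "holo g (bidisc a b)" "\<And>z. z \<in> bidisc a b \<Longrightarrow> r z = z $ 1 * g z"
proof -
  define g where "g = (\<lambda>z::complex^2. integral {0..1} (\<lambda>t. ddir ex r (pt (of_real t * z $ 1) (z $ 2))))"
  have inb: "pt (of_real t * z $ 1) (z $ 2) \<in> bidisc a b" if "t \<in> {0..1}" "z \<in> bidisc a b" for t z
    using that mult_left_le_one_le[of "norm (z $ 1)" t] by (auto simp: bidisc_def norm_mult)
  have hd: "holo (ddir ex r) (bidisc a b)" by (rule holo_ddir[OF open_bidisc hol])
  have "holo g (bidisc a b)"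
    unfolding g_def
  proof (rule holo_integral[OF open_bidisc])
    show "continuous_on ({0..1} \<times> bidisc a b) (\<lambda>(t, z). ddir ex r (pt (of_real t * z $ 1) (z $ 2)))"
      unfolding case_prod_beta
      by (rule continuous_on_compose2[OF holo_continuous_on[OF hd]])
        (use inb in \<open>auto intro!: continuous_intros\<close>)
    show "holo (\<lambda>z. ddir ex r (pt (of_real t * z $ 1) (z $ 2))) (bidisc a b)" if "t \<in> {0..1}" for t
      by (rule holo_pt[OF hd]) (use inb[OF that] in \<open>auto intro!: holo_mult\<close>)
  qed
  moreover have "r z = z $ 1 * g z" if z: "z \<in> bidisc a b" for z
  proof -
    have "((\<lambda>t. r (pt (of_real t * z $ 1) (z $ 2))) has_vector_derivative
        z $ 1 * ddir ex r (pt (of_real t * z $ 1) (z $ 2))) (at t within {0..1})"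
      if t: "t \<in> {0..1}" for t
    proof -
      let ?w = "z $ 2 *s ey" and ?v = "z $ 1 *s ex"
      have e: "?w + of_real s *s ?v = pt (of_real s * z $ 1) (z $ 2)" for s
        by (simp add: vec_eq_iff forall_2 pt_def axis_def)
      have "((\<lambda>\<tau>. r (?w + \<tau> *s ?v)) has_field_derivative ddir ?v r (?w + of_real t *s ?v)) (at (of_real t))"
        by (rule holo_slice[OF hol]) (use inb[OF t z] e in simp)
      hence "((\<lambda>s. r (?w + of_real s *s ?v)) has_vector_derivative ddir ?v r (?w + of_real t *s ?v)) (at t within {0..1})"
        by (rule has_vector_derivative_real_field)
      thus ?thesis
        unfolding e using ddir_smult[OF hol inb[OF t z], of "z $ 1" ex] by simp
    qed
    hence "((\<lambda>t. z $ 1 * ddir ex r (pt (of_real t * z $ 1) (z $ 2))) has_integral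
        (r (pt (of_real 1 * z $ 1) (z $ 2)) - r (pt (of_real 0 * z $ 1) (z $ 2)))) {0..1}"
      by (intro fundamental_theorem_of_calculus) auto
    moreover have "r (pt 0 (z $ 2)) = 0" using z by (intro zero) (auto simp: bidisc_def)
    ultimately have "((\<lambda>t. z $ 1 * ddir ex r (pt (of_real t * z $ 1) (z $ 2))) has_integral r z) {0..1}"
      by simp
    from integral_unique[OF this] show ?thesis unfolding g_def integral_mult_right by simp
  qed
  ultimately show ?thesis using that by blast
qed

text \<open>The exact order at zero, as a factorization with nonvanishing cofactor. A function that
  is zero near the origin has no order, so the predicate also records that \<open>f\<close> is not
  such a function.\<close>

definition ord0 :: "nat \<Rightarrow> (complex \<Rightarrow> complex) \<Rightarrow> bool" where
  "ord0 d f \<longleftrightarrow> (\<exists>R>0. \<exists>h. h holomorphic_on ball 0 R \<and> (\<forall>y\<in>ball 0 R. f y = y ^ d * h y \<and> h y \<noteq> 0))"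

lemma ord0_exists:
  assumes "f holomorphic_on ball 0 R" "w \<in> ball 0 R" "f w \<noteq> 0"
  obtains d where "ord0 d f"
proof -
  have "R > 0" using assms(2) by (metis ball_eq_empty empty_iff not_le)
  have "\<exists>w\<in>ball 0 R. f w \<noteq> 0" using assms(2,3) by blast
  with zorder_exist_zero[OF assms(1) open_ball connected_ball, of 0] \<open>R > 0\<close> obtain r where
    r: "r > 0" "zor_poly f 0 holomorphic_on cball 0 r"
      "\<forall>w\<in>cball 0 r. f w = zor_poly f 0 w * (w - 0) ^ nat (zorder f 0) \<and> zor_poly f 0 w \<noteq> 0"
    by auto
  show ?thesis
    by (rule that[of "nat (zorder f 0)"], unfold ord0_def)
      (intro exI[of _ r] conjI exI[of _ "zor_poly f 0"] holomorphic_on_subset[OF r(2)]; use r in auto)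
qed

lemma ord0_nonzero:
  assumes "ord0 d f" shows "\<not> (\<forall>\<^sub>F y in nhds 0. f y = 0)"
proof
  assume "\<forall>\<^sub>F y in nhds 0. f y = 0"
  then obtain S where S: "S > 0" "\<And>y. y \<in> ball 0 S \<Longrightarrow> f y = 0" by (rule eventually_nhds_ballE) blast
  from assms obtain R h where R: "R > 0" "\<forall>y\<in>ball 0 R. f y = y ^ d * h y \<and> h y \<noteq> 0"
    unfolding ord0_def by blast
  define y :: complex where "y = of_real (min R S / 2)"
  have "norm y = min R S / 2" using R S by (simp add: y_def)
  hence y: "y \<in> ball 0 R" "y \<in> ball 0 S" "y \<noteq> 0" using R(1) S(1) by auto
  show False using R(2)[rule_format, OF y(1)] S(2)[OF y(2)] y(3) by simp
qed

lemma holomorphic_ball_tendsto: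
  assumes "f holomorphic_on ball 0 r" "r > 0" shows "(f \<longlongrightarrow> f 0) (at 0)"
  using holomorphic_on_imp_continuous_on[OF assms(1)] assms(2)
  by (simp add: continuous_on_eq_continuous_at isCont_def)

text \<open>Division by \<open>x\<close> must stop: the slice at height \<open>z0 $ 2\<close> is not
  identically zero, hence has a finite order \<open>n\<close> at \<open>x = 0\<close>, which
  excludes a factor \<open>x ^ Suc n\<close>. When it stops, the cofactor is nonzero somewhere on
  the axis \<open>x = 0\<close>, though perhaps not at the origin.\<close>

lemma factor_x_power:
  assumes hol: "holo r (bidisc a b)" and ab: "a > 0" "b > 0" and nz: "z0 \<in> bidisc a b" "r z0 \<noteq> 0"
  obtains m g y where "holo g (bidisc a b)" "\<And>z. z \<in> bidisc a b \<Longrightarrow> r z = z $ 1 ^ m * g z"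
    "norm y < b" "g (pt 0 y) \<noteq> 0"
proof (rule ccontr)
  note obt = that
  assume nt: "\<not> thesis"
  hence contra: "g (pt 0 y) = 0"
    if "holo g (bidisc a b)" "\<And>z. z \<in> bidisc a b \<Longrightarrow> r z = z $ 1 ^ m * g z" "norm y < b" for g m y
    using obt[OF that(1,2,3)] nt by blast
  have fac: "\<exists>g. holo g (bidisc a b) \<and> (\<forall>z\<in>bidisc a b. r z = z $ 1 ^ m * g z)" for m
  proof (induction m)
    case 0 thus ?case using hol by auto
  next
    case (Suc m)
    then obtain g where g: "holo g (bidisc a b)" "\<And>z. z \<in> bidisc a b \<Longrightarrow> r z = z $ 1 ^ m * g z" by blast
    obtain g' where "holo g' (bidisc a b)" "\<And>z. z \<in> bidisc a b \<Longrightarrow> g z = z $ 1 * g' z"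
      by (rule divide_by_x[OF g(1)]) (use contra[OF g] in blast)+
    thus ?case using g(2) by (intro exI[of _ g']) (auto simp: mult_ac)
  qed
  define h where "h = (\<lambda>x. r (pt x (z0 $ 2)))"
  have b0: "norm (z0 $ 2) < b" "norm (z0 $ 1) < a" using nz(1) by (auto simp: bidisc_def)
  have hh: "h holomorphic_on ball 0 a"
    unfolding h_def by (rule holomorphic_on_pt_left[OF hol]) (use b0 in auto)
  have hz: "h (z0 $ 1) \<noteq> 0" using nz by (simp add: h_def)
  obtain n where "ord0 n h"
    by (rule ord0_exists[OF hh _ hz]) (use b0 in auto)
  then obtain s' G where sG: "s' > 0" "G holomorphic_on ball 0 s'" "\<forall>y\<in>ball 0 s'. h y = y ^ n * G y \<and> G y \<noteq> 0"
    unfolding ord0_def by blast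
  define s where "s = min s' a"
  have G: "s > 0" "s \<le> a" "\<And>w. w \<in> ball 0 s \<Longrightarrow> h w = w ^ n * G w" "\<And>w. w \<in> ball 0 s \<Longrightarrow> G w \<noteq> 0"
    using sG ab by (auto simp: s_def)
  obtain g where g: "holo g (bidisc a b)" "\<And>z. z \<in> bidisc a b \<Longrightarrow> r z = z $ 1 ^ Suc n * g z"
    using fac[of "Suc n"] by blast
  have hg: "(\<lambda>x. g (pt x (z0 $ 2))) holomorphic_on ball 0 a"
    by (rule holomorphic_on_pt_left[OF g(1)]) (use b0 in auto)
  \<comment> \<open>Cancelling \<open>w ^ n\<close> exhibits \<open>G\<close> as a multiple of
    \<open>w\<close>, contrary to \<open>G 0 \<noteq> 0\<close>. The cancellation needs
    \<open>w \<noteq> 0\<close>, so the value at zero is reached as a limit.\<close>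
  have eq: "G w = w * g (pt w (z0 $ 2))" if "w \<in> ball 0 s - {0}" for w
  proof -
    have "w ^ n * G w = w ^ Suc n * g (pt w (z0 $ 2))"
      using G(3)[of w] g(2)[of "pt w (z0 $ 2)"] that b0 G(2) by (auto simp: h_def)
    thus ?thesis using that by simp
  qed
  have "(G \<longlongrightarrow> G 0) (at 0)"
    by (rule holomorphic_ball_tendsto[OF sG(2,1)])
  moreover have "((\<lambda>w. w * g (pt w (z0 $ 2))) \<longlongrightarrow> 0 * g (pt 0 (z0 $ 2))) (at 0)"
    by (rule tendsto_mult[OF tendsto_ident_at holomorphic_ball_tendsto[OF hg ab(1)]])
  moreover have "\<forall>\<^sub>F w in at 0. G w = w * g (pt w (z0 $ 2))"
    unfolding eventually_at using G(1) eq by (intro exI[of _ s]) (auto simp: dist_commute)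
  ultimately have "((\<lambda>w. w * g (pt w (z0 $ 2))) \<longlongrightarrow> G 0) (at 0)"
      "((\<lambda>w. w * g (pt w (z0 $ 2))) \<longlongrightarrow> 0) (at 0)"
    by (auto intro: Lim_transform_eventually)
  hence "G 0 = 0" by (rule tendsto_unique[rotated]) simp
  thus False using G(1,4) by simp
qed

text \<open>For \<open>z\<close> in the bidisc the point \<open>z $ 2\<close> stays off the circle,
  so the integrand is jointly continuous and holomorphic in \<open>z\<close>. This serves both for
  the quotient \<open>q\<close> and for the auxiliary integral \<open>T\<close> of the
  division.\<close>

lemma Cauchy_quotient_holo:
  assumes "holo u V" "holo w V" "s > 0"
    and V: "\<And>x \<zeta>. norm x < a \<Longrightarrow> norm \<zeta> = s \<Longrightarrow> pt x \<zeta> \<in> V \<and> w (pt x \<zeta>) \<noteq> 0"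
  shows "holo (\<lambda>z. contour_integral (circlepath 0 s) (\<lambda>\<zeta>. u (pt (z $ 1) \<zeta>) / (w (pt (z $ 1) \<zeta>) * (\<zeta> - z $ 2)))) (bidisc a s)"
  unfolding contour_integral_integral
proof (rule holo_integral[OF open_bidisc])
  have c: "norm (circlepath 0 s t) = s" for t using assms(3) by (simp add: circlepath norm_mult)
  have inV: "pt (z $ 1) (circlepath 0 s t) \<in> V" "w (pt (z $ 1) (circlepath 0 s t)) \<noteq> 0"
    if "z \<in> bidisc a s" for z t
    using V[of "z $ 1" "circlepath 0 s t"] c that by (auto simp: bidisc_def)
  have nz: "circlepath 0 s t \<noteq> z $ 2" if "z \<in> bidisc a s" for z t
    using c[of t] that by (auto simp: bidisc_def)
  have cc: "continuous_on S (\<lambda>x. circlepath 0 s (fst x))" for S :: "(real \<times> (complex^2)) set"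
    unfolding circlepath by (intro continuous_intros)
  have cu: "continuous_on ({0..1} \<times> bidisc a s) (\<lambda>x. f (pt (snd x $ 1) (circlepath 0 s (fst x))))"
    if "holo f V" for f
    by (rule continuous_on_compose2[OF holo_continuous_on[OF that]])
      (use inV(1) in \<open>auto intro!: continuous_intros cc\<close>)
  show "continuous_on ({0..1} \<times> bidisc a s) (\<lambda>(t, z). u (pt (z $ 1) (circlepath 0 s t))
      / (w (pt (z $ 1) (circlepath 0 s t)) * (circlepath 0 s t - z $ 2))
      * vector_derivative (circlepath 0 s) (at t))"
    unfolding case_prod_beta vector_derivative_circlepath
  proof (intro continuous_intros cu[OF assms(1)] cu[OF assms(2)] cc)
    show "\<forall>x\<in>{0..1} \<times> bidisc a s. w (pt (snd x $ 1) (circlepath 0 s (fst x))) * (circlepath 0 s (fst x) - snd x $ 2) \<noteq> 0"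
      using inV(2) nz by auto
  qed
  show "holo (\<lambda>z. u (pt (z $ 1) (circlepath 0 s t))
      / (w (pt (z $ 1) (circlepath 0 s t)) * (circlepath 0 s t - z $ 2))
      * vector_derivative (circlepath 0 s) (at t)) (bidisc a s)" for t
    using inV nz
    by (intro holo_mult holo_divide holo_diff holo_const holo_nth holo_pt[OF assms(1)] holo_pt[OF assms(2)]) auto
qed

text \<open>The radial segment joining points of equal angle on the two circles stays in the closed
  annulus, which gives a linear homotopy.\<close>

lemma contour_integral_circles_eq:
  assumes "f holomorphic_on S" "open S" "0 < s1" "s1 \<le> s2"
    and "\<And>\<zeta>. s1 \<le> norm \<zeta> \<Longrightarrow> norm \<zeta> \<le> s2 \<Longrightarrow> \<zeta> \<in> S"
  shows "contour_integral (circlepath 0 s1) f = contour_integral (circlepath 0 s2) f"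
proof (rule Cauchy_theorem_homotopic_loops[OF _ assms(2,1)])
  show "homotopic_loops S (circlepath 0 s1) (circlepath 0 s2)"
  proof (rule homotopic_loops_linear)
    fix t :: real
    show "closed_segment (circlepath 0 s1 t) (circlepath 0 s2 t) \<subseteq> S"
    proof
      fix \<zeta> assume "\<zeta> \<in> closed_segment (circlepath 0 s1 t) (circlepath 0 s2 t)"
      then obtain u where u: "0 \<le> u" "u \<le> 1"
        "\<zeta> = (1 - u) *\<^sub>R circlepath 0 s1 t + u *\<^sub>R circlepath 0 s2 t" by (auto simp: closed_segment_def)
      have "\<zeta> = of_real ((1 - u) * s1 + u * s2) * exp (2 * of_real pi * \<i> * of_real t)"
        unfolding u(3) circlepath by (simp add: scaleR_conv_of_real algebra_simps)
      hence n: "norm \<zeta> = \<bar>(1 - u) * s1 + u * s2\<bar>" by (simp only: norm_mult norm_of_real) simp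
      have "s1 + u * (s2 - s1) = (1 - u) * s1 + u * s2" by (simp add: algebra_simps)
      moreover have "0 \<le> u * (s2 - s1)" using u(1) assms(4) by simp
      moreover have "u * (s2 - s1) \<le> 1 * (s2 - s1)"
        by (rule mult_right_mono[OF u(2)]) (use assms(4) in simp)
      ultimately have "s1 \<le> norm \<zeta>" "norm \<zeta> \<le> s2" using n assms(3) by auto
      thus "\<zeta> \<in> S" by (rule assms(5))
    qed
  qed auto
qed auto

text \<open>The quotient \<open>q\<close> is the Cauchy integral of \<open>u / w\<close> in \<open>y\<close> over a circle around the zeros of \<open>w\<close>,
  so the remainder divided by \<open>w\<close> has vanishing Cauchy integral. This persists after division by
  a power of \<open>x\<close>; at \<open>x = 0\<close> it forces a quotient without pole to vanish, whence \<open>d' < d\<close>.\<close>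

lemma weierstrass_reduce:
  assumes w: "holomorphic_at w 0" and od: "ord0 d (\<lambda>y. w (pt 0 y))" and u: "holomorphic_at u 0"
  obtains q where "holomorphic_at q 0" "(\<forall>\<^sub>F z in nhds 0. u z = q z * w z) \<or>
    (\<exists>m g d'. holomorphic_at g 0 \<and> (\<forall>\<^sub>F z in nhds 0. u z - q z * w z = z $ 1 ^ m * g z) \<and>
      ord0 d' (\<lambda>y. g (pt 0 y)) \<and> d' < d)"
proof -
  obtain Rw where Rw: "Rw > 0" "holo w (ball 0 Rw)" using holomorphic_atE[OF w] by blast
  obtain Ru where Ru: "Ru > 0" "holo u (ball 0 Ru)" using holomorphic_atE[OF u] by blast
  obtain Rh h where Rh: "Rh > 0" "h holomorphic_on ball 0 Rh"
    "\<forall>y\<in>ball 0 Rh. w (pt 0 y) = y ^ d * h y \<and> h y \<noteq> 0" using od unfolding ord0_def by blast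
  define R0 where "R0 = min Rw Ru"
  define V where "V = ball (0::complex^2) R0"
  have hw: "holo w V" and hu: "holo u V"
    unfolding V_def R0_def by (auto intro: holo_subset[OF Rw(2)] holo_subset[OF Ru(2)])
  have R0: "R0 > 0" using Rw Ru by (simp add: R0_def)
  define s where "s = min R0 Rh / 4"
  define s1 where "s1 = s / 2"
  have s: "s > 0" "s1 > 0" "s1 < s" "s < R0 / 2" "s < Rh" using R0 Rh(1) by (auto simp: s_def s1_def)
  \<comment> \<open>The closed annulus between the circles of radii \<open>s1\<close> and
    \<open>s\<close>. Nonvanishing of \<open>w\<close> on all of it allows the contour to be moved
    from one circle to the other.\<close>
  define K where "K = cball (0::complex) s - ball 0 s1"
  have "compact K" unfolding K_def by (intro compact_diff) auto
  have Kmem: "\<zeta> \<in> K \<longleftrightarrow> s1 \<le> norm \<zeta> \<and> norm \<zeta> \<le> s" for \<zeta> by (auto simp: K_def)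
  have inV: "pt x y \<in> V" if "norm x + norm y < R0" for x y
    using that norm_pt_le[of x y] by (auto simp: V_def)
  define W where "W = {(\<zeta>, x). pt x \<zeta> \<in> V \<and> w (pt x \<zeta>) \<noteq> 0}"
  have "open W"
  proof -
    have "open ((\<lambda>p. pt (snd p) (fst p)) -` (w -` (-{0}) \<inter> V))"
    proof (rule open_vimage)
      show "open (w -` (-{0}) \<inter> V)"
        using holo_continuous_on[OF hw] continuous_on_open_vimage[of V w] by (auto simp: V_def)
      show "continuous_on UNIV (\<lambda>p. pt (snd p) (fst p))" by (intro continuous_intros)
    qed
    moreover have "W = (\<lambda>p. pt (snd p) (fst p)) -` (w -` (-{0}) \<inter> V)" by (auto simp: W_def)
    ultimately show ?thesis by simp
  qed
  have w0: "w (pt 0 \<zeta>) \<noteq> 0" if "\<zeta> \<noteq> 0" "norm \<zeta> \<le> s" for \<zeta> using Rh(3) that s by auto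
  \<comment> \<open>On the axis \<open>x = 0\<close> the only possible zero of \<open>w\<close> in
    the disc is \<open>y = 0\<close>, so there is none in the annulus; the tube lemma extends this
    to all small \<open>x\<close>.\<close>
  have "\<exists>a>0. a < R0 / 2 \<and> (\<forall>x \<zeta>. norm x < a \<longrightarrow> \<zeta> \<in> K \<longrightarrow> pt x \<zeta> \<in> V \<and> w (pt x \<zeta>) \<noteq> 0)"
  proof -
    have KW: "(\<lambda>\<zeta>. (\<zeta>, 0)) ` K \<subseteq> W \<inter> K \<times> UNIV"
    proof
      fix p :: "complex \<times> complex" assume "p \<in> (\<lambda>\<zeta>. (\<zeta>, 0)) ` K"
      then obtain \<zeta> where p: "p = (\<zeta>, 0)" "\<zeta> \<in> K" by blast
      hence z: "s1 \<le> norm \<zeta>" "norm \<zeta> \<le> s" "\<zeta> \<noteq> 0" using s(2) by (auto simp: Kmem)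
      have "pt 0 \<zeta> \<in> V" by (rule inV) (use z s R0 in auto)
      thus "p \<in> W \<inter> K \<times> UNIV" using w0[OF z(3,2)] p by (simp add: W_def)
    qed
    have "of_real s \<in> K" using s by (simp add: Kmem)
    hence "K \<noteq> {}" by blast
    have "openin (top_of_set (K \<times> UNIV)) (W \<inter> K \<times> UNIV)"
      using openin_open_Int[OF \<open>open W\<close>, of "K \<times> UNIV"] by (simp add: Int_commute)
    then obtain T where T: "openin (top_of_set UNIV) T" "0 \<in> T" "K \<times> T \<subseteq> W \<inter> K \<times> UNIV"
      using tube_lemma[OF \<open>compact K\<close> \<open>K \<noteq> {}\<close> KW] by blast
    have "open T" using T(1) by simp
    then obtain e where e: "e > 0" "ball 0 e \<subseteq> T" using T(2) open_contains_ball by blast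
    show ?thesis
    proof (intro exI[of _ "min e (R0 / 4)"] conjI allI impI)
      fix x \<zeta> :: complex assume x: "norm x < min e (R0 / 4)" and z: "\<zeta> \<in> K"
      have "x \<in> T" using x by (intro subsetD[OF e(2)]) auto
      with z have "(\<zeta>, x) \<in> W" using T(3) by blast
      thus "pt x \<zeta> \<in> V" "w (pt x \<zeta>) \<noteq> 0" by (auto simp: W_def)
    qed (use e R0 in auto)
  qed
  then obtain a where a: "a > 0" "a < R0 / 2"
    "\<And>x \<zeta>. norm x < a \<Longrightarrow> \<zeta> \<in> K \<Longrightarrow> pt x \<zeta> \<in> V \<and> w (pt x \<zeta>) \<noteq> 0" by blast
  define q where "q = (\<lambda>z::complex^2. 1 / (2 * of_real pi * \<i>) *
    contour_integral (circlepath 0 s) (\<lambda>\<zeta>. u (pt (z $ 1) \<zeta>) / (w (pt (z $ 1) \<zeta>) * (\<zeta> - z $ 2))))"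
  have hq: "holo q (bidisc a s)"
    unfolding q_def using s a(3)
    by (intro holo_mult holo_const Cauchy_quotient_holo[OF hu hw]) (auto simp: Kmem)
  have BV: "bidisc a s \<subseteq> V" unfolding V_def using a s by (intro bidisc_subset_ball) auto
  have qat: "holomorphic_at q 0" by (rule holomorphic_atI[OF hq open_bidisc bidisc_0[OF a(1) s(1)]])
  define r where "r = (\<lambda>z. u z - q z * w z)"
  have hr: "holo r (bidisc a s)"
    unfolding r_def by (intro holo_diff holo_mult hq holo_subset[OF hu BV] holo_subset[OF hw BV])
  have ev: "\<forall>\<^sub>F z in nhds 0. z \<in> bidisc a s"
    by (rule eventually_nhds_in_open[OF open_bidisc bidisc_0[OF a(1) s(1)]])
  show ?thesis
  proof (cases "\<forall>z\<in>bidisc a s. r z = 0")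
    case True
    with ev have "\<forall>\<^sub>F z in nhds 0. u z = q z * w z"
      by (auto elim!: eventually_mono simp: r_def)
    with qat show ?thesis using that by blast
  next
    case False
    then obtain z0 where z0: "z0 \<in> bidisc a s" "r z0 \<noteq> 0" by blast
    obtain m g y0 where g: "holo g (bidisc a s)" "\<And>z. z \<in> bidisc a s \<Longrightarrow> r z = z $ 1 ^ m * g z"
      "norm y0 < s" "g (pt 0 y0) \<noteq> 0"
      by (rule factor_x_power[of r a s z0, OF hr a(1) s(1) z0]) blast
    have gat: "holomorphic_at g 0" by (rule holomorphic_atI[OF g(1) open_bidisc bidisc_0[OF a(1) s(1)]])
    have hg0: "(\<lambda>y. g (pt 0 y)) holomorphic_on ball 0 s"
      by (rule holomorphic_on_pt_right[OF g(1)]) (use a in auto)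
    obtain d' where d': "ord0 d' (\<lambda>y. g (pt 0 y))"
      by (rule ord0_exists[OF hg0, of y0]) (use g in auto)
    have evr: "\<forall>\<^sub>F z in nhds 0. u z - q z * w z = z $ 1 ^ m * g z"
      using ev by eventually_elim (use g(2) in \<open>simp add: r_def\<close>)
    have "d' < d"
    proof (rule ccontr)
      assume "\<not> d' < d"
      obtain Rg G where G: "Rg > 0" "G holomorphic_on ball 0 Rg"
        "\<forall>y\<in>ball 0 Rg. g (pt 0 y) = y ^ d' * G y \<and> G y \<noteq> 0" using d' unfolding ord0_def by blast
      define T where "T = (\<lambda>z::complex^2. contour_integral (circlepath 0 s1)
        (\<lambda>\<zeta>. g (pt (z $ 1) \<zeta>) / (w (pt (z $ 1) \<zeta>) * (\<zeta> - z $ 2))))"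
      have hT: "holo T (bidisc a s1)"
        unfolding T_def
        by (rule Cauchy_quotient_holo[OF g(1) holo_subset[OF hw BV] s(2)])
          (use a(3) s in \<open>auto simp: Kmem\<close>)
      \<comment> \<open>The Cauchy integrals of \<open>u / w\<close> and of \<open>q\<close> over
        the inner circle both give \<open>q\<close>, the former after moving the contour. Hence the
        Cauchy integral of their difference \<open>x ^ m * g / w\<close> vanishes, and
        \<open>x ^ m\<close> can be cancelled for \<open>x \<noteq> 0\<close>.\<close>
      have T0: "T (pt x y) = 0" if x: "norm x < a" "x \<noteq> 0" and y: "norm y < s1" for x y
      proof -
        define f where "f = (\<lambda>\<zeta>. u (pt x \<zeta>) / (w (pt x \<zeta>) * (\<zeta> - y)))"
        define S where "S = ((\<lambda>\<zeta>. (\<zeta>, x)) -` W) \<inter> (- {y})"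
        have oS: "open S"
          unfolding S_def by (intro open_Int open_Compl closed_singleton open_vimage[OF \<open>open W\<close>])
            (intro continuous_intros)
        have fS: "f holomorphic_on S"
          unfolding f_def
          by (intro holomorphic_intros holomorphic_on_pt_right[OF hu] holomorphic_on_pt_right[OF hw])
            (auto simp: S_def W_def)
        have KS: "\<zeta> \<in> S" if "s1 \<le> norm \<zeta>" "norm \<zeta> \<le> s" for \<zeta>
          using a(3)[OF x(1), of \<zeta>] that y by (auto simp: S_def W_def Kmem)
        have fi: "f contour_integrable_on circlepath 0 s1"
          by (intro contour_integrable_continuous_circlepath continuous_on_subset[OF holomorphic_on_imp_continuous_on[OF fS]])
            (use KS s in auto)
        have q1: "contour_integral (circlepath 0 s1) f = 2 * of_real pi * \<i> * q (pt x y)"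
          using contour_integral_circles_eq[OF fS oS s(2) less_imp_le[OF s(3)] KS]
          by (simp add: q_def f_def)
        have hqy: "(\<lambda>\<zeta>. q (pt x \<zeta>)) holomorphic_on ball 0 s"
          by (rule holomorphic_on_pt_right[OF hq]) (use x in auto)
        have q2: "((\<lambda>\<zeta>. q (pt x \<zeta>) / (\<zeta> - y)) has_contour_integral (2 * of_real pi * \<i> * q (pt x y))) (circlepath 0 s1)"
        proof (rule Cauchy_integral_circlepath)
          have "cball 0 s1 \<subseteq> ball (0::complex) s" using s by auto
          thus "continuous_on (cball 0 s1) (\<lambda>\<zeta>. q (pt x \<zeta>))"
            by (rule continuous_on_subset[OF holomorphic_on_imp_continuous_on[OF hqy]])
          show "(\<lambda>\<zeta>. q (pt x \<zeta>)) holomorphic_on ball 0 s1"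
            by (rule holomorphic_on_subset[OF hqy]) (use s in auto)
        qed (use y in simp)
        have "((\<lambda>\<zeta>. f \<zeta> - q (pt x \<zeta>) / (\<zeta> - y)) has_contour_integral
            (contour_integral (circlepath 0 s1) f - 2 * of_real pi * \<i> * q (pt x y))) (circlepath 0 s1)"
          by (rule has_contour_integral_diff[OF has_contour_integral_integral[OF fi] q2])
        hence "contour_integral (circlepath 0 s1) (\<lambda>\<zeta>. f \<zeta> - q (pt x \<zeta>) / (\<zeta> - y)) = 0"
          using q1 by (simp add: contour_integral_unique)
        moreover have "contour_integral (circlepath 0 s1) (\<lambda>\<zeta>. f \<zeta> - q (pt x \<zeta>) / (\<zeta> - y)) =
          contour_integral (circlepath 0 s1) (\<lambda>\<zeta>. x ^ m * (g (pt x \<zeta>) / (w (pt x \<zeta>) * (\<zeta> - y))))"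
        proof (rule contour_integral_cong[OF refl])
          fix \<zeta> assume "\<zeta> \<in> path_image (circlepath 0 s1)"
          hence z: "norm \<zeta> = s1" using s by simp
          hence wz: "w (pt x \<zeta>) \<noteq> 0" "\<zeta> \<noteq> y" using a(3)[OF x(1), of \<zeta>] s y by (auto simp: Kmem)
          have "u (pt x \<zeta>) = q (pt x \<zeta>) * w (pt x \<zeta>) + x ^ m * g (pt x \<zeta>)"
            using g(2)[of "pt x \<zeta>"] z s x by (simp add: r_def algebra_simps)
          thus "f \<zeta> - q (pt x \<zeta>) / (\<zeta> - y) = x ^ m * (g (pt x \<zeta>) / (w (pt x \<zeta>) * (\<zeta> - y)))"
            using wz by (simp add: f_def divide_simps)
        qed
        moreover have "\<dots> = x ^ m * T (pt x y)"
        proof -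
          have "(\<lambda>\<zeta>. g (pt x \<zeta>) / (w (pt x \<zeta>) * (\<zeta> - y))) contour_integrable_on circlepath 0 s1"
            using a(3)[OF x(1)] x y s
            by (intro contour_integrable_continuous_circlepath continuous_intros
                continuous_on_compose2[OF holo_continuous_on[OF g(1)]] continuous_on_compose2[OF holo_continuous_on[OF hw]])
              (auto simp: Kmem)
          thus ?thesis unfolding T_def pt_nth by (rule contour_integral_lmul)
        qed
        ultimately show ?thesis using x by simp
      qed
      \<comment> \<open>The case \<open>x = 0\<close> is a limit, by continuity of
        \<open>T\<close>.\<close>
      have T00: "T (pt 0 y) = 0" if y: "norm y < s1" for y
      proof (rule tendsto_unique[of "at (0::complex)"])
        have "isCont T (pt 0 y)"
          using holo_continuous_on[OF hT] open_bidisc[of a s1] a(1) y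
          by (auto simp: continuous_on_eq_continuous_at)
        moreover have "isCont (\<lambda>x. pt x y) 0"
          using continuous_on_eq_continuous_at[OF open_UNIV, of "\<lambda>x. pt x y"]
          by (auto intro!: continuous_intros)
        ultimately have "isCont (\<lambda>x. T (pt x y)) 0" by (rule isCont_o2[rotated])
        thus "((\<lambda>x. T (pt x y)) \<longlongrightarrow> T (pt 0 y)) (at 0)" by (simp add: isCont_def)
        have "\<forall>\<^sub>F x in at 0. 0 = T (pt x y)"
          unfolding eventually_at using a(1) T0 y by (intro exI[of _ a]) auto
        thus "((\<lambda>x. T (pt x y)) \<longlongrightarrow> 0) (at 0)" by (rule Lim_transform_eventually[OF tendsto_const])
      qed simp
      define e where "e = min (min Rg Rh) s"
      \<comment> \<open>If \<open>d \<le> d'\<close>, the quotient \<open>g / w\<close> has no pole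
        at \<open>y = 0\<close> on the axis; the first branch is its holomorphic extension. By
        Cauchy's formula \<open>T\<close> on the axis is then \<open>2 * pi * i * F\<close>.\<close>
      define F where "F = (\<lambda>y. if y \<in> ball 0 e then y ^ (d' - d) * (G y / h y) else g (pt 0 y) / w (pt 0 y))"
      have e: "e > 0" "e \<le> s" using G(1) Rh(1) s by (auto simp: e_def)
      have Fh: "F holomorphic_on (ball 0 e \<union> (ball 0 s - {0}))"
        unfolding F_def
      proof (rule holomorphic_on_If_Un)
        show "(\<lambda>y. y ^ (d' - d) * (G y / h y)) holomorphic_on ball 0 e"
          using Rh(3) by (intro holomorphic_intros holomorphic_on_subset[OF G(2)] holomorphic_on_subset[OF Rh(2)])
            (auto simp: e_def)
        show "(\<lambda>y. g (pt 0 y) / w (pt 0 y)) holomorphic_on ball 0 s - {0}"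
          using w0 by (intro holomorphic_intros holomorphic_on_subset[OF hg0] holomorphic_on_pt_right[OF hw])
            (use a(1) in \<open>auto intro!: subsetD[OF BV]\<close>)
        show "y ^ (d' - d) * (G y / h y) = g (pt 0 y) / w (pt 0 y)" if "y \<in> ball 0 e" "y \<in> ball 0 s - {0}" for y
        proof -
          have "g (pt 0 y) = y ^ d' * G y" "w (pt 0 y) = y ^ d * h y" "h y \<noteq> 0"
            using G(3) Rh(3) that by (auto simp: e_def)
          moreover have "y ^ d' = y ^ (d' - d) * y ^ d"
            using \<open>\<not> d' < d\<close> by (simp flip: power_add)
          ultimately show ?thesis using that by simp
        qed
      qed auto
      have Un: "ball 0 e \<union> (ball 0 s - {0}) = ball (0::complex) s" using e by auto
      from Fh have Fh: "F holomorphic_on ball 0 s" unfolding Un .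
      have F0: "F y = 0" if y: "norm y < s1" for y
      proof -
        have "((\<lambda>\<zeta>. F \<zeta> / (\<zeta> - y)) has_contour_integral (2 * of_real pi * \<i> * F y)) (circlepath 0 s1)"
        proof (rule Cauchy_integral_circlepath)
          have "cball 0 s1 \<subseteq> ball (0::complex) s" using s by auto
          thus "continuous_on (cball 0 s1) F"
            by (rule continuous_on_subset[OF holomorphic_on_imp_continuous_on[OF Fh]])
          show "F holomorphic_on ball 0 s1"
            by (rule holomorphic_on_subset[OF Fh]) (use s in auto)
        qed (use y in simp)
        hence "2 * of_real pi * \<i> * F y = contour_integral (circlepath 0 s1) (\<lambda>\<zeta>. F \<zeta> / (\<zeta> - y))"
          by (simp add: contour_integral_unique)
        also have "\<dots> = contour_integral (circlepath 0 s1) (\<lambda>\<zeta>. g (pt 0 \<zeta>) / (w (pt 0 \<zeta>) * (\<zeta> - y)))"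
        proof (rule contour_integral_cong[OF refl])
          fix \<zeta> assume "\<zeta> \<in> path_image (circlepath 0 s1)"
          hence z: "norm \<zeta> = s1" using s by simp
          have "F \<zeta> = g (pt 0 \<zeta>) / w (pt 0 \<zeta>)"
          proof (cases "\<zeta> \<in> ball 0 e")
            case True
            hence "g (pt 0 \<zeta>) = \<zeta> ^ d' * G \<zeta>" "w (pt 0 \<zeta>) = \<zeta> ^ d * h \<zeta>" "h \<zeta> \<noteq> 0"
              using G(3) Rh(3) by (auto simp: e_def)
            moreover have "\<zeta> ^ d' = \<zeta> ^ (d' - d) * \<zeta> ^ d"
              using \<open>\<not> d' < d\<close> by (simp flip: power_add)
            moreover have "\<zeta> \<noteq> 0" using z s by auto
            ultimately show ?thesis using True by (simp add: F_def)
          qed (simp add: F_def)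
          thus "F \<zeta> / (\<zeta> - y) = g (pt 0 \<zeta>) / (w (pt 0 \<zeta>) * (\<zeta> - y))" by simp
        qed
        also have "\<dots> = 0" using T00[OF y] by (simp add: T_def)
        finally show ?thesis by simp
      qed
      \<comment> \<open>A point other than zero, because \<open>y ^ (d' - d)\<close> may vanish at
        zero.\<close>
      define y :: complex where "y = of_real (min e s1 / 2)"
      have ny: "norm y = min e s1 / 2" using e s by (simp add: y_def)
      hence y: "norm y < s1" "y \<in> ball 0 e" "y \<noteq> 0" using e(1) s(2) by auto
      hence "G y \<noteq> 0" "h y \<noteq> 0" using G(3) Rh(3) by (auto simp: e_def)
      with F0[OF y(1)] y show False by (simp add: F_def)
    qed
    with qat gat evr d' show ?thesis using that by blast
  qed
qed

section \<open>Ideals of germs containing a power of the maximal ideal\<close>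

lemma unit_germ_iff: "unit_germ u \<longleftrightarrow> holomorphic_at u 0 \<and> u 0 \<noteq> 0"
proof
  assume "unit_germ u"
  then obtain v where "holomorphic_at u 0" "\<forall>\<^sub>F z in nhds 0. u z * v z = 1"
    unfolding unit_germ_def by blast
  moreover from this(2) have "u 0 * v 0 = 1" by (rule eventually_nhds_x_imp_x)
  ultimately show "holomorphic_at u 0 \<and> u 0 \<noteq> 0" by auto
next
  assume u: "holomorphic_at u 0 \<and> u 0 \<noteq> 0"
  have "\<forall>\<^sub>F z in nhds 0. u z \<noteq> 0"
    using tendsto_imp_eventually_ne[of u "u 0" "nhds 0" 0] holomorphic_at_isCont[of u 0] u
    by (auto simp: isCont_def tendsto_at_iff_tendsto_nhds)
  hence "\<forall>\<^sub>F z in nhds 0. u z * inverse (u z) = 1" by eventually_elim simp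
  thus "unit_germ u" unfolding unit_germ_def using u holomorphic_at_inverse[of u 0] by blast
qed

definition in_ideal :: "(complex^2 \<Rightarrow> complex) \<Rightarrow> (complex^2 \<Rightarrow> complex) \<Rightarrow> (complex^2 \<Rightarrow> complex) \<Rightarrow> bool" where
  "in_ideal P g v \<longleftrightarrow> (\<exists>A B. holomorphic_at A 0 \<and> holomorphic_at B 0 \<and>
     (\<forall>\<^sub>F z in nhds 0. v z = A z * P z + B z * g z))"

lemma in_idealI:
  "holomorphic_at A 0 \<Longrightarrow> holomorphic_at B 0 \<Longrightarrow> \<forall>\<^sub>F z in nhds 0. v z = A z * P z + B z * g z \<Longrightarrow> in_ideal P g v"
  unfolding in_ideal_def by blast

lemma in_ideal_left: "in_ideal P g P"
  by (rule in_idealI[of "\<lambda>_. 1" "\<lambda>_. 0"]) auto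

lemma in_ideal_right: "in_ideal P g g"
  by (rule in_idealI[of "\<lambda>_. 0" "\<lambda>_. 1"]) auto

lemma in_ideal_cong:
  assumes "\<forall>\<^sub>F z in nhds 0. v z = u z" "in_ideal P g u" shows "in_ideal P g v"
proof -
  from assms(2) obtain A B where AB: "holomorphic_at A 0" "holomorphic_at B 0"
    "\<forall>\<^sub>F z in nhds 0. u z = A z * P z + B z * g z" unfolding in_ideal_def by blast
  from AB(3) assms(1) have "\<forall>\<^sub>F z in nhds 0. v z = A z * P z + B z * g z" by eventually_elim simp
  with AB(1,2) show ?thesis by (rule in_idealI)
qed

lemma in_ideal_add:
  assumes "in_ideal P g u" "in_ideal P g v" shows "in_ideal P g (\<lambda>z. u z + v z)"
proof -
  from assms(1) obtain A B where AB: "holomorphic_at A 0" "holomorphic_at B 0"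
    "\<forall>\<^sub>F z in nhds 0. u z = A z * P z + B z * g z" unfolding in_ideal_def by blast
  from assms(2) obtain A' B' where AB': "holomorphic_at A' 0" "holomorphic_at B' 0"
    "\<forall>\<^sub>F z in nhds 0. v z = A' z * P z + B' z * g z" unfolding in_ideal_def by blast
  from AB(3) AB'(3) have "\<forall>\<^sub>F z in nhds 0. u z + v z = (A z + A' z) * P z + (B z + B' z) * g z"
    by eventually_elim (simp add: algebra_simps)
  with AB AB' show ?thesis by (intro in_idealI) auto
qed

lemma in_ideal_mult:
  assumes "holomorphic_at c 0" "in_ideal P g v" shows "in_ideal P g (\<lambda>z. c z * v z)"
proof -
  from assms(2) obtain A B where AB: "holomorphic_at A 0" "holomorphic_at B 0"
    "\<forall>\<^sub>F z in nhds 0. v z = A z * P z + B z * g z" unfolding in_ideal_def by blast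
  from AB(3) have "\<forall>\<^sub>F z in nhds 0. c z * v z = (c z * A z) * P z + (c z * B z) * g z"
    by eventually_elim (simp add: algebra_simps)
  with AB assms(1) show ?thesis by (intro in_idealI) auto
qed

lemma in_ideal_product:
  assumes "in_ideal P f u" "in_ideal P g v" "holomorphic_at P 0" "holomorphic_at f 0" "holomorphic_at g 0"
  shows "in_ideal P (\<lambda>z. f z * g z) (\<lambda>z. u z * v z)"
proof -
  from assms(1) obtain A B where AB: "holomorphic_at A 0" "holomorphic_at B 0"
    "\<forall>\<^sub>F z in nhds 0. u z = A z * P z + B z * f z" unfolding in_ideal_def by blast
  from assms(2) obtain A' B' where AB': "holomorphic_at A' 0" "holomorphic_at B' 0"
    "\<forall>\<^sub>F z in nhds 0. v z = A' z * P z + B' z * g z" unfolding in_ideal_def by blast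
  from AB(3) AB'(3) have "\<forall>\<^sub>F z in nhds 0. u z * v z =
      (A z * (A' z * P z + B' z * g z) + B z * f z * A' z) * P z + (B z * B' z) * (f z * g z)"
    by eventually_elim (simp add: algebra_simps)
  moreover have "holomorphic_at (\<lambda>z. A z * (A' z * P z + B' z * g z) + B z * f z * A' z) 0"
    using AB AB' assms by (intro holomorphic_at_add holomorphic_at_mult)
  moreover have "holomorphic_at (\<lambda>z. B z * B' z) 0" using AB AB' by (intro holomorphic_at_mult)
  ultimately show ?thesis by (intro in_idealI)
qed

text \<open>The saturation \<open>J\<close> of the ideal \<open>(P, g)\<close> by the powers of \<open>x\<close> is principal: it is generated by an
  element of least order on the axis \<open>x = 0\<close>. Irreducibility of \<open>P\<close> leaves only \<open>J = (1)\<close>.\<close>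

lemma irreducible_x_power:
  assumes irr: "irreducible_germ P" and reg: "ord0 n (\<lambda>y. P (pt 0 y))"
    and g: "holomorphic_at g 0"
    and ndiv: "\<And>a. holomorphic_at a 0 \<Longrightarrow> \<not> (\<forall>\<^sub>F z in nhds 0. g z = a z * P z)"
  obtains k where "in_ideal P g (\<lambda>z. z $ 1 ^ k)"
proof -
  have P: "holomorphic_at P 0" using irr by (simp add: irreducible_germ_def)
  define J where "J = {v. holomorphic_at v 0 \<and> (\<exists>k. in_ideal P g (\<lambda>z. z $ 1 ^ k * v z))}"
  have PJ: "P \<in> J" and gJ: "g \<in> J"
    using P g in_ideal_left[of P g] in_ideal_right[of P g] by (auto simp: J_def intro!: exI[of _ 0])
  define d where "d = (LEAST d. \<exists>v\<in>J. ord0 d (\<lambda>y. v (pt 0 y)))"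
  have "\<exists>v\<in>J. ord0 d (\<lambda>y. v (pt 0 y))"
    unfolding d_def by (rule LeastI_ex) (use PJ reg in blast)
  then obtain w where w: "w \<in> J" "ord0 d (\<lambda>y. w (pt 0 y))" by blast
  then obtain kw where kw: "holomorphic_at w 0" "in_ideal P g (\<lambda>z. z $ 1 ^ kw * w z)"
    by (auto simp: J_def)
  have mult: "\<exists>q. holomorphic_at q 0 \<and> (\<forall>\<^sub>F z in nhds 0. u z = q z * w z)" if u: "u \<in> J" for u
  proof -
    from u obtain ku where ku: "holomorphic_at u 0" "in_ideal P g (\<lambda>z. z $ 1 ^ ku * u z)"
      by (auto simp: J_def)
    obtain q where q: "holomorphic_at q 0" "(\<forall>\<^sub>F z in nhds 0. u z = q z * w z) \<or>
      (\<exists>m g' d'. holomorphic_at g' 0 \<and> (\<forall>\<^sub>F z in nhds 0. u z - q z * w z = z $ 1 ^ m * g' z) \<and>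
        ord0 d' (\<lambda>y. g' (pt 0 y)) \<and> d' < d)"
      by (rule weierstrass_reduce[OF kw(1) w(2) ku(1)]) blast
    \<comment> \<open>A nonzero remainder, freed from its power of \<open>x\<close>, would again lie
      in \<open>J\<close> and have an order on the axis below the least one.\<close>
    have False if "holomorphic_at g' 0" "\<forall>\<^sub>F z in nhds 0. u z - q z * w z = z $ 1 ^ m * g' z"
      "ord0 d' (\<lambda>y. g' (pt 0 y))" "d' < d" for m g' d'
    proof -
      have "in_ideal P g (\<lambda>z. z $ 1 ^ kw * (z $ 1 ^ ku * u z) + (- (z $ 1 ^ ku * q z)) * (z $ 1 ^ kw * w z))"
        by (intro in_ideal_add in_ideal_mult[of _ P g "\<lambda>z. z $ 1 ^ ku * u z"]
            in_ideal_mult[of _ P g "\<lambda>z. z $ 1 ^ kw * w z"] ku(2) kw(2) holomorphic_at_minus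
            holomorphic_at_mult holomorphic_at_power holomorphic_at_nth q(1))
      moreover from that(2) have "\<forall>\<^sub>F z in nhds 0. z $ 1 ^ (kw + ku + m) * g' z =
          z $ 1 ^ kw * (z $ 1 ^ ku * u z) + (- (z $ 1 ^ ku * q z)) * (z $ 1 ^ kw * w z)"
      proof eventually_elim
        case (elim z)
        have "z $ 1 ^ (kw + ku + m) * g' z = z $ 1 ^ (kw + ku) * (z $ 1 ^ m * g' z)"
          by (simp add: power_add)
        also have "\<dots> = z $ 1 ^ (kw + ku) * (u z - q z * w z)" using elim by simp
        finally show ?case by (simp add: power_add algebra_simps)
      qed
      ultimately have "in_ideal P g (\<lambda>z. z $ 1 ^ (kw + ku + m) * g' z)" by (rule in_ideal_cong[rotated])
      hence "g' \<in> J" using that(1) by (auto simp: J_def)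
      hence "d \<le> d'" unfolding d_def using that(3) by (intro Least_le) blast
      thus False using that(4) by simp
    qed
    with q show ?thesis by blast
  qed
  from mult[OF PJ] obtain s where s: "holomorphic_at s 0" "\<forall>\<^sub>F z in nhds 0. P z = s z * w z" by blast
  from mult[OF gJ] obtain t where t: "holomorphic_at t 0" "\<forall>\<^sub>F z in nhds 0. g z = t z * w z" by blast
  \<comment> \<open>Now \<open>w\<close> divides both \<open>P\<close> and \<open>g\<close>. If the
    cofactor \<open>s\<close> of \<open>P\<close> is a unit, then \<open>P\<close> divides
    \<open>g\<close>, which is excluded; so \<open>w\<close> is the unit, and the power of
    \<open>x\<close> that multiplies \<open>w\<close> into the ideal lies in the ideal
    itself.\<close>
  from irr s kw(1) have "unit_germ s \<or> unit_germ w" unfolding irreducible_germ_def by blast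
  thus ?thesis
  proof
    assume "unit_germ s"
    then obtain s' where s': "holomorphic_at s' 0" "\<forall>\<^sub>F z in nhds 0. s z * s' z = 1"
      unfolding unit_germ_def by blast
    from s(2) t(2) s'(2) have "\<forall>\<^sub>F z in nhds 0. g z = (t z * s' z) * P z"
      by eventually_elim (metis mult.assoc mult.commute mult.right_neutral)
    with ndiv[of "\<lambda>z. t z * s' z"] t(1) s'(1) show ?thesis by blast
  next
    assume "unit_germ w"
    then obtain w' where w': "holomorphic_at w' 0" "\<forall>\<^sub>F z in nhds 0. w z * w' z = 1"
      unfolding unit_germ_def by blast
    have "in_ideal P g (\<lambda>z. w' z * (z $ 1 ^ kw * w z))" by (rule in_ideal_mult[OF w'(1) kw(2)])
    moreover from w'(2) have "\<forall>\<^sub>F z in nhds 0. z $ 1 ^ kw = w' z * (z $ 1 ^ kw * w z)"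
      by eventually_elim (metis mult.assoc mult.commute mult.right_neutral)
    ultimately have "in_ideal P g (\<lambda>z. z $ 1 ^ kw)" by (rule in_ideal_cong[rotated])
    thus ?thesis by (rule that)
  qed
qed

text \<open>On the axis, \<open>P\<close> is a unit times \<open>y ^ n\<close>, so
  \<open>y ^ n\<close> lies in the ideal \<open>(P, x)\<close>. Its \<open>k\<close>-th power then
  lies in \<open>(P, x ^ k)\<close>, which is contained in \<open>(P, g)\<close>.\<close>

lemma in_ideal_y_power:
  assumes P: "holomorphic_at P 0" and reg: "ord0 n (\<lambda>y. P (pt 0 y))"
    and x: "in_ideal P g (\<lambda>z. z $ 1 ^ k)"
  shows "in_ideal P g (\<lambda>z. z $ 2 ^ (n * k))"
proof -
  obtain R where R: "R > 0" "holo P (ball 0 R)" using holomorphic_atE[OF P] by blast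
  obtain Rh h where Rh: "Rh > 0" "h holomorphic_on ball 0 Rh"
    "\<forall>y\<in>ball 0 Rh. P (pt 0 y) = y ^ n * h y \<and> h y \<noteq> 0" using reg unfolding ord0_def by blast
  define a where "a = min R Rh / 2"
  have a: "a > 0" "a < Rh" using R Rh by (auto simp: a_def)
  have B: "bidisc a a \<subseteq> ball 0 R" by (rule bidisc_subset_ball) (simp add: a_def)
  note hP = holo_subset[OF R(2) B]
  have hP0: "holo (\<lambda>z. P (pt 0 (z $ 2))) (bidisc a a)"
    by (rule holo_pt[OF hP]) (use a in \<open>auto simp: bidisc_def\<close>)
  obtain P1 where P1: "holo P1 (bidisc a a)"
    "\<And>z. z \<in> bidisc a a \<Longrightarrow> P z - P (pt 0 (z $ 2)) = z $ 1 * P1 z"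
    by (rule divide_by_x[OF holo_diff[OF hP hP0]]) (simp, blast)
  \<comment> \<open>\<open>i\<close> inverts the unit factor of \<open>P\<close> on the axis and
    \<open>P1\<close> is the quotient of \<open>P z - P (pt 0 (z $ 2))\<close> by \<open>x\<close>;
    solving for \<open>y ^ n\<close> gives the coefficient \<open>b\<close> of
    \<open>x\<close>.\<close>
  define i where "i = (\<lambda>z::complex^2. inverse (h (z $ 2)))"
  have hi: "holo i (bidisc a a)"
    unfolding i_def using Rh(3) a
    by (intro holo_inverse holo_compose_fun[OF Rh(2) open_ball]) (auto simp: bidisc_def)
  define b where "b = (\<lambda>z. - (i z * P1 z))"
  have at: "holomorphic_at i 0" "holomorphic_at b 0"
    using hi P1(1) a unfolding b_def
    by (auto intro!: holomorphic_atI[OF _ open_bidisc bidisc_0] holo_minus holo_mult)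
  have ev: "\<forall>\<^sub>F z in nhds 0. z \<in> bidisc a a"
    by (rule eventually_nhds_in_open[OF open_bidisc bidisc_0[OF a(1) a(1)]])
  hence e1: "\<forall>\<^sub>F z in nhds 0. z $ 2 ^ n = i z * P z + b z * z $ 1"
  proof eventually_elim
    case (elim z)
    have "norm (z $ 2) < Rh" using elim a by (auto simp: bidisc_def)
    hence "P (pt 0 (z $ 2)) = z $ 2 ^ n * h (z $ 2)" "h (z $ 2) \<noteq> 0" using Rh(3) by auto
    with P1(2)[OF elim] have "z $ 2 ^ n * h (z $ 2) = P z - z $ 1 * P1 z" by (simp add: algebra_simps)
    hence "z $ 2 ^ n = (P z - z $ 1 * P1 z) / h (z $ 2)"
      using \<open>h (z $ 2) \<noteq> 0\<close> by (simp add: field_simps)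
    thus ?case by (simp add: i_def b_def divide_inverse algebra_simps)
  qed
  have "\<exists>A B. holomorphic_at A 0 \<and> holomorphic_at B 0 \<and>
      (\<forall>\<^sub>F z in nhds 0. z $ 2 ^ (n * j) = A z * P z + B z * z $ 1 ^ j)" for j
  proof (induction j)
    case 0 show ?case by (intro exI[of _ "\<lambda>_. 0"] exI[of _ "\<lambda>_. 1"]) auto
  next
    case (Suc j)
    then obtain A B where AB: "holomorphic_at A 0" "holomorphic_at B 0"
      "\<forall>\<^sub>F z in nhds 0. z $ 2 ^ (n * j) = A z * P z + B z * z $ 1 ^ j" by blast
    from AB(3) e1 have "\<forall>\<^sub>F z in nhds 0. z $ 2 ^ (n * Suc j) =
      (A z * (i z * P z + b z * z $ 1) + B z * z $ 1 ^ j * i z) * P z + (B z * b z) * z $ 1 ^ Suc j"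
    proof eventually_elim
      case (elim z)
      have "z $ 2 ^ (n * Suc j) = z $ 2 ^ (n * j) * z $ 2 ^ n" by (simp add: power_add)
      also have "\<dots> = (A z * P z + B z * z $ 1 ^ j) * (i z * P z + b z * z $ 1)" using elim by simp
      finally show ?case by (simp add: algebra_simps)
    qed
    moreover have "holomorphic_at (\<lambda>z. A z * (i z * P z + b z * z $ 1) + B z * z $ 1 ^ j * i z) 0"
      using AB at P by (intro holomorphic_at_add holomorphic_at_mult holomorphic_at_power holomorphic_at_nth)
    moreover have "holomorphic_at (\<lambda>z. B z * b z) 0" using AB at by blast
    ultimately show ?case by blast
  qed
  then obtain A B where AB: "holomorphic_at A 0" "holomorphic_at B 0"
    "\<forall>\<^sub>F z in nhds 0. z $ 2 ^ (n * k) = A z * P z + B z * z $ 1 ^ k" by blast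
  have "in_ideal P g (\<lambda>z. A z * P z + B z * z $ 1 ^ k)"
    by (intro in_ideal_add in_ideal_mult AB in_ideal_left x)
  with AB(3) show ?thesis by (rule in_ideal_cong)
qed

text \<open>Every monomial of degree \<open>a + b\<close> is divisible by \<open>x ^ a\<close> or by
  \<open>y ^ b\<close>. Without power series: \<open>vanish_split\<close> peels off one coordinate
  at a time, and its two coefficients fall under the induction hypothesis for
  \<open>(a - 1, b)\<close> and \<open>(a, b - 1)\<close>.\<close>

lemma vanish_monomials:
  assumes "holomorphic_at r 0" "vanish (a + b) r"
  shows "\<exists>A B. holomorphic_at A 0 \<and> holomorphic_at B 0 \<and> (\<forall>\<^sub>F z in nhds 0. r z = A z * z $ 1 ^ a + B z * z $ 2 ^ b)"
  using assms
proof (induction "a + b" arbitrary: a b r)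
  case 0
  thus ?case by (intro exI[of _ r] exI[of _ "\<lambda>_. 0"]) auto
next
  case (Suc m)
  show ?case
  proof (cases "a = 0 \<or> b = 0")
    case True
    thus ?thesis
    proof
      assume "a = 0" thus ?thesis using Suc.prems by (intro exI[of _ r] exI[of _ "\<lambda>_. 0"]) auto
    next
      assume "b = 0" thus ?thesis using Suc.prems by (intro exI[of _ "\<lambda>_. 0"] exI[of _ r]) auto
    qed
  next
    case False
    then obtain a' b' where ab: "a = Suc a'" "b = Suc b'" using not0_implies_Suc by blast
    from Suc.hyps(2) Suc.prems(2) have v: "vanish (Suc m) r" by simp
    obtain r1 r2 where r: "holomorphic_at r1 0" "holomorphic_at r2 0" "vanish m r1" "vanish m r2"
      "\<forall>\<^sub>F z in nhds 0. r z = z $ 1 * r1 z + z $ 2 * r2 z"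
      by (rule vanish_split[OF Suc.prems(1) v]) blast
    have m: "m = a' + b" "m = a + b'" using Suc.hyps(2) ab by auto
    obtain A1 B1 where 1: "holomorphic_at A1 0" "holomorphic_at B1 0"
      "\<forall>\<^sub>F z in nhds 0. r1 z = A1 z * z $ 1 ^ a' + B1 z * z $ 2 ^ b"
      using Suc.hyps(1)[OF m(1) r(1)] r(3) m(1) by blast
    obtain A2 B2 where 2: "holomorphic_at A2 0" "holomorphic_at B2 0"
      "\<forall>\<^sub>F z in nhds 0. r2 z = A2 z * z $ 1 ^ a + B2 z * z $ 2 ^ b'"
      using Suc.hyps(1)[OF m(2) r(2)] r(4) m(2) by blast
    from r(5) 1(3) 2(3) have "\<forall>\<^sub>F z in nhds 0. r z =
      (A1 z + z $ 2 * A2 z) * z $ 1 ^ a + (z $ 1 * B1 z + B2 z) * z $ 2 ^ b"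
      by eventually_elim (simp add: ab algebra_simps)
    moreover have "holomorphic_at (\<lambda>z. A1 z + z $ 2 * A2 z) 0"
      by (intro holomorphic_at_add holomorphic_at_mult holomorphic_at_nth 1 2)
    moreover have "holomorphic_at (\<lambda>z. z $ 1 * B1 z + B2 z) 0"
      by (intro holomorphic_at_add holomorphic_at_mult holomorphic_at_nth 1 2)
    ultimately show ?thesis by blast
  qed
qed

lemma in_ideal_of_vanish:
  assumes "holomorphic_at P 0" "in_ideal P g (\<lambda>z. z $ 1 ^ a)" "in_ideal P g (\<lambda>z. z $ 2 ^ b)"
    and "holomorphic_at r 0" "vanish (a + b) r"
  shows "in_ideal P g r"
proof -
  from vanish_monomials[OF assms(4,5)] obtain A B where AB: "holomorphic_at A 0" "holomorphic_at B 0"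
    "\<forall>\<^sub>F z in nhds 0. r z = A z * z $ 1 ^ a + B z * z $ 2 ^ b" by blast
  have "in_ideal P g (\<lambda>z. A z * z $ 1 ^ a + B z * z $ 2 ^ b)"
    by (intro in_ideal_add in_ideal_mult AB assms)
  with AB(3) show ?thesis by (rule in_ideal_cong)
qed

text \<open>The inverse germ turns a factorization of the pullback into one of \<open>P\<close>, and
  units are recognised by their value at the origin, which both maps fix.\<close>

lemma irreducible_compose:
  assumes "biholomorphism_germ \<phi>" "irreducible_germ P"
  shows "irreducible_germ (\<lambda>z. P (\<phi> z))"
proof -
  from assms(1) obtain \<psi> where \<phi>: "holomorphic_map_at \<phi> 0" "\<phi> 0 = 0"
    and \<psi>: "holomorphic_map_at \<psi> 0" "\<psi> 0 = 0"
    and inv: "\<forall>\<^sub>F z in nhds 0. \<psi> (\<phi> z) = z" "\<forall>\<^sub>F z in nhds 0. \<phi> (\<psi> z) = z"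
    unfolding biholomorphism_germ_def by blast
  from assms(2) have P: "holomorphic_at P 0" "\<not> (\<forall>\<^sub>F z in nhds 0. P z = 0)" "\<not> unit_germ P"
    and irr: "\<And>g h. holomorphic_at g 0 \<Longrightarrow> holomorphic_at h 0 \<Longrightarrow> (\<forall>\<^sub>F z in nhds 0. P z = g z * h z) \<Longrightarrow> unit_germ g \<or> unit_germ h"
    unfolding irreducible_germ_def by blast+
  have comp: "holomorphic_at (\<lambda>z. g (\<phi> z)) 0" "holomorphic_at (\<lambda>z. g (\<psi> z)) 0" if "holomorphic_at g 0" for g
    using holomorphic_at_compose[of g \<phi> 0] holomorphic_at_compose[of g \<psi> 0] that \<phi> \<psi> by simp_all
  have ev\<psi>: "\<forall>\<^sub>F z in nhds 0. Q (\<psi> z)" if "\<forall>\<^sub>F z in nhds 0. Q z" for Q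
    using eventually_nhds_compose[OF holomorphic_map_at_isCont[OF \<psi>(1)]] \<psi>(2) that by simp
  show ?thesis
    unfolding irreducible_germ_def
  proof (intro conjI allI impI)
    show "holomorphic_at (\<lambda>z. P (\<phi> z)) 0" by (rule comp(1)[OF P(1)])
    show "\<not> (\<forall>\<^sub>F z in nhds 0. P (\<phi> z) = 0)"
    proof
      assume "\<forall>\<^sub>F z in nhds 0. P (\<phi> z) = 0"
      from ev\<psi>[OF this] inv(2) have "\<forall>\<^sub>F z in nhds 0. P z = 0" by eventually_elim simp
      with P(2) show False by blast
    qed
    show "\<not> unit_germ (\<lambda>z. P (\<phi> z))" using P(1,3) \<phi>(2) by (auto simp: unit_germ_iff)
    fix g h assume gh: "holomorphic_at g 0 \<and> holomorphic_at h 0 \<and> (\<forall>\<^sub>F z in nhds 0. P (\<phi> z) = g z * h z)"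
    hence "\<forall>\<^sub>F z in nhds 0. P (\<phi> (\<psi> z)) = g (\<psi> z) * h (\<psi> z)" by (intro ev\<psi>) blast
    with inv(2) have "\<forall>\<^sub>F z in nhds 0. P z = g (\<psi> z) * h (\<psi> z)" by eventually_elim simp
    with irr[of "\<lambda>z. g (\<psi> z)" "\<lambda>z. h (\<psi> z)"] gh comp(2)
    have "unit_germ (\<lambda>z. g (\<psi> z)) \<or> unit_germ (\<lambda>z. h (\<psi> z))" by blast
    thus "unit_germ g \<or> unit_germ h" using gh \<psi>(2) by (auto simp: unit_germ_iff)
  qed
qed

section \<open>Finite order along a line and the ideal \<open>(P, f * D_e P)\<close>\<close>

lemma holomorphic_map_at_pt:
  assumes "holomorphic_at f p" "holomorphic_at g p"
  shows "holomorphic_map_at (\<lambda>z. pt (f z) (g z)) p"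
  unfolding holomorphic_map_at_def
proof
  fix i :: 2
  show "holomorphic_at (\<lambda>z. pt (f z) (g z) $ i) p" using exhaust_2[of i] assms by auto
qed

text \<open>A linear change of coordinates \<open>A\<close> takes the axis \<open>x = 0\<close> to
  the line spanned by \<open>e\<close>, on which \<open>P\<close> has finite order. In these
  coordinates the ideal contains powers of \<open>x\<close> and of \<open>y\<close>, hence a power
  of the maximal ideal.\<close>

lemma irreducible_vanish_in_ideal:
  assumes irr: "irreducible_germ P" and reg: "ord0 n (\<lambda>\<tau>. P (\<tau> *s e))"
    and g: "holomorphic_at g 0"
    and ndiv: "\<And>a. holomorphic_at a 0 \<Longrightarrow> \<not> (\<forall>\<^sub>F z in nhds 0. g z = a z * P z)"
  obtains K where "\<And>r. holomorphic_at r 0 \<Longrightarrow> vanish K r \<Longrightarrow> in_ideal P g r"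
proof -
  have P: "holomorphic_at P 0" "P 0 = 0" using irr by (auto simp: irreducible_germ_def unit_germ_iff)
  have "e \<noteq> 0" using ord0_nonzero[OF reg] P(2) by (auto simp: smult_eq zero_vec_def[symmetric])
  have "\<exists>A A'. holomorphic_map_at A 0 \<and> A 0 = 0 \<and> holomorphic_map_at A' 0 \<and> A' 0 = 0
    \<and> (\<forall>z. A' (A z) = z) \<and> (\<forall>z. A (A' z) = z) \<and> (\<forall>y. A (pt 0 y) = y *s e)"
  \<comment> \<open>The map that fixes the first basis vector and sends the second to
    \<open>e\<close> is invertible only if \<open>e $ 2 \<noteq> 0\<close>; otherwise the two
    coordinates are exchanged.\<close>
  proof (cases "e $ 2 = 0")
    case True
    with \<open>e \<noteq> 0\<close> have "e $ 1 \<noteq> 0" by (auto simp: vec_eq_iff forall_2)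
    with True show ?thesis
      by (intro exI[of _ "\<lambda>z. pt (z $ 2 * e $ 1) (z $ 1)"] exI[of _ "\<lambda>z. pt (z $ 2) (z $ 1 * inverse (e $ 1))"]
          conjI allI holomorphic_map_at_pt holomorphic_at_mult holomorphic_at_nth holomorphic_at_const)
        (auto simp: vec_eq_iff forall_2)
  next
    case False
    thus ?thesis
      by (intro exI[of _ "\<lambda>z. pt (z $ 1 + z $ 2 * e $ 1) (z $ 2 * e $ 2)"]
          exI[of _ "\<lambda>z. pt (z $ 1 - z $ 2 * (e $ 1 / e $ 2)) (z $ 2 * inverse (e $ 2))"]
          conjI allI holomorphic_map_at_pt holomorphic_at_add holomorphic_at_diff
          holomorphic_at_mult holomorphic_at_nth holomorphic_at_const)
        (auto simp: vec_eq_iff forall_2 field_simps)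
  qed
  then obtain A A' where A: "holomorphic_map_at A 0" "A 0 = 0" "holomorphic_map_at A' 0" "A' 0 = 0"
    "\<And>z. A' (A z) = z" "\<And>z. A (A' z) = z" "\<And>y. A (pt 0 y) = y *s e" by blast
  have bi: "biholomorphism_germ A"
    unfolding biholomorphism_germ_def using A by (auto intro!: exI[of _ A'])
  have evA': "\<forall>\<^sub>F z in nhds 0. Q (A' z)" if "\<forall>\<^sub>F z in nhds 0. Q z" for Q
    using eventually_nhds_compose[OF holomorphic_map_at_isCont[OF A(3)]] A(4) that by simp
  have compA: "holomorphic_at (\<lambda>z. f (A z)) 0" "holomorphic_at (\<lambda>z. f (A' z)) 0" if "holomorphic_at f 0" for f
    using holomorphic_at_compose[of f A 0] holomorphic_at_compose[of f A' 0] that A(1-4) by simp_all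
  have reg': "ord0 n (\<lambda>y. P (A (pt 0 y)))" using reg by (simp add: A(7))
  have irr': "irreducible_germ (\<lambda>z. P (A z))" by (rule irreducible_compose[OF bi irr])
  have ndiv': "\<not> (\<forall>\<^sub>F z in nhds 0. g (A z) = a z * P (A z))" if "holomorphic_at a 0" for a
  proof
    assume "\<forall>\<^sub>F z in nhds 0. g (A z) = a z * P (A z)"
    from evA'[OF this] have "\<forall>\<^sub>F z in nhds 0. g z = a (A' z) * P z" by (simp add: A(6))
    with ndiv[OF compA(2)[OF that]] show False by blast
  qed
  obtain k where k: "in_ideal (\<lambda>z. P (A z)) (\<lambda>z. g (A z)) (\<lambda>z. z $ 1 ^ k)"
    by (rule irreducible_x_power[OF irr' reg' compA(1)[OF g] ndiv']) blast+
  note ky = in_ideal_y_power[OF compA(1)[OF P(1)] reg' k]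
  have v1: "vanish 1 A"
    by (rule vanish_vecI, rule vanish_1I) (use A(1,2) in \<open>simp_all add: holomorphic_map_at_def\<close>)
  have "in_ideal P g r" if r: "holomorphic_at r 0" "vanish (k + n * k) r" for r
  proof -
    have "vanish (k + n * k) (\<lambda>z. r (A z))"
      by (rule vanish_compose[OF r(2) v1 holomorphic_map_at_isCont[OF A(1)]])
    from in_ideal_of_vanish[OF compA(1)[OF P(1)] k ky compA(1)[OF r(1)] this]
    obtain a b where ab: "holomorphic_at a 0" "holomorphic_at b 0"
      "\<forall>\<^sub>F z in nhds 0. r (A z) = a z * P (A z) + b z * g (A z)" unfolding in_ideal_def by blast
    from evA'[OF ab(3)] have "\<forall>\<^sub>F z in nhds 0. r z = a (A' z) * P z + b (A' z) * g z" by (simp add: A(6))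
    thus ?thesis by (rule in_idealI[OF compA(2)[OF ab(1)] compA(2)[OF ab(2)]])
  qed
  thus ?thesis using that by blast
qed

lemma germ_direction:
  assumes "holomorphic_at P 0" "\<not> (\<forall>\<^sub>F z in nhds 0. P z = 0)"
  obtains e n where "ord0 n (\<lambda>\<tau>. P (\<tau> *s e))"
proof -
  obtain R where R: "R > 0" "holo P (ball 0 R)" using holomorphic_atE[OF assms(1)] by blast
  have "\<not> (\<forall>z\<in>ball 0 R. P z = 0)"
    using assms(2) eventually_nhds_ballI[OF R(1), of 0 "\<lambda>z. P z = 0"] by blast
  then obtain e where e: "e \<in> ball 0 R" "P e \<noteq> 0" by blast
  \<comment> \<open>The midpoint between \<open>norm e\<close> and \<open>R\<close>. The disc of
    radius \<open>S = R / D > 1\<close> contains both 0, where the order is taken, and 1, where the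
    slice is nonzero. Dividing by \<open>D\<close> instead of \<open>norm e\<close> covers
    \<open>e = 0\<close>.\<close>
  define D where "D = norm e + (R - norm e) / 2"
  define S where "S = R / D"
  have "norm e < R" using e(1) by simp
  hence D: "norm e \<le> D" "D < R" unfolding D_def by (simp_all add: field_simps)
  have "0 < (R - norm e) / 2" using \<open>norm e < R\<close> by simp
  hence "D > 0" unfolding D_def by (intro add_nonneg_pos) auto
  have S: "S > 1" "S * norm e \<le> R"
  proof -
    show "S > 1" using \<open>D > 0\<close> D(2) by (simp add: S_def)
    hence "S * norm e \<le> S * D" using D(1) by (intro mult_left_mono) auto
    thus "S * norm e \<le> R" using \<open>D > 0\<close> by (simp add: S_def)
  qed
  have "(\<lambda>\<tau>. P (0 + \<tau> *s e)) holomorphic_on ball 0 S"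
  proof (rule holo_slice_holomorphic[OF R(2)])
    fix \<tau> :: complex assume t: "\<tau> \<in> ball 0 S"
    have "norm \<tau> * norm e < R"
    proof (cases "e = 0")
      case False
      hence "norm \<tau> * norm e < S * norm e" using t by (intro mult_strict_right_mono) auto
      thus ?thesis using S(2) by linarith
    qed (use R in simp)
    thus "0 + \<tau> *s e \<in> ball 0 R" by (simp add: norm_smult)
  qed
  hence hol: "(\<lambda>\<tau>. P (\<tau> *s e)) holomorphic_on ball 0 S" by simp
  have "1 *s e = e" by (simp add: vec_eq_iff)
  with e(2) have "P (1 *s e) \<noteq> 0" by simp
  obtain n where "ord0 n (\<lambda>\<tau>. P (\<tau> *s e))"
    by (rule ord0_exists[OF hol _ \<open>P (1 *s e) \<noteq> 0\<close>]) (use S(1) in auto)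
  thus ?thesis by (rule that)
qed

text \<open>The integrating factor \<open>exp (- I t)\<close> turns \<open>f\<close> into a
  constant. Later use: since the exponential never vanishes, \<open>f\<close> is zero at time one
  exactly if it is zero at time zero.\<close>

lemma scalar_ode:
  fixes f k :: "real \<Rightarrow> complex"
  assumes d: "\<And>t. t \<in> {0..1} \<Longrightarrow> (f has_vector_derivative k t * f t) (at t within {0..1})"
    and k: "continuous_on {0..1} k"
  shows "f 1 = f 0 * exp (integral {0..1} k)"
proof -
  define I where "I = (\<lambda>t. integral {0..t} k)"
  define g where "g = (\<lambda>t. f t * exp (- I t))"
  have "(g has_vector_derivative 0) (at t within {0..1})" if t: "t \<in> {0..1}" for t
  proof -
    have "((\<lambda>t. - I t) has_vector_derivative - k t) (at t within {0..1})"
      unfolding I_def by (intro has_vector_derivative_minus integral_has_vector_derivative[OF k t])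
    from field_vector_diff_chain_within[OF this, of exp "exp (- I t)"]
    have "((\<lambda>t. exp (- I t)) has_vector_derivative - k t * exp (- I t)) (at t within {0..1})"
      by (simp add: o_def has_field_derivative_at_within)
    from has_vector_derivative_mult[OF d[OF t] this] show ?thesis
      by (simp add: g_def algebra_simps)
  qed
  hence "norm (g 1 - g 0) \<le> 0 * \<bar>1 - 0\<bar>" by (rule vector_derivative_bound) auto
  hence "g 1 = g 0" by simp
  hence "f 1 * exp (- I 1) = f 0" by (simp add: g_def I_def)
  thus ?thesis by (simp add: I_def exp_minus field_simps)
qed

text \<open>Along the line spanned by \<open>e\<close> the relation \<open>ddir e P = a * P\<close>
  is a linear differential equation with initial value \<open>P 0 = 0\<close>, so \<open>P\<close>
  would vanish on that line near the origin, where it has finite order.\<close>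

lemma ddir_not_divisible:
  assumes P: "holomorphic_at P 0" "P 0 = 0" and reg: "ord0 n (\<lambda>\<tau>. P (\<tau> *s e))" and a: "holomorphic_at a 0"
  shows "\<not> (\<forall>\<^sub>F z in nhds 0. ddir e P z = a z * P z)"
proof
  assume ev: "\<forall>\<^sub>F z in nhds 0. ddir e P z = a z * P z"
  obtain R1 where R1: "R1 > 0" "holo P (ball 0 R1)" using holomorphic_atE[OF P(1)] by blast
  obtain R2 where R2: "R2 > 0" "holo a (ball 0 R2)" using holomorphic_atE[OF a] by blast
  obtain R3 where R3: "R3 > 0" "\<And>z. z \<in> ball 0 R3 \<Longrightarrow> ddir e P z = a z * P z"
    using eventually_nhds_ballE[OF ev] by blast
  define R where "R = min R1 (min R2 R3)"
  define r where "r = R / (norm e + 1)"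
  have "R > 0" using R1(1) R2(1) R3(1) by (simp add: R_def)
  have ne: "norm e + 1 > 0" by (intro add_nonneg_pos) auto
  have r: "r > 0" "r * norm e < R"
  proof -
    show "r > 0" using \<open>R > 0\<close> ne by (simp add: r_def)
    hence "r * norm e < r * (norm e + 1)" by simp
    thus "r * norm e < R" using ne by (simp add: r_def)
  qed
  have "P (\<tau> *s e) = 0" if t: "\<tau> \<in> ball 0 r" for \<tau>
  proof -
    have inR: "of_real s *s (\<tau> *s e) \<in> ball 0 R" if "s \<in> {0..1}" for s
    proof -
      have "\<bar>s\<bar> * (norm \<tau> * norm e) \<le> 1 * (r * norm e)"
        using that t by (intro mult_mono mult_right_mono) auto
      hence "norm (of_real s *s (\<tau> *s e)) < R" unfolding norm_smult norm_of_real using r(2) by linarith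
      thus ?thesis by (simp only: mem_ball_0)
    qed
    define p where "p = (\<lambda>s::real. P (of_real s *s (\<tau> *s e)))"
    have "p 1 = p 0 * exp (integral {0..1} (\<lambda>s. \<tau> * a (of_real s *s (\<tau> *s e))))"
    proof (rule scalar_ode)
      fix s :: real assume s: "s \<in> {0..1}"
      have i: "0 + of_real s *s (\<tau> *s e) \<in> ball 0 R1" using inR[OF s] by (simp add: R_def)
      have "((\<lambda>\<sigma>. P (0 + \<sigma> *s (\<tau> *s e))) has_field_derivative ddir (\<tau> *s e) P (0 + of_real s *s (\<tau> *s e))) (at (of_real s))"
        by (rule holo_slice[OF R1(2) i])
      hence "((\<lambda>s. P (0 + of_real s *s (\<tau> *s e))) has_vector_derivative ddir (\<tau> *s e) P (0 + of_real s *s (\<tau> *s e))) (at s within {0..1})"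
        by (rule has_vector_derivative_real_field)
      moreover have "ddir (\<tau> *s e) P (0 + of_real s *s (\<tau> *s e)) = \<tau> * (a (of_real s *s (\<tau> *s e)) * P (of_real s *s (\<tau> *s e)))"
        using ddir_smult[OF R1(2) i, of \<tau> e] R3(2)[of "of_real s *s (\<tau> *s e)"] inR[OF s] by (simp add: R_def)
      ultimately show "(p has_vector_derivative \<tau> * a (of_real s *s (\<tau> *s e)) * p s) (at s within {0..1})"
        by (simp add: p_def mult_ac)
    next
      show "continuous_on {0..1} (\<lambda>s. \<tau> * a (of_real s *s (\<tau> *s e)))"
        by (intro continuous_intros continuous_on_compose2[OF holo_continuous_on[OF R2(2)]])
          (use inR in \<open>auto simp: R_def\<close>)
    qed
    moreover have "p 0 = 0" using P(2) by (simp add: p_def)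
    moreover have "p 1 = P (\<tau> *s e)" by (simp add: p_def)
    ultimately show ?thesis by simp
  qed
  hence "\<forall>\<^sub>F \<tau> in nhds 0. P (\<tau> *s e) = 0" by (rule eventually_nhds_ballI[OF r(1)])
  with ord0_nonzero[OF reg] show False by blast
qed

text \<open>The product of the ideals \<open>(P, f)\<close> and \<open>(P, ddir e P)\<close> lies in
  \<open>(P, f * ddir e P)\<close>. Each factor contains a power of the maximal ideal, as
  \<open>P\<close> divides neither \<open>f\<close> nor \<open>ddir e P\<close>. So \<open>x\<close>
  and \<open>y\<close> to the power \<open>K1 + K2\<close> lie in the product, and order
  \<open>2 * (K1 + K2)\<close> suffices.\<close>

lemma irreducible_jacobian_ideal:
  assumes irr: "irreducible_germ P" and f: "holomorphic_at f 0"
    and ndiv: "\<And>a. holomorphic_at a 0 \<Longrightarrow> \<not> (\<forall>\<^sub>F z in nhds 0. f z = a z * P z)"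
  obtains e K where "\<And>r. holomorphic_at r 0 \<Longrightarrow> vanish K r \<Longrightarrow> in_ideal P (\<lambda>z. f z * ddir e P z) r"
proof -
  have P: "holomorphic_at P 0" "P 0 = 0" "\<not> (\<forall>\<^sub>F z in nhds 0. P z = 0)"
    using irr by (auto simp: irreducible_germ_def unit_germ_iff)
  obtain e n where reg: "ord0 n (\<lambda>\<tau>. P (\<tau> *s e))" using germ_direction[OF P(1,3)] by blast
  obtain K1 where K1: "\<And>r. holomorphic_at r 0 \<Longrightarrow> vanish K1 r \<Longrightarrow> in_ideal P f r"
    by (rule irreducible_vanish_in_ideal[OF irr reg f ndiv]) blast+
  note de = holomorphic_at_ddir[OF P(1), of e]
  obtain K2 where K2: "\<And>r. holomorphic_at r 0 \<Longrightarrow> vanish K2 r \<Longrightarrow> in_ideal P (ddir e P) r"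
    by (rule irreducible_vanish_in_ideal[OF irr reg de ddir_not_divisible[OF P(1,2) reg]]) blast+
  have vz: "vanish k (\<lambda>z. z $ i ^ k)" for k and i :: 2
  proof (rule vanishI[of 1 _ 1])
    show "norm (z $ i ^ k) \<le> 1 * norm z ^ k" for z :: "complex^2"
      using power_mono[OF Finite_Cartesian_Product.norm_nth_le[of z i] norm_ge_zero, of k] by (simp add: norm_power)
  qed simp
  have "in_ideal P (\<lambda>z. f z * ddir e P z) (\<lambda>z. z $ i ^ K1 * z $ i ^ K2)" for i
    by (intro in_ideal_product K1 K2 vz P f de holomorphic_at_power holomorphic_at_nth)
  hence m: "in_ideal P (\<lambda>z. f z * ddir e P z) (\<lambda>z. z $ i ^ (K1 + K2))" for i by (simp add: power_add)
  have "in_ideal P (\<lambda>z. f z * ddir e P z) r"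
    if "holomorphic_at r 0" "vanish ((K1 + K2) + (K1 + K2)) r" for r
    by (rule in_ideal_of_vanish[OF P(1) m m that])
  thus ?thesis using that by blast
qed

section \<open>Approximation by flows and the path method\<close>

lemma holomorphic_map_at_add:
  "holomorphic_map_at X p \<Longrightarrow> holomorphic_map_at W p \<Longrightarrow> holomorphic_map_at (\<lambda>z. X z + W z) p"
  by (simp add: holomorphic_map_at_def holomorphic_at_add)

lemma holomorphic_map_at_diff:
  "holomorphic_map_at X p \<Longrightarrow> holomorphic_map_at W p \<Longrightarrow> holomorphic_map_at (\<lambda>z. X z - W z) p"
  by (simp add: holomorphic_map_at_def holomorphic_at_diff)

lemma vanish_holo_ball:
  fixes X :: "complex^2 \<Rightarrow> complex^2"
  assumes "holomorphic_map_at X 0" "vanish k X"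
  obtains R C where "R > 0" "C \<ge> 0" "\<forall>i. holo (\<lambda>z. X z $ i) (ball 0 R)"
    "\<forall>z\<in>ball 0 R. norm (X z) \<le> C * norm z ^ k"
proof -
  obtain R where R: "R > 0" "\<And>i. holo (\<lambda>z. X z $ i) (ball 0 R)"
    using holomorphic_map_atE[OF assms(1)] by blast
  obtain S C where S: "S > 0" "C \<ge> 0" "\<And>z. z \<in> ball 0 S \<Longrightarrow> norm (X z) \<le> C * norm z ^ k"
    using vanishE[OF assms(2)] by blast
  have "\<forall>i. holo (\<lambda>z. X z $ i) (ball 0 (min R S))"
    using holo_subset[OF R(2), of "ball 0 (min R S)"] by (auto simp: subset_ball)
  moreover have "\<forall>z\<in>ball 0 (min R S). norm (X z) \<le> C * norm z ^ k" using S(3) by simp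
  ultimately show ?thesis using R(1) S(1,2) by (intro that[of "min R S" C]) auto
qed

text \<open>Two comparisons of the integral curves \<open>c\<close> of \<open>X\<close> and
  \<open>c'\<close> of \<open>X + W\<close> starting at \<open>p\<close>. A crude one shows that
  they differ by a multiple of \<open>norm p ^ k\<close>. Combined with the Lipschitz constant of
  \<open>X\<close>, which is a multiple of \<open>norm p\<close>, this makes the derivative of
  \<open>c' - c - t W p\<close> of order \<open>k + 1\<close>.\<close>

lemma exp_vf_perturb:
  assumes X: "holomorphic_map_at X 0" "vanish 2 X"
    and W: "holomorphic_map_at W 0" "vanish k W" "k \<ge> 2"
  shows "vanish (Suc k) (\<lambda>z. exp_vf (\<lambda>z. X z + W z) z - exp_vf X z - W z)"
proof -
  let ?V = "\<lambda>z. X z + W z"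
  have W2: "vanish 2 W" by (rule vanish_mono[OF W(2,3)])
  have V: "holomorphic_map_at ?V 0" "vanish 2 ?V"
    using holomorphic_map_at_add[OF X(1) W(1)] vanish_add[OF X(2) W2] by auto
  obtain R1 A where R1: "R1 > 0" "A \<ge> 0" "\<forall>i. holo (\<lambda>z. X z $ i) (ball 0 R1)"
    "\<forall>z\<in>ball 0 R1. norm (X z) \<le> A * norm z ^ 2" using vanish_holo_ball[OF X] by blast
  obtain R2 B where R2: "R2 > 0" "B \<ge> 0" "\<forall>i. holo (\<lambda>z. W z $ i) (ball 0 R2)"
    "\<forall>z\<in>ball 0 R2. norm (W z) \<le> B * norm z ^ k" using vanish_holo_ball[OF W(1,2)] by blast
  obtain d1 K1 where d1: "d1 > 0" "K1 \<ge> 0"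
    "\<forall>p\<in>ball 0 d1. \<exists>c. integral_curve X c \<and> c 0 = p \<and> c 1 = exp_vf X p \<and>
      (\<forall>t\<in>{0..1}. norm (c t) \<le> 2 * norm p \<and> norm (c t - p) \<le> K1 * norm p ^ 2)"
    by (rule exp_flow[OF X]) blast
  obtain d2 K2 where d2: "d2 > 0" "K2 \<ge> 0"
    "\<forall>p\<in>ball 0 d2. \<exists>c. integral_curve ?V c \<and> c 0 = p \<and> c 1 = exp_vf ?V p \<and>
      (\<forall>t\<in>{0..1}. norm (c t) \<le> 2 * norm p \<and> norm (c t - p) \<le> K2 * norm p ^ 2)"
    by (rule exp_flow[OF V]) blast
  \<comment> \<open>The factor five leaves room for the radius \<open>4 * n\<close> that Cauchy's
    inequality uses, and the last bound makes the Lipschitz constant \<open>16 * A * n\<close> of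
    \<open>X\<close> at most \<open>1/2\<close>.\<close>
  define R where "R = min (min R1 R2) (min (min d1 d2) (1 / (32 * (A + 1)))) / 5"
  have A1: "1 / (32 * (A + 1)) > 0" using R1(2) by simp
  have "R > 0" unfolding R_def using R1(1) R2(1) d1(1) d2(1) A1 by (simp only: min_less_iff_conj zero_less_divide_iff) simp
  have Rle: "5 * R \<le> R1" "5 * R \<le> R2" "5 * R \<le> d1" "5 * R \<le> d2" "5 * R \<le> 1 / (32 * (A + 1))"
    unfolding R_def by (simp_all del: divide_le_eq)
  \<comment> \<open>The first summand accounts for \<open>X (c' t) - X (c t)\<close>, the second for
    \<open>W (c' t) - W p\<close>.\<close>
  define Q where "Q = 16 * A * (2 * B * 2 ^ k) + B * 4 ^ k * K2"
  show ?thesis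
  proof (rule vanishI[OF \<open>R > 0\<close>, of _ Q])
    fix p :: "complex^2" assume p: "p \<in> ball 0 R"
    define n where "n = norm p"
    have n: "0 \<le> n" "n < R" using p by (auto simp: n_def)
    show "norm (exp_vf ?V p - exp_vf X p - W p) \<le> Q * norm p ^ Suc k"
    proof (cases "p = 0")
      case True
      have "W 0 = 0" by (rule vanish_zero[OF W2]) simp
      thus ?thesis using exp_vf_holomorphic(2)[OF X] exp_vf_holomorphic(2)[OF V] True by simp
    next
      case False
      hence n0: "n > 0" by (simp add: n_def)
      have "n < d1" "n < d2" using n Rle(3,4) by linarith+
      hence "p \<in> ball 0 d1" "p \<in> ball 0 d2" by (auto simp: n_def)
      obtain c where c: "integral_curve X c" "c 0 = p" "c 1 = exp_vf X p"
        "\<forall>t\<in>{0..1}. norm (c t) \<le> 2 * norm p \<and> norm (c t - p) \<le> K1 * norm p ^ 2"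
        using d1(3) \<open>p \<in> ball 0 d1\<close> by blast
      obtain c' where c': "integral_curve ?V c'" "c' 0 = p" "c' 1 = exp_vf ?V p"
        "\<forall>t\<in>{0..1}. norm (c' t) \<le> 2 * norm p \<and> norm (c' t - p) \<le> K2 * norm p ^ 2"
        using d2(3) \<open>p \<in> ball 0 d2\<close> by blast
      have dc: "(c has_vector_derivative X (c t)) (at t within {0..1})"
        and dc': "(c' has_vector_derivative X (c' t) + W (c' t)) (at t within {0..1})"
        if "t \<in> {0..1}" for t using c(1) c'(1) that by (auto simp: integral_curve_def)
      have bc: "c t \<in> cball 0 (2 * n)" and bc': "c' t \<in> cball 0 (2 * n)" if "t \<in> {0..1}" for t
        using c(4) c'(4) that by (auto simp: n_def)
      have lipX: "norm (X x - X y) \<le> (16 * A * n) * norm (x - y)"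
        if "x \<in> cball 0 (2 * n)" "y \<in> cball 0 (2 * n)" for x y
      proof -
        have "norm (X x - X y) \<le> 2 * (A * (2 * (2 * n)) ^ 2 / (2 * n)) * norm (x - y)"
          by (rule map_lipschitz_order[of X R1]) (use R1 n n0 Rle that in auto)
        also have "2 * (A * (2 * (2 * n)) ^ 2 / (2 * n)) = 16 * A * n"
          using n0 by (simp add: power2_eq_square)
        finally show ?thesis .
      qed
      have lipW: "norm (W x - W y) \<le> (B * 4 ^ k * n ^ (k - 1)) * norm (x - y)"
        if "x \<in> cball 0 (2 * n)" "y \<in> cball 0 (2 * n)" for x y
      proof -
        have "norm (W x - W y) \<le> 2 * (B * (2 * (2 * n)) ^ k / (2 * n)) * norm (x - y)"
          by (rule map_lipschitz_order[of W R2]) (use R2 n n0 Rle that in auto)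
        also have "2 * (B * (2 * (2 * n)) ^ k / (2 * n)) = B * 4 ^ k * n ^ (k - 1)"
        proof -
          have "n ^ k = n * n ^ (k - 1)" using W(3) by (cases k) auto
          moreover have "(2 * (2 * n)) ^ k = (4 * n) ^ k" by simp
          hence "(2 * (2 * n)) ^ k = 4 ^ k * n ^ k" unfolding power_mult_distrib[of 4 n k] .
          ultimately show ?thesis using n0 by simp
        qed
        finally show ?thesis .
      qed
      have An: "16 * A * n \<le> 1 / 2"
      proof -
        have "n \<le> 1 / (32 * (A + 1))" using n Rle(5) by linarith
        hence "n * (32 * (A + 1)) \<le> 1" using R1(2) by (simp add: field_simps)
        thus ?thesis using n0 by (simp add: algebra_simps)
      qed
      have cc: "continuous_on {0..1} c" "continuous_on {0..1} c'"
        using dc dc' by (meson continuous_on_eq_continuous_within has_vector_derivative_continuous)+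
      have cn: "continuous_on {0..1} (\<lambda>t. norm (c' t - c t))" by (intro continuous_intros cc)
      have "\<exists>m\<in>{0..1}. \<forall>t\<in>{0..1}. norm (c' t - c t) \<le> norm (c' m - c m)"
        by (rule continuous_attains_sup[OF compact_Icc _ cn]) simp
      then obtain m where m: "m \<in> {0..1}" "\<forall>t\<in>{0..1}. norm (c' t - c t) \<le> norm (c' m - c m)" by blast
      \<comment> \<open>The largest distance of the two curves. It satisfies
        \<open>M \<le> M / 2 + B * 2 ^ k * n ^ k\<close>, and the first term is absorbed.\<close>
      define M where "M = norm (c' m - c m)"
      have M0: "M \<ge> 0" by (simp add: M_def)
      have lipX': "norm (X (c' t) - X (c t)) \<le> (16 * A * n) * M" if "t \<in> {0..1}" for t
      proof -
        have "norm (X (c' t) - X (c t)) \<le> (16 * A * n) * norm (c' t - c t)"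
          by (rule lipX[OF bc'[OF that] bc[OF that]])
        also have "\<dots> \<le> (16 * A * n) * M"
          using m(2) that R1(2) n(1) unfolding M_def by (intro mult_left_mono) auto
        finally show ?thesis .
      qed
      have WB: "norm (W (c' t)) \<le> B * 2 ^ k * n ^ k" if "t \<in> {0..1}" for t
      proof -
        have b: "norm (c' t) \<le> 2 * n" using bc'[OF that] by simp
        have "norm (W (c' t)) \<le> B * norm (c' t) ^ k" using R2(4) b n Rle(2) by simp
        also have "\<dots> \<le> B * (2 * n) ^ k" using b R2(2) by (intro mult_left_mono power_mono) auto
        finally show ?thesis by (simp add: power_mult_distrib)
      qed
      have "norm ((c' m - c m) - (c' 0 - c 0)) \<le> ((16 * A * n) * M + B * 2 ^ k * n ^ k) * \<bar>m - 0\<bar>"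
      proof (rule vector_derivative_bound)
        fix t :: real assume t: "t \<in> {0..1}"
        show "((\<lambda>t. c' t - c t) has_vector_derivative (X (c' t) - X (c t)) + W (c' t)) (at t within {0..1})"
          using has_vector_derivative_diff[OF dc'[OF t] dc[OF t]] by (simp add: algebra_simps)
        show "norm ((X (c' t) - X (c t)) + W (c' t)) \<le> (16 * A * n) * M + B * 2 ^ k * n ^ k"
          using norm_triangle_ineq[of "X (c' t) - X (c t)" "W (c' t)"] lipX'[OF t] WB[OF t] by linarith
      qed (use m in auto)
      also have "\<dots> \<le> ((16 * A * n) * M + B * 2 ^ k * n ^ k) * 1"
        using m(1) M0 R1(2) R2(2) n(1) by (intro mult_left_mono add_nonneg_nonneg mult_nonneg_nonneg) auto
      also have "\<dots> \<le> 1 / 2 * M + B * 2 ^ k * n ^ k"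
        using mult_right_mono[OF An M0] by simp
      finally have "M \<le> 1 / 2 * M + B * 2 ^ k * n ^ k" using c(2) c'(2) by (simp add: M_def)
      hence MB: "M \<le> 2 * B * 2 ^ k * n ^ k" by simp
      have "norm ((c' 1 - c 1 - 1 *\<^sub>R W p) - (c' 0 - c 0 - 0 *\<^sub>R W p)) \<le> (Q * n ^ Suc k) * \<bar>1 - 0\<bar>"
      proof (rule vector_derivative_bound)
        fix t :: real assume t: "t \<in> {0..1}"
        have "((\<lambda>t. t *\<^sub>R W p) has_vector_derivative 1 *\<^sub>R W p) (at t within {0..1})"
          by (auto intro!: derivative_eq_intros)
        from has_vector_derivative_diff[OF has_vector_derivative_diff[OF dc'[OF t] dc[OF t]] this]
        show "((\<lambda>t. c' t - c t - t *\<^sub>R W p) has_vector_derivative (X (c' t) - X (c t)) + (W (c' t) - W p)) (at t within {0..1})"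
          by (simp add: algebra_simps)
        have p2: "p \<in> cball 0 (2 * n)" using n0 by (simp add: n_def)
        have "norm (X (c' t) - X (c t)) \<le> (16 * A * n) * (2 * B * 2 ^ k * n ^ k)"
          by (rule order_trans[OF lipX'[OF t] mult_left_mono[OF MB]]) (use R1(2) n0 in simp)
        moreover have "norm (W (c' t) - W p) \<le> (B * 4 ^ k * n ^ (k - 1)) * (K2 * n ^ 2)"
        proof -
          have "norm (W (c' t) - W p) \<le> (B * 4 ^ k * n ^ (k - 1)) * norm (c' t - p)"
            by (rule lipW[OF bc'[OF t] p2])
          also have "\<dots> \<le> (B * 4 ^ k * n ^ (k - 1)) * (K2 * n ^ 2)"
            using c'(4) t R2(2) n0 by (intro mult_left_mono) (auto simp: n_def)
          finally show ?thesis .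
        qed
        moreover have "(16 * A * n) * (2 * B * 2 ^ k * n ^ k) + (B * 4 ^ k * n ^ (k - 1)) * (K2 * n ^ 2) = Q * n ^ Suc k"
        proof -
          have "k - 1 + 2 = Suc k" using W(3) by simp
          hence "n ^ (k - 1) * n ^ 2 = n ^ Suc k" unfolding power_add[symmetric] by (rule arg_cong)
          hence "(B * 4 ^ k * n ^ (k - 1)) * (K2 * n ^ 2) = B * 4 ^ k * K2 * n ^ Suc k" by (simp add: mult_ac)
          thus ?thesis by (simp add: Q_def algebra_simps)
        qed
        ultimately show "norm ((X (c' t) - X (c t)) + (W (c' t) - W p)) \<le> Q * n ^ Suc k"
          using norm_triangle_ineq[of "X (c' t) - X (c t)" "W (c' t) - W p"] by linarith
      qed auto
      thus ?thesis using c(2,3) c'(2,3) by (simp add: n_def)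
    qed
  qed
qed

lemma exp_vf_0: "exp_vf (\<lambda>_. 0) p = p"
proof -
  have "integral_curve (\<lambda>_. 0) (\<lambda>_::real. p)"
    by (auto simp: integral_curve_def holomorphic_map_at_def)
  from exp_vf_eq[OF this] show ?thesis .
qed

text \<open>The error of \<open>X\<close> is a holomorphic map of order \<open>k + 2\<close> and may
  be subtracted from the field; by \<open>exp_vf_perturb\<close> this cancels it up to order
  \<open>k + 3\<close>. The induction starts with the zero field, whose time one map is the
  identity.\<close>

lemma exp_vf_approx:
  assumes "holomorphic_map_at \<kappa> 0" "vanish 2 (\<lambda>z. \<kappa> z - z)"
  shows "\<exists>X. holomorphic_map_at X 0 \<and> vanish 2 X \<and> vanish (k + 2) (\<lambda>z. exp_vf X z - \<kappa> z)"
proof (induction k)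
  case 0
  have "holomorphic_map_at (\<lambda>_. 0) 0" by (auto simp: holomorphic_map_at_def)
  moreover have "vanish 2 (\<lambda>_::complex^2. 0 :: complex^2)" by (rule vanishI[of 1 _ 0]) auto
  moreover have "vanish (0 + 2) (\<lambda>z. exp_vf (\<lambda>_. 0) z - \<kappa> z)"
    using vanish_minus[OF assms(2)] unfolding add_0 exp_vf_0 minus_diff_eq .
  ultimately show ?case by blast
next
  case (Suc k)
  then obtain X where X: "holomorphic_map_at X 0" "vanish 2 X" "vanish (k + 2) (\<lambda>z. exp_vf X z - \<kappa> z)" by blast
  define W where "W = (\<lambda>z. \<kappa> z - exp_vf X z)"
  have W: "holomorphic_map_at W 0" "vanish (k + 2) W"
    using holomorphic_map_at_diff[OF assms(1) exp_vf_holomorphic(1)[OF X(1,2)]] vanish_minus[OF X(3)]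
    by (simp_all add: W_def)
  have "vanish 2 W" by (rule vanish_mono[OF W(2)]) simp
  moreover have "vanish (Suc (k + 2)) (\<lambda>z. exp_vf (\<lambda>z. X z + W z) z - exp_vf X z - W z)"
    by (rule exp_vf_perturb[OF X(1,2) W]) simp
  hence "vanish (Suc k + 2) (\<lambda>z. exp_vf (\<lambda>z. X z + W z) z - \<kappa> z)" by (simp add: W_def)
  ultimately show ?case using holomorphic_map_at_add[OF X(1) W(1)] vanish_add[OF X(2), of W] by blast
qed

section \<open>The path method along \<open>P + t r\<close>\<close>

lemma curve_derivative:
  assumes "holo f U" "c t \<in> U" "(c has_vector_derivative v) (at t within S)"
  shows "((\<lambda>t. f (c t)) has_vector_derivative ddir v f (c t)) (at t within S)"
  using vector_derivative_diff_chain_within[OF assms(3) has_derivative_at_withinI[OF holo_has_derivative[OF assms(1,2)]]]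
  by (simp add: o_def)

lemma common_ball:
  assumes "\<forall>g\<in>set gs. holomorphic_at g p"
  obtains R where "R > 0" "\<forall>g\<in>set gs. holo g (ball p R)"
proof -
  have "\<exists>U. open U \<and> p \<in> U \<and> (\<forall>g\<in>set gs. holo g U)"
    using assms
  proof (induction gs)
    case Nil show ?case by (intro exI[of _ UNIV]) auto
  next
    case (Cons g gs)
    then obtain U where U: "open U" "p \<in> U" "\<forall>g\<in>set gs. holo g U" by auto
    from Cons.prems obtain V where V: "open V" "p \<in> V" "holo g V"
      by (auto simp: holomorphic_at_iff)
    show ?case by (intro exI[of _ "U \<inter> V"]) (use U V in \<open>auto intro: holo_subset\<close>)
  qed
  then obtain U where U: "open U" "p \<in> U" "\<forall>g\<in>set gs. holo g U" by blast
  then obtain R where R: "R > 0" "ball p R \<subseteq> U" using open_contains_ball by blast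
  with U(3) have "\<forall>g\<in>set gs. holo g (ball p R)" by (blast intro: holo_subset)
  with R(1) show ?thesis by (rule that)
qed

text \<open>With \<open>G = f \<cdot> D\<^sub>e P\<close> and \<open>G\<^sub>t = f \<cdot> D\<^sub>e (P + t r)\<close>, the pair \<open>(P + t r, G\<^sub>t)\<close> is \<open>(P, G)\<close> transformed
  by a matrix of determinant \<open>D t\<close>; inverting it gives \<open>r = \<alpha> (P + t r) + \<beta> G\<^sub>t\<close>. Hence along the flow of
  \<open>- \<beta> f e\<close> both \<open>f\<close> and \<open>P + t r\<close> solve scalar linear differential equations.\<close>

lemma path_equivalence:
  assumes f: "holomorphic_at f 0" "f 0 = 0" and P: "holomorphic_at P 0" and r: "holomorphic_at r 0"
    and a: "holomorphic_at a 0" "a 0 = 0" and c: "holomorphic_at c 0" "c 0 = 0"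
    and a': "holomorphic_at a' 0" "a' 0 = 0" and c': "holomorphic_at c' 0" "c' 0 = 0"
    and r1: "\<forall>\<^sub>F z in nhds 0. r z = a z * P z + c z * (f z * ddir e P z)"
    and r2: "\<forall>\<^sub>F z in nhds 0. f z * ddir e r z = a' z * P z + c' z * (f z * ddir e P z)"
  obtains \<theta> where "holomorphic_map_at \<theta> 0" "vanish 2 (\<lambda>z. \<theta> z - z)"
    "\<forall>\<^sub>F z in nhds 0. (f (\<theta> z) = 0 \<longleftrightarrow> f z = 0) \<and> (P (\<theta> z) + r (\<theta> z) = 0 \<longleftrightarrow> P z = 0)"
proof -
  have "\<forall>g\<in>set [f, P, r, a, c, a', c']. holomorphic_at g 0" using f P r a c a' c' by simp
  from common_ball[OF this] obtain R0 where R0: "R0 > 0" "\<forall>g\<in>set [f, P, r, a, c, a', c']. holo g (ball 0 R0)" .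
  hence hol0: "holo f (ball 0 R0)" "holo P (ball 0 R0)" "holo r (ball 0 R0)" "holo a (ball 0 R0)"
    "holo c (ball 0 R0)" "holo a' (ball 0 R0)" "holo c' (ball 0 R0)" by simp_all
  have small: "\<forall>\<^sub>F z in nhds 0. norm (g z) < 1 / 4" if "holomorphic_at g 0" "g 0 = 0" for g
  proof -
    have "(g \<longlongrightarrow> g 0) (nhds 0)"
      using holomorphic_at_isCont[OF that(1)] unfolding isCont_def tendsto_at_iff_tendsto_nhds .
    hence "\<forall>\<^sub>F z in nhds 0. dist (g z) (g 0) < 1 / 4" by (rule tendstoD) simp
    thus ?thesis using that(2) by simp
  qed
  obtain Cf Sf where Cf: "Sf > 0" "Cf \<ge> 0" "\<And>z. z \<in> ball 0 Sf \<Longrightarrow> norm (f z) \<le> Cf * norm z ^ 1"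
    by (rule vanishE[OF vanish_1I[OF f]]) blast
  obtain Cc Sc where Cc: "Sc > 0" "Cc \<ge> 0" "\<And>z. z \<in> ball 0 Sc \<Longrightarrow> norm (c z) \<le> Cc * norm z ^ 1"
    by (rule vanishE[OF vanish_1I[OF c]]) blast
  have "\<forall>\<^sub>F z in nhds 0. norm (a z) < 1 / 4 \<and> norm (c z) < 1 / 4 \<and> norm (a' z) < 1 / 4 \<and> norm (c' z) < 1 / 4
     \<and> r z = a z * P z + c z * (f z * ddir e P z) \<and> f z * ddir e r z = a' z * P z + c' z * (f z * ddir e P z)
     \<and> z \<in> ball 0 R0 \<and> z \<in> ball 0 Sf \<and> z \<in> ball 0 Sc"
    using small[OF a] small[OF c] small[OF a'] small[OF c'] r1 r2 R0(1) Cf(1) Cc(1)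
    by (intro eventually_conj eventually_nhds_in_open open_ball centre_in_ball[THEN iffD2])
  then obtain R where R: "R > 0" and RR: "\<And>z. z \<in> ball 0 R \<Longrightarrow> norm (a z) < 1 / 4 \<and> norm (c z) < 1 / 4 \<and> norm (a' z) < 1 / 4 \<and> norm (c' z) < 1 / 4
     \<and> r z = a z * P z + c z * (f z * ddir e P z) \<and> f z * ddir e r z = a' z * P z + c' z * (f z * ddir e P z)
     \<and> z \<in> ball 0 R0 \<and> z \<in> ball 0 Sf \<and> z \<in> ball 0 Sc"
    by (rule eventually_nhds_ballE) blast
  define B where "B = ball (0::complex^2) R"
  have B0: "B \<subseteq> ball 0 R0" using RR unfolding B_def by blast
  note hol = hol0[THEN holo_subset, OF B0]
  \<comment> \<open>The determinant of the matrix with rows \<open>(1 + t a, t c)\<close> and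
    \<open>(t a', 1 + t c')\<close>. The functions \<open>a\<close>, \<open>c\<close>,
    \<open>a'\<close>, \<open>c'\<close> being below \<open>1/4\<close> keeps its modulus at least
    \<open>1 - 1/2 - 1/8 = 3/8\<close>.\<close>
  define D where "D = (\<lambda>(t::real) z. (1 + of_real t * a z) * (1 + of_real t * c' z) - of_real t ^ 2 * c z * a' z)"
  have Dn: "norm (D t z) \<ge> 3 / 8" if "t \<in> {0..1}" "z \<in> B" for t z
  proof -
    have tb: "norm (of_real t :: complex) \<le> 1" using that by simp
    have b: "norm (of_real t * x) \<le> 1 / 4" if "norm x < 1 / 4" for x :: complex
      using mult_mono[OF tb less_imp_le[OF that]] by (simp add: norm_mult)
    have bb: "norm (x * y) \<le> 1 / 16" if "norm x \<le> 1 / 4" "norm y \<le> 1 / 4" for x y :: complex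
      using mult_mono[OF that] by (simp add: norm_mult)
    let ?a = "of_real t * a z" and ?c = "of_real t * c z" and ?a' = "of_real t * a' z" and ?c' = "of_real t * c' z"
    have s: "norm ?a \<le> 1 / 4" "norm ?c \<le> 1 / 4" "norm ?a' \<le> 1 / 4" "norm ?c' \<le> 1 / 4"
      using RR[of z] that(2) unfolding B_def by (blast intro: b)+
    have "D t z = 1 + (?a + ?c' + (?a * ?c' - ?c * ?a'))"
      by (simp add: D_def algebra_simps power2_eq_square)
    moreover have "norm (?a + ?c' + (?a * ?c' - ?c * ?a')) \<le> norm ?a + norm ?c' + (norm (?a * ?c') + norm (?c * ?a'))"
      by (intro order_trans[OF norm_triangle_ineq] add_mono norm_triangle_ineq norm_triangle_ineq4)
    moreover have "norm ?a + norm ?c' + (norm (?a * ?c') + norm (?c * ?a')) \<le> 1 / 4 + 1 / 4 + (1 / 16 + 1 / 16)"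
      by (intro add_mono s bb)
    ultimately have "norm (D t z - 1) \<le> 5 / 8" by simp
    moreover have "1 = norm (1::complex)" by simp
    ultimately show ?thesis using norm_triangle_ineq2[of 1 "1 - D t z"] by (simp add: norm_minus_commute)
  qed
  hence D0: "D t z \<noteq> 0" if "t \<in> {0..1}" "z \<in> B" for t z using that by force
  \<comment> \<open>The row \<open>(a, c)\<close> of coefficients of \<open>r\<close>, multiplied by
    the inverse matrix; in the second entry the products of \<open>a\<close> and \<open>c\<close>
    cancel, leaving \<open>c / D\<close>.\<close>
  define \<alpha> where "\<alpha> = (\<lambda>t z. (a z * (1 + of_real t * c' z) - of_real t * c z * a' z) / D t z)"
  define \<beta> where "\<beta> = (\<lambda>t z. c z / D t z)"
  have key: "r z = \<alpha> t z * (P z + of_real t * r z) + \<beta> t z * (f z * ddir e P z + of_real t * (f z * ddir e r z))"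
    if "t \<in> {0..1}" "z \<in> B" for t z
  proof -
    have e1: "r z = a z * P z + c z * (f z * ddir e P z)"
      and e2: "f z * ddir e r z = a' z * P z + c' z * (f z * ddir e P z)"
      using RR[of z] that by (auto simp: B_def)
    define G where "G = f z * ddir e P z"
    define \<tau> :: complex where "\<tau> = of_real t"
    have "(a z * (1 + \<tau> * c' z) - \<tau> * c z * a' z) * (P z + \<tau> * (a z * P z + c z * G))
        + c z * (G + \<tau> * (a' z * P z + c' z * G)) = (a z * P z + c z * G) * D t z"
      by (simp add: D_def \<tau>_def[symmetric] algebra_simps power2_eq_square)
    hence main: "(a z * (1 + \<tau> * c' z) - \<tau> * c z * a' z) * (P z + \<tau> * r z)
        + c z * (G + \<tau> * (f z * ddir e r z)) = r z * D t z"
      unfolding e2 unfolding e1 G_def[symmetric] .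
    have "\<alpha> t z * u + \<beta> t z * v = ((a z * (1 + \<tau> * c' z) - \<tau> * c z * a' z) * u + c z * v) / D t z" for u v
      by (simp add: \<alpha>_def \<beta>_def \<tau>_def add_divide_distrib)
    from this[of "P z + \<tau> * r z" "G + \<tau> * (f z * ddir e r z)"] show ?thesis
      unfolding main using D0[OF that] by (simp add: G_def \<tau>_def)
  qed
  \<comment> \<open>Both \<open>c\<close> and \<open>f\<close> vanish at the origin, so the field
    has order two; the factor \<open>f\<close> makes its flow preserve \<open>f = 0\<close>.\<close>
  define X where "X = (\<lambda>t z. (- (\<beta> t z * f z)) *s e)"
  have cont1: "continuous_on ({0..1} \<times> B) (\<lambda>x. g (snd x))" if "holo g B" for g
    by (rule continuous_on_compose2[OF holo_continuous_on[OF that]]) (auto intro!: continuous_intros)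
  have cD: "continuous_on ({0..1} \<times> B) (\<lambda>x. D (fst x) (snd x))"
    unfolding D_def by (intro continuous_intros cont1 hol)
  have hD: "holo (D t) B" for t
    unfolding D_def by (intro holo_diff holo_mult holo_add holo_const holo_power hol)
  have c\<beta>: "continuous_on ({0..1} \<times> B) (\<lambda>(t, z). \<beta> t z)"
    and c\<alpha>: "continuous_on ({0..1} \<times> B) (\<lambda>(t, z). \<alpha> t z)"
    unfolding \<alpha>_def \<beta>_def case_prod_beta using D0
    by (intro continuous_intros cont1 hol cD; auto)+
  have h\<beta>: "holo (\<beta> t) B" if "t \<in> {0..1}" for t
    unfolding \<beta>_def using D0[OF that] by (intro holo_divide hol hD) auto
  define C where "C = Cc * Cf * (8 / 3) * norm e"
  have "C \<ge> 0" using Cc(2) Cf(2) by (simp add: C_def)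
  have Xb: "norm (X t z) \<le> C * norm z ^ 2" if "t \<in> {0..1}" "z \<in> B" for t z
  proof -
    have fz: "norm (f z) \<le> Cf * norm z" "norm (c z) \<le> Cc * norm z"
      using Cf(3)[of z] Cc(3)[of z] RR[of z] that by (auto simp: B_def)
    have "norm (X t z) = norm (c z) * norm (f z) / norm (D t z) * norm e"
      by (simp add: X_def \<beta>_def norm_smult norm_mult norm_divide)
    also have "\<dots> \<le> (Cc * norm z) * (Cf * norm z) / (3 / 8) * norm e"
      using fz Dn[OF that] Cc(2) Cf(2) by (intro mult_right_mono frac_le mult_mono) auto
    finally show ?thesis by (simp add: C_def power2_eq_square mult_ac)
  qed
  obtain d fl where fl: "0 < d" "2 * d \<le> R"
    "\<And>p. p \<in> ball 0 d \<Longrightarrow> fl 0 p = p"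
    "\<And>t p. t \<in> {0..1} \<Longrightarrow> p \<in> ball 0 d \<Longrightarrow> norm (fl t p) \<le> 2 * norm p"
    "\<And>t p. t \<in> {0..1} \<Longrightarrow> p \<in> ball 0 d \<Longrightarrow> norm (fl t p - p) \<le> 4 * C * norm p ^ 2"
    "\<And>t p. t \<in> {0..1} \<Longrightarrow> p \<in> ball 0 d \<Longrightarrow>
      ((\<lambda>t. fl t p) has_vector_derivative X t (fl t p)) (at t within {0..1})"
    "\<And>t i. t \<in> {0..1} \<Longrightarrow> holo (\<lambda>p. fl t p $ i) (ball 0 d)"
  proof (rule flow_quadratic[of R X C])
    show "continuous_on ({0..1} \<times> ball 0 R) (\<lambda>(t, z). X t z)"
      unfolding X_def case_prod_beta using c\<beta>[unfolded case_prod_beta]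
      by (intro continuous_on_smult continuous_on_minus continuous_on_mult continuous_on_const)
        (use cont1[OF hol(1)] in \<open>simp_all add: B_def\<close>)
    show "holo (\<lambda>z. X t z $ i) (ball 0 R)" if "t \<in> {0..1}" for t i
      using holo_mult[OF holo_minus[OF holo_mult[OF h\<beta>[OF that] hol(1)]] holo_const]
      by (simp add: X_def B_def)
  qed (use R \<open>C \<ge> 0\<close> Xb in \<open>auto simp: B_def\<close>)
  have flB: "fl t p \<in> B" if "t \<in> {0..1}" "p \<in> ball 0 d" for t p
    using fl(4)[OF that] fl(2) that by (auto simp: B_def)
  have flc: "continuous_on {0..1} (\<lambda>t. fl t p)" if "p \<in> ball 0 d" for p
    using fl(6)[OF _ that] by (meson continuous_on_eq_continuous_within has_vector_derivative_continuous)
  have along: "continuous_on {0..1} (\<lambda>t. g t (fl t p))"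
    if "continuous_on ({0..1} \<times> B) (\<lambda>(t, z). g t z)" "p \<in> ball 0 d" for g :: "real \<Rightarrow> complex^2 \<Rightarrow> complex" and p
    by (rule continuous_on_case_prod_compose[OF that(1) continuous_on_id flc[OF that(2)]]) (use flB that(2) in auto)
  have oB: "open B" by (simp add: B_def)
  have ddX: "ddir (X t z) g z = - (\<beta> t z * f z) * ddir e g z" if "holo g B" "z \<in> B" for t z g
    unfolding X_def by (rule ddir_smult[OF that])
  have res: "(f (fl 1 p) = 0 \<longleftrightarrow> f p = 0) \<and> (P (fl 1 p) + r (fl 1 p) = 0 \<longleftrightarrow> P p = 0)" if p: "p \<in> ball 0 d" for p
  proof
    have "f (fl 1 p) = f (fl 0 p) * exp (integral {0..1} (\<lambda>t. - \<beta> t (fl t p) * ddir e f (fl t p)))"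
    proof (rule scalar_ode)
      fix t :: real assume t: "t \<in> {0..1}"
      from curve_derivative[OF hol(1) flB[OF t p] fl(6)[OF t p]]
      show "((\<lambda>t. f (fl t p)) has_vector_derivative - \<beta> t (fl t p) * ddir e f (fl t p) * f (fl t p)) (at t within {0..1})"
        by (simp add: ddX[OF hol(1) flB[OF t p]] mult_ac)
    next
      show "continuous_on {0..1} (\<lambda>t. - \<beta> t (fl t p) * ddir e f (fl t p))"
        by (intro continuous_intros along[OF c\<beta> p]
            continuous_on_compose2[OF holo_continuous_on[OF holo_ddir[OF oB hol(1)]] flc[OF p]])
          (use flB p in auto)
    qed
    thus "f (fl 1 p) = 0 \<longleftrightarrow> f p = 0" using fl(3)[OF p] by simp
    have "P (fl 1 p) + of_real 1 * r (fl 1 p) = (P (fl 0 p) + of_real 0 * r (fl 0 p)) * exp (integral {0..1} (\<lambda>t. \<alpha> t (fl t p)))"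
    proof (rule scalar_ode)
      fix t :: real assume t: "t \<in> {0..1}"
      let ?z = "fl t p"
      note zB = flB[OF t p]
      have dP: "((\<lambda>t. P (fl t p)) has_vector_derivative - (\<beta> t ?z * f ?z) * ddir e P ?z) (at t within {0..1})"
        using curve_derivative[OF hol(2) zB fl(6)[OF t p]] by (simp add: ddX[OF hol(2) zB])
      have dr: "((\<lambda>t. r (fl t p)) has_vector_derivative - (\<beta> t ?z * f ?z) * ddir e r ?z) (at t within {0..1})"
        using curve_derivative[OF hol(3) zB fl(6)[OF t p]] by (simp add: ddX[OF hol(3) zB])
      have dt: "((\<lambda>t. of_real t :: complex) has_vector_derivative 1) (at t within {0..1})"
        by (rule has_vector_derivative_of_real[OF DERIV_ident, simplified])
      have "((\<lambda>t. P (fl t p) + of_real t * r (fl t p)) has_vector_derivative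
          - (\<beta> t ?z * f ?z) * ddir e P ?z + (of_real t * (- (\<beta> t ?z * f ?z) * ddir e r ?z) + 1 * r ?z)) (at t within {0..1})"
        by (intro has_vector_derivative_add dP has_vector_derivative_mult dt dr)
      \<comment> \<open>The derivative of \<open>P + t r\<close> along the flow is
        \<open>r - \<beta> G_t\<close> with \<open>G_t = f * D_e (P + t r)\<close>, and
        \<open>key\<close> says that this is \<open>\<alpha> (P + t r)\<close>.\<close>
      moreover have "- (\<beta> t ?z * f ?z) * ddir e P ?z + (of_real t * (- (\<beta> t ?z * f ?z) * ddir e r ?z) + 1 * r ?z)
          = \<alpha> t ?z * (P ?z + of_real t * r ?z)"
        using key[OF t zB] by (simp add: algebra_simps)
      ultimately show "((\<lambda>t. P (fl t p) + of_real t * r (fl t p)) has_vector_derivative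
          \<alpha> t ?z * (P ?z + of_real t * r ?z)) (at t within {0..1})" by simp
    qed (rule along[OF c\<alpha> p])
    thus "P (fl 1 p) + r (fl 1 p) = 0 \<longleftrightarrow> P p = 0" using fl(3)[OF p] by simp
  qed
  show ?thesis
  proof (rule that[of "fl 1"])
    show "holomorphic_map_at (fl 1) 0" by (rule holomorphic_map_at_ballI[OF fl(7) fl(1)]) simp
    show "vanish 2 (\<lambda>z. fl 1 z - z)" by (rule vanishI[OF fl(1)]) (use fl(5)[of 1] in auto)
    show "\<forall>\<^sub>F z in nhds 0. (f (fl 1 z) = 0 \<longleftrightarrow> f z = 0) \<and> (P (fl 1 z) + r (fl 1 z) = 0 \<longleftrightarrow> P z = 0)"
      by (rule eventually_nhds_ballI[OF fl(1)]) (rule res)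
  qed
qed

section \<open>Conjugation of flows and matrix logarithms\<close>

lemma ddir_near_identity:
  assumes "holomorphic_at f 0" "vanish 2 (\<lambda>z. f z - z $ i)"
  shows "ddir v f 0 = v $ i"
proof -
  define g where "g = (\<lambda>z. f z - z $ i)"
  have g: "holomorphic_at g 0" "vanish (Suc 1) g"
    using assms holomorphic_at_diff[OF assms(1) holomorphic_at_nth] by (simp_all add: g_def numeral_2_eq_2)
  obtain R where R: "R > 0" "holo g (ball 0 R)" using holomorphic_atE[OF g(1)] by blast
  have "ddir v g 0 = 0" by (rule vanish_zero[OF vanish_ddir[OF g]]) simp
  moreover have "((\<lambda>\<tau>. g (0 + \<tau> *s v)) has_field_derivative ddir v g (0 + 0 *s v)) (at 0)"
    by (rule holo_slice[OF R(2)]) (use R(1) in simp)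
  ultimately have "((\<lambda>\<tau>. g (0 + \<tau> *s v)) has_field_derivative 0) (at 0)" by simp
  from DERIV_add[OF this DERIV_cmult_right[OF DERIV_ident, of "v $ i"]]
  have "((\<lambda>\<tau>. f (0 + \<tau> *s v)) has_field_derivative v $ i) (at 0)" by (simp add: g_def)
  thus ?thesis unfolding ddir_def by (rule DERIV_imp_deriv)
qed

text \<open>\<open>X\<close> is the pullback of \<open>Z\<close>: the inverse Jacobian matrix of
  \<theta> applied to \<open>Z\<close> composed with \<theta>. Then \<theta> maps integral curves of
  \<open>X\<close> to integral curves of \<open>Z\<close>, hence conjugates the time one
  maps.\<close>

lemma conjugate_flow:
  assumes \<theta>: "holomorphic_map_at \<theta> 0" "vanish 2 (\<lambda>z. \<theta> z - z)"
    and Z: "holomorphic_map_at Z 0" "vanish 2 Z"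
  obtains X where "holomorphic_map_at X 0" "vanish 2 X"
    "\<forall>\<^sub>F z in nhds 0. \<theta> (exp_vf X z) = exp_vf Z (\<theta> z)"
proof -
  have \<theta>0: "\<theta> 0 = 0" using vanish_zero[OF \<theta>(2)] by simp
  have v1: "vanish 1 \<theta>"
    by (rule vanish_vecI, rule vanish_1I) (use \<theta>(1) \<theta>0 in \<open>simp_all add: holomorphic_map_at_def\<close>)
  \<comment> \<open>\<open>m i v\<close> is the derivative of component \<open>i\<close> of \<theta>
    along \<open>v\<close>. With the basis vectors for \<open>v\<close> these are the entries of the
    Jacobian matrix, \<open>D\<close> is its determinant, equal to 1 at the origin, and
    \<open>x1\<close>, \<open>x2\<close> solve the linear system by Cramer's rule.\<close>
  define m where "m = (\<lambda>i v. ddir v (\<lambda>z. \<theta> z $ i))"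
  have mh: "holomorphic_at (m i v) 0" for i v
    unfolding m_def using \<theta>(1) by (intro holomorphic_at_ddir) (simp add: holomorphic_map_at_def)
  have m0: "m i v 0 = v $ i" for i v
    unfolding m_def using \<theta>(1) vanish_nth[OF \<theta>(2), of i]
    by (intro ddir_near_identity) (simp_all add: holomorphic_map_at_def)
  define D where "D = (\<lambda>z. m 1 ex z * m 2 ey z - m 1 ey z * m 2 ex z)"
  have Dh: "holomorphic_at D 0" unfolding D_def by (intro holomorphic_at_diff holomorphic_at_mult mh)
  have "D 0 = 1" by (simp add: D_def m0 axis_def)
  hence Dn: "D 0 \<noteq> 0" by simp
  define Y where "Y = (\<lambda>z. Z (\<theta> z))"
  have Y: "holomorphic_map_at Y 0"
    unfolding Y_def by (rule holomorphic_map_at_compose) (use Z \<theta> \<theta>0 in simp_all)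
  have Yv: "vanish 2 Y"
    unfolding Y_def by (rule vanish_compose[OF Z(2) v1 holomorphic_map_at_isCont[OF \<theta>(1)]])
  have Yi: "holomorphic_at (\<lambda>z. Y z $ i) 0" "vanish 2 (\<lambda>z. Y z $ i)" for i
    using Y vanish_nth[OF Yv] by (simp_all add: holomorphic_map_at_def)
  define x1 where "x1 = (\<lambda>z. (m 2 ey z * Y z $ 1 - m 1 ey z * Y z $ 2) * inverse (D z))"
  define x2 where "x2 = (\<lambda>z. (m 1 ex z * Y z $ 2 - m 2 ex z * Y z $ 1) * inverse (D z))"
  have xh: "holomorphic_at x1 0" "holomorphic_at x2 0"
    unfolding x1_def x2_def by (intro holomorphic_at_mult holomorphic_at_diff holomorphic_at_inverse mh Yi Dh Dn)+
  have vm: "vanish 2 (\<lambda>z. g z * h z)" if "holomorphic_at g 0" "vanish 2 h" for g h :: "complex^2 \<Rightarrow> complex"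
    using vanish_mult[OF vanish_0[OF holomorphic_at_isCont[OF that(1)]] that(2)] unfolding add_0 .
  have xv: "vanish 2 x1" "vanish 2 x2"
  proof -
    have "vanish 2 (\<lambda>z. inverse (D z) * (m 2 ey z * Y z $ 1 - m 1 ey z * Y z $ 2))"
      by (intro vm vanish_diff holomorphic_at_inverse Dh Dn mh Yi)
    thus "vanish 2 x1" by (simp add: x1_def mult.commute)
    have "vanish 2 (\<lambda>z. inverse (D z) * (m 1 ex z * Y z $ 2 - m 2 ex z * Y z $ 1))"
      by (intro vm vanish_diff holomorphic_at_inverse Dh Dn mh Yi)
    thus "vanish 2 x2" by (simp add: x2_def mult.commute)
  qed
  define X where "X = (\<lambda>z. pt (x1 z) (x2 z))"
  have Xh: "holomorphic_map_at X 0" unfolding X_def by (rule holomorphic_map_at_pt[OF xh])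
  have Xv: "vanish 2 X"
  proof (rule vanish_vecI)
    fix i :: 2 show "vanish 2 (\<lambda>z. X z $ i)" using exhaust_2[of i] xv by (auto simp: X_def)
  qed
  have ev1: "\<forall>\<^sub>F z in nhds 0. D z \<noteq> 0"
    using tendsto_imp_eventually_ne[of D "D 0" "nhds 0" 0] holomorphic_at_isCont[OF Dh] Dn
    unfolding isCont_def tendsto_at_iff_tendsto_nhds by blast
  obtain Rt where Rt: "Rt > 0" "\<And>i. holo (\<lambda>z. \<theta> z $ i) (ball 0 Rt)"
    using holomorphic_map_atE[OF \<theta>(1)] by blast
  have evZ: "\<forall>\<^sub>F z in nhds 0. holomorphic_map_at Z z"
  proof -
    obtain Rz where Rz: "Rz > 0" "\<And>i. holo (\<lambda>z. Z z $ i) (ball 0 Rz)"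
      using holomorphic_map_atE[OF Z(1)] by blast
    show ?thesis
      by (rule eventually_nhds_ballI[OF Rz(1)])
        (auto simp: holomorphic_map_at_def intro: holomorphic_atI[OF Rz(2) open_ball])
  qed
  have "\<forall>\<^sub>F z in nhds 0. holomorphic_map_at Z (\<theta> z)"
    by (rule eventually_nhds_compose[OF holomorphic_map_at_isCont[OF \<theta>(1)]]) (simp add: \<theta>0 evZ)
  moreover have "\<forall>\<^sub>F z in nhds 0. z \<in> ball (0::complex^2) Rt"
    by (rule eventually_nhds_in_open) (use Rt in auto)
  ultimately have "\<forall>\<^sub>F z in nhds 0. holomorphic_map_at Z (\<theta> z) \<and> D z \<noteq> 0 \<and> z \<in> ball 0 Rt"
    using ev1 by eventually_elim blast
  then obtain R where R: "R > 0" "\<And>z. z \<in> ball 0 R \<Longrightarrow> holomorphic_map_at Z (\<theta> z) \<and> D z \<noteq> 0 \<and> z \<in> ball 0 Rt"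
    by (rule eventually_nhds_ballE) blast
  obtain d K where d: "d > 0"
    "\<forall>p\<in>ball 0 d. \<exists>c. integral_curve X c \<and> c 0 = p \<and> c 1 = exp_vf X p \<and>
      (\<forall>t\<in>{0..1}. norm (c t) \<le> 2 * norm p \<and> norm (c t - p) \<le> K * norm p ^ 2)"
    by (rule exp_flow[OF Xh Xv]) blast
  have "\<forall>\<^sub>F z in nhds 0. \<theta> (exp_vf X z) = exp_vf Z (\<theta> z)"
  proof (rule eventually_nhds_ballI[of "min d (R / 2)"])
    fix p :: "complex^2" assume p: "p \<in> ball 0 (min d (R / 2))"
    hence "p \<in> ball 0 d" by simp
    with d(2) obtain c where c: "integral_curve X c" "c 0 = p" "c 1 = exp_vf X p"
      "\<forall>t\<in>{0..1}. norm (c t) \<le> 2 * norm p \<and> norm (c t - p) \<le> K * norm p ^ 2" by blast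
    have inR: "c t \<in> ball 0 R" if "t \<in> {0..1}" for t
    proof -
      have "norm (c t) \<le> 2 * norm p" using c(4) that by blast
      thus ?thesis using p by simp
    qed
    have "integral_curve Z (\<lambda>t. \<theta> (c t))"
      unfolding integral_curve_def
    proof (intro ballI conjI)
      fix t :: real assume t: "t \<in> {0..1}"
      let ?q = "c t"
      have q: "holomorphic_map_at Z (\<theta> ?q)" "D ?q \<noteq> 0" "?q \<in> ball 0 Rt" using R(2)[OF inR[OF t]] by auto
      show "holomorphic_map_at Z (\<theta> ?q)" by (rule q(1))
      have dc: "(c has_vector_derivative X ?q) (at t within {0..1})"
        using c(1) t by (simp add: integral_curve_def)
      have "((\<lambda>t. \<theta> (c t)) has_vector_derivative
          (\<chi> i. ddir ex (\<lambda>z. \<theta> z $ i) ?q * X ?q $ 1 + ddir ey (\<lambda>z. \<theta> z $ i) ?q * X ?q $ 2)) (at t within {0..1})"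
        using vector_derivative_diff_chain_within[OF dc
            has_derivative_at_withinI[OF map_has_derivative[of \<theta>, OF Rt(2) q(3)]]]
        by (simp add: o_def)
      moreover have "(\<chi> i. ddir ex (\<lambda>z. \<theta> z $ i) ?q * X ?q $ 1 + ddir ey (\<lambda>z. \<theta> z $ i) ?q * X ?q $ 2) = Z (\<theta> ?q)"
      proof -
        have "m 1 ex ?q * X ?q $ 1 + m 1 ey ?q * X ?q $ 2 = D ?q * inverse (D ?q) * Y ?q $ 1"
          by (simp add: X_def x1_def x2_def D_def algebra_simps)
        moreover have "m 2 ex ?q * X ?q $ 1 + m 2 ey ?q * X ?q $ 2 = D ?q * inverse (D ?q) * Y ?q $ 2"
          by (simp add: X_def x1_def x2_def D_def algebra_simps)
        ultimately show ?thesis using q(2) by (simp add: vec_eq_iff forall_2 m_def Y_def)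
      qed
      ultimately show "((\<lambda>t. \<theta> (c t)) has_vector_derivative Z (\<theta> ?q)) (at t within {0..1})" by simp
    qed
    from exp_vf_eq[OF this] c(2,3) show "\<theta> (exp_vf X p) = exp_vf Z (\<theta> p)" by simp
  qed (use d R in auto)
  with Xh Xv show ?thesis by (rule that)
qed

text \<open>Order two forces the linear part to be zero, which is nilpotent with exponent 1.\<close>

lemma nilpotent_of_vanish:
  assumes "holomorphic_map_at X 0" "vanish 2 X" shows "nilpotent_vector_field X"
proof -
  have X0: "X 0 = 0" using vanish_zero[OF assms(2)] by simp
  obtain R C where R: "R > 0" "C \<ge> 0" "\<And>z. z \<in> ball 0 R \<Longrightarrow> norm (X z) \<le> C * norm z ^ 2"
    by (rule vanishE[OF assms(2)]) blast
  have "(X has_derivative (\<lambda>_. 0)) (at 0)"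
    unfolding has_derivative_at
  proof
    show "bounded_linear (\<lambda>_::complex^2. 0 :: complex^2)" by (rule bounded_linear_zero)
    show "(\<lambda>h. norm (X (0 + h) - X 0 - 0) / norm h) \<midarrow>0\<rightarrow> 0"
    proof (rule Lim_null_comparison)
      show "\<forall>\<^sub>F h in at 0. norm (norm (X (0 + h) - X 0 - 0) / norm h) \<le> C * norm h"
        unfolding eventually_at
      proof (intro exI[of _ R] conjI ballI impI)
        fix h :: "complex^2" assume h: "h \<noteq> 0 \<and> dist h 0 < R"
        have "norm (X h) \<le> C * norm h ^ 2" by (rule R(3)) (use h in simp)
        hence "norm (X h) / norm h \<le> C * norm h ^ 2 / norm h" by (rule divide_right_mono) simp
        thus "norm (norm (X (0 + h) - X 0 - 0) / norm h) \<le> C * norm h"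
          using h X0 by (simp add: power2_eq_square)
      qed (use R in auto)
      have "isCont (\<lambda>h::complex^2. C * norm h) 0" by (intro continuous_intros)
      thus "((\<lambda>h. C * norm h) \<longlongrightarrow> 0) (at (0::complex^2))" by (simp add: isCont_def)
    qed
  qed
  moreover have "(\<lambda>_::complex^2. 0::complex^2) ^^ 1 = (\<lambda>_. 0)" by simp
  ultimately show ?thesis
    unfolding nilpotent_vector_field_def singular_vector_field_def using assms(1) X0 by blast
qed

section \<open>Linear flows and logarithms of invertible matrices\<close>

lemma matrix2_mult_vec:
  "((A::complex^2^2) *v z) $ i = A $ i $ 1 * z $ 1 + A $ i $ 2 * z $ 2"
  by (simp add: matrix_vector_mult_def sum_2)

lemma holomorphic_map_at_matrix: "holomorphic_map_at (\<lambda>z. (A::complex^2^2) *v z) p"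
  unfolding holomorphic_map_at_def matrix2_mult_vec
  by (intro allI holomorphic_at_add holomorphic_at_mult holomorphic_at_const holomorphic_at_nth)

text \<open>By uniqueness of integral curves, a time one map is identified by displaying one
  solution through each point.\<close>

lemma exp_of_decomposition:
  fixes A B :: "complex^2^2"
  assumes "\<And>p. \<exists>c. c 0 = p \<and> c 1 = A *v p \<and> (\<forall>t::real. (c has_vector_derivative B *v c t) (at t))"
  shows "exp_vf (\<lambda>z. B *v z) p = A *v p"
proof -
  obtain c where c: "c 0 = p" "c 1 = A *v p" "\<forall>t::real. (c has_vector_derivative B *v c t) (at t)"
    using assms by blast
  have "integral_curve (\<lambda>z. B *v z) c"
    using c(3) holomorphic_map_at_matrix has_vector_derivative_at_within unfolding integral_curve_def by blast
  from exp_vf_eq[OF this] c show ?thesis by simp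
qed

lemma exp_scalar_derivative:
  "((\<lambda>t::real. exp (of_real t * l) :: complex) has_vector_derivative l * exp (of_real t * l)) (at t)"
proof -
  have "((\<lambda>z. exp (z * l)) has_field_derivative (exp (of_real t * l) * l)) (at (of_real t))"
    by (auto intro!: derivative_eq_intros)
  from has_vector_derivative_real_field[OF this] show ?thesis by (simp add: mult.commute)
qed

lemma has_vector_derivative_vec2:
  assumes "\<And>i. ((\<lambda>t. c t $ i) has_vector_derivative (v::complex^2) $ i) (at t)"
  shows "(c has_vector_derivative v) (at t)"
proof -
  have e: "(\<lambda>t. c t $ 1 *s ex + c t $ 2 *s ey) = c" by (rule ext) (rule vec2_eq[symmetric])
  have "((\<lambda>t. c t $ i *s axis i 1) has_vector_derivative v $ i *s axis i 1) (at t)" for i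
    by (rule bounded_linear.has_vector_derivative[OF bounded_linear_smult_left assms])
  from has_vector_derivative_add[OF this[of 1] this[of 2]] show ?thesis
    unfolding e vec2_eq[symmetric] .
qed

text \<open>By Cayley--Hamilton the eigenvalues \<open>l\<close>, \<open>m\<close> of \<open>A\<close> satisfy
  \<open>(A - l) (A - m) = 0\<close>, which gives the flow of a logarithm in closed form.\<close>

lemma matrix_exponential_surj:
  fixes A :: "complex^2^2"
  assumes "det A \<noteq> 0"
  obtains B where "\<And>p. exp_vf (\<lambda>z. B *v z) p = A *v p"
proof -
  define a b c d where abcd: "a = A $ 1 $ 1" "b = A $ 1 $ 2" "c = A $ 2 $ 1" "d = A $ 2 $ 2"
  \<comment> \<open>A square root of the discriminant of the characteristic polynomial of
    \<open>A\<close>; \<open>l\<close> and \<open>m\<close> are the eigenvalues.\<close>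
  define s where "s = csqrt ((a - d) ^ 2 + 4 * b * c)"
  define l m where lm: "l = (a + d + s) / 2" "m = (a + d - s) / 2"
  have ss: "s * s = (a - d) ^ 2 + 4 * b * c"
    using power2_csqrt[of "(a - d) ^ 2 + 4 * b * c"] by (simp add: s_def power2_eq_square)
  have sum: "l + m = a + d" by (simp add: lm field_simps)
  have prod: "l * m = a * d - b * c"
  proof -
    have two: "2 * l = a + d + s" "2 * m = a + d - s" by (simp_all add: lm)
    have "4 * (l * m) = (2 * l) * (2 * m)" by simp
    also have "\<dots> = (a + d) * (a + d) - s * s" unfolding two by (simp add: algebra_simps)
    finally have "4 * (l * m) = (a + d) * (a + d) - s * s" .
    also have "\<dots> = 4 * (a * d - b * c)" unfolding ss by (simp add: algebra_simps power2_eq_square)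
    finally have "4 * (l * m) = 4 * (a * d - b * c)" .
    thus ?thesis unfolding mult_cancel_left by simp
  qed
  have "det A = a * d - b * c" by (simp add: det_2 abcd)
  hence "l \<noteq> 0" "m \<noteq> 0" using assms prod by auto
  have AN: "A *v p = pt (a * p $ 1 + b * p $ 2) (c * p $ 1 + d * p $ 2)" for p
    by (simp add: vec_eq_iff forall_2 matrix2_mult_vec abcd)
  have CH1: "(a - l) * (a - m) + b * c = 0"
  proof -
    have "(a - l) * (a - m) + b * c = a * a - a * (l + m) + l * m + b * c" by (simp add: algebra_simps)
    thus ?thesis unfolding sum prod by (simp add: algebra_simps)
  qed
  have CH2: "(d - l) * (d - m) + b * c = 0"
  proof -
    have "(d - l) * (d - m) + b * c = d * d - d * (l + m) + l * m + b * c" by (simp add: algebra_simps)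
    thus ?thesis unfolding sum prod by (simp add: algebra_simps)
  qed
  have CH3: "a - l + (d - m) = 0" using sum by (simp add: algebra_simps)
  show ?thesis
  proof (cases "l = m")
    case False
    define u where "u = Ln l"
    define v where "v = Ln m"
    have uv: "exp u = l" "exp v = m" using \<open>l \<noteq> 0\<close> \<open>m \<noteq> 0\<close> by (simp_all add: u_def v_def)
    define w where "w = (u - v) / (l - m)"
    have wl: "w * (l - m) = u - v" using False by (simp add: w_def)
    \<comment> \<open>The polynomial in \<open>A\<close> of degree at most one that takes the value
      \<open>u = Ln l\<close> at \<open>l\<close> and \<open>v = Ln m\<close> at
      \<open>m\<close>.\<close>
    define B :: "complex^2^2" where "B = (\<chi> i j. w * A $ i $ j + (if i = j then v - w * m else 0))"
    have Bv: "B *v p = pt (w * (a * p $ 1 + b * p $ 2) + (v - w * m) * p $ 1) (w * (c * p $ 1 + d * p $ 2) + (v - w * m) * p $ 2)" for p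
      by (simp add: vec_eq_iff forall_2 matrix2_mult_vec B_def abcd algebra_simps)
    have "exp_vf (\<lambda>z. B *v z) p = A *v p" for p
    proof (rule exp_of_decomposition)
      fix p :: "complex^2"
      define E F where EF: "E = (\<lambda>t::real. exp (of_real t * u))" "F = (\<lambda>t::real. exp (of_real t * v))"
      define k where "k = 1 / (l - m)"
      have kk: "k * (l - m) = 1" using False by (simp add: k_def)
      \<comment> \<open>The components \<open>(A - m) p / (l - m)\<close> and
        \<open>(l - A) p / (l - m)\<close> of \<open>p\<close> in the eigenspaces for
        \<open>l\<close> and \<open>m\<close>. The facts \<open>CH1\<close> to \<open>CH3\<close>
        encode the entries of \<open>(A - l) (A - m) = 0\<close>.\<close>
      define x1 y1 x2 y2 where xy: "x1 = k * ((a - m) * p $ 1 + b * p $ 2)" "y1 = k * (c * p $ 1 + (d - m) * p $ 2)"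
        "x2 = - k * ((a - l) * p $ 1 + b * p $ 2)" "y2 = - k * (c * p $ 1 + (d - l) * p $ 2)"
      define C where "C = (\<lambda>t. pt (E t * x1 + F t * x2) (E t * y1 + F t * y2))"
      have s1: "x1 + x2 = p $ 1" "y1 + y2 = p $ 2"
      proof -
        have "x1 + x2 = (k * (l - m)) * p $ 1" by (simp add: xy algebra_simps)
        thus "x1 + x2 = p $ 1" using kk by simp
        have "y1 + y2 = (k * (l - m)) * p $ 2" by (simp add: xy algebra_simps)
        thus "y1 + y2 = p $ 2" using kk by simp
      qed
      have e1: "a * x1 + b * y1 = l * x1" "c * x1 + d * y1 = l * y1"
      proof -
        have "a * x1 + b * y1 - l * x1 = k * (((a - l) * (a - m) + b * c) * p $ 1 + b * (a - l + (d - m)) * p $ 2)"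
          by (simp add: xy algebra_simps)
        thus "a * x1 + b * y1 = l * x1" unfolding CH1 CH3 by simp
        have "c * x1 + d * y1 - l * y1 = k * (c * (a - m + (d - l)) * p $ 1 + ((d - l) * (d - m) + b * c) * p $ 2)"
          by (simp add: xy algebra_simps)
        moreover have "a - m + (d - l) = 0" using sum by (simp add: algebra_simps)
        ultimately show "c * x1 + d * y1 = l * y1" unfolding CH2 by simp
      qed
      have e2: "a * x2 + b * y2 = m * x2" "c * x2 + d * y2 = m * y2"
      proof -
        have "a * x2 + b * y2 - m * x2 = - k * (((a - l) * (a - m) + b * c) * p $ 1 + b * (a - m + (d - l)) * p $ 2)"
          by (simp add: xy algebra_simps)
        moreover have "a - m + (d - l) = 0" using sum by (simp add: algebra_simps)
        ultimately show "a * x2 + b * y2 = m * x2" unfolding CH1 by simp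
        have "c * x2 + d * y2 - m * y2 = - k * (c * (a - l + (d - m)) * p $ 1 + ((d - l) * (d - m) + b * c) * p $ 2)"
          by (simp add: xy algebra_simps)
        thus "c * x2 + d * y2 = m * y2" unfolding CH2 CH3 by simp
      qed
      have dE: "((\<lambda>t. E t * x + F t * y) has_vector_derivative (u * E t * x + v * F t * y)) (at t)" for t x y
        unfolding EF
        by (intro has_vector_derivative_add has_vector_derivative_mult_left exp_scalar_derivative)
      have "(C has_vector_derivative B *v C t) (at t)" for t
      proof (rule has_vector_derivative_vec2)
        fix i :: 2
        have wl': "w * l = u - v + w * m" using wl by (simp add: algebra_simps)
        have b1: "(B *v C t) $ 1 = u * E t * x1 + v * F t * x2"
        proof -
          have "(B *v C t) $ 1 = E t * (w * (a * x1 + b * y1) + (v - w * m) * x1)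
              + F t * (w * (a * x2 + b * y2) + (v - w * m) * x2)"
            by (simp add: Bv C_def algebra_simps)
          also have "\<dots> = E t * ((w * l) * x1 + (v - w * m) * x1) + F t * (v * x2)"
            unfolding e1 e2 by (simp add: algebra_simps)
          also have "\<dots> = u * E t * x1 + v * F t * x2" unfolding wl' by (simp add: algebra_simps)
          finally show ?thesis .
        qed
        have b2: "(B *v C t) $ 2 = u * E t * y1 + v * F t * y2"
        proof -
          have "(B *v C t) $ 2 = E t * (w * (c * x1 + d * y1) + (v - w * m) * y1)
              + F t * (w * (c * x2 + d * y2) + (v - w * m) * y2)"
            by (simp add: Bv C_def algebra_simps)
          also have "\<dots> = E t * ((w * l) * y1 + (v - w * m) * y1) + F t * (v * y2)"
            unfolding e1 e2 by (simp add: algebra_simps)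
          also have "\<dots> = u * E t * y1 + v * F t * y2" unfolding wl' by (simp add: algebra_simps)
          finally show ?thesis .
        qed
        show "((\<lambda>t. C t $ i) has_vector_derivative (B *v C t) $ i) (at t)"
          using exhaust_2[of i] b1 b2 dE by (auto simp: C_def)
      qed
      moreover have "C 0 = p" using s1 by (simp add: C_def EF vec_eq_iff forall_2)
      moreover have "C 1 = A *v p"
      proof -
        have "a * p $ 1 + b * p $ 2 = (a * x1 + b * y1) + (a * x2 + b * y2)"
          unfolding s1[symmetric] by (simp add: algebra_simps)
        moreover have "c * p $ 1 + d * p $ 2 = (c * x1 + d * y1) + (c * x2 + d * y2)"
          unfolding s1[symmetric] by (simp add: algebra_simps)
        ultimately show ?thesis unfolding AN by (simp add: C_def EF uv e1 e2)
      qed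
      ultimately show "\<exists>c. c 0 = p \<and> c 1 = A *v p \<and> (\<forall>t::real. (c has_vector_derivative B *v c t) (at t))" by blast
    qed
    thus ?thesis by (rule that)
  next
    case True
    define u where "u = Ln l"
    have u: "exp u = l" using \<open>l \<noteq> 0\<close> by (simp add: u_def)
    define w where "w = 1 / l"
    have wl: "w * l = 1" using \<open>l \<noteq> 0\<close> by (simp add: w_def)
    \<comment> \<open>With a double eigenvalue, \<open>A / l - 1\<close> has square zero and the
      logarithm series stops after its first term: the logarithm of \<open>A\<close> is
      \<open>u + (A / l - 1)\<close>.\<close>
    define B :: "complex^2^2" where "B = (\<chi> i j. w * A $ i $ j + (if i = j then u - 1 else 0))"
    \<comment> \<open>The diagonal term \<open>u - 1\<close> is written as \<open>u - w * l\<close>,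
      so that \<open>w\<close> becomes a common factor of \<open>A - l\<close>.\<close>
    have Bv: "B *v p = pt (w * (a * p $ 1 + b * p $ 2) + (u - w * l) * p $ 1) (w * (c * p $ 1 + d * p $ 2) + (u - w * l) * p $ 2)" for p
      unfolding wl by (simp add: vec_eq_iff forall_2 matrix2_mult_vec B_def abcd algebra_simps)
    have "exp_vf (\<lambda>z. B *v z) p = A *v p" for p
    proof (rule exp_of_decomposition)
      fix p :: "complex^2"
      define E where "E = (\<lambda>t::real. exp (of_real t * u))"
      define x y where xy: "x = w * ((a - l) * p $ 1 + b * p $ 2)" "y = w * (c * p $ 1 + (d - l) * p $ 2)"
      \<comment> \<open>\<open>exp (t u)\<close> times \<open>p + t (A / l - 1) p\<close>, the
        exponential of the square-zero part being affine in \<open>t\<close>.\<close>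
      define C where "C = (\<lambda>t. pt (E t * (p $ 1 + of_real t * x)) (E t * (p $ 2 + of_real t * y)))"
      have n: "(a - l) * x + b * y = 0" "c * x + (d - l) * y = 0"
      proof -
        have "(a - l) * x + b * y = w * (((a - l) * (a - m) + b * c) * p $ 1 + b * (a - l + (d - m)) * p $ 2)"
          by (simp add: xy True algebra_simps)
        thus "(a - l) * x + b * y = 0" unfolding CH1 CH3 by simp
        have "c * x + (d - l) * y = w * (c * (a - l + (d - m)) * p $ 1 + ((d - l) * (d - m) + b * c) * p $ 2)"
          by (simp add: xy True algebra_simps)
        thus "c * x + (d - l) * y = 0" unfolding CH2 CH3 by simp
      qed
      have dE: "((\<lambda>t. E t * (q + of_real t * x)) has_vector_derivative (E t * x + u * E t * (q + of_real t * x))) (at t)" for t q x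
      proof -
        have dt: "((\<lambda>t. of_real t :: complex) has_vector_derivative 1) (at t)"
          by (rule has_vector_derivative_of_real[OF DERIV_ident, simplified])
        have "((\<lambda>t. q + of_real t * x) has_vector_derivative (0 + 1 * x)) (at t)"
          by (intro has_vector_derivative_add has_vector_derivative_const has_vector_derivative_mult_left dt)
        from has_vector_derivative_mult[OF exp_scalar_derivative this, of u]
        show ?thesis by (simp add: E_def algebra_simps)
      qed
      have "(C has_vector_derivative B *v C t) (at t)" for t
      proof (rule has_vector_derivative_vec2)
        fix i :: 2
        have "(B *v C t) $ 1 = E t * x + u * E t * (p $ 1 + of_real t * x) + E t * of_real t * w * ((a - l) * x + b * y)"
          by (simp add: Bv C_def xy algebra_simps)
        hence b1: "(B *v C t) $ 1 = E t * x + u * E t * (p $ 1 + of_real t * x)" unfolding n by simp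
        have "(B *v C t) $ 2 = E t * y + u * E t * (p $ 2 + of_real t * y) + E t * of_real t * w * (c * x + (d - l) * y)"
          by (simp add: Bv C_def xy algebra_simps)
        hence b2: "(B *v C t) $ 2 = E t * y + u * E t * (p $ 2 + of_real t * y)" unfolding n by simp
        show "((\<lambda>t. C t $ i) has_vector_derivative (B *v C t) $ i) (at t)"
          using exhaust_2[of i] b1 b2 dE by (auto simp: C_def)
      qed
      moreover have "C 0 = p" by (simp add: C_def E_def)
      moreover have "C 1 = A *v p"
      proof -
        have "l * x = (w * l) * ((a - l) * p $ 1 + b * p $ 2)" "l * y = (w * l) * (c * p $ 1 + (d - l) * p $ 2)"
          by (simp_all add: xy)
        hence "l * (p $ 1 + x) = a * p $ 1 + b * p $ 2" "l * (p $ 2 + y) = c * p $ 1 + d * p $ 2"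
          unfolding wl by (simp_all add: algebra_simps)
        thus ?thesis unfolding AN by (simp add: C_def E_def u)
      qed
      ultimately show "\<exists>c. c 0 = p \<and> c 1 = A *v p \<and> (\<forall>t::real. (c has_vector_derivative B *v c t) (at t))" by blast
    qed
    thus ?thesis by (rule that)
  qed
qed

section \<open>Realizing the conjugacy of branches\<close>

text \<open>The order beyond \<open>K\<close> is spent on a factor \<open>z $ 1\<close> or
  \<open>z $ 2\<close>, which makes the coefficients vanish at the origin. The path method needs
  this to have a determinant near one and a field of order two.\<close>

lemma ideal_split:
  assumes ideal: "\<And>r. holomorphic_at r 0 \<Longrightarrow> vanish K r \<Longrightarrow> in_ideal P g r"
    and r: "holomorphic_at r 0" "vanish (Suc K) r"
  obtains a c where "holomorphic_at a 0" "a 0 = 0" "holomorphic_at c 0" "c 0 = 0"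
    "\<forall>\<^sub>F z in nhds 0. r z = a z * P z + c z * g z"
proof -
  obtain r1 r2 where r12: "holomorphic_at r1 0" "holomorphic_at r2 0" "vanish K r1" "vanish K r2"
    "\<forall>\<^sub>F z in nhds 0. r z = z $ 1 * r1 z + z $ 2 * r2 z"
    by (rule vanish_split[OF r]) blast
  obtain a1 c1 where 1: "holomorphic_at a1 0" "holomorphic_at c1 0" "\<forall>\<^sub>F z in nhds 0. r1 z = a1 z * P z + c1 z * g z"
    using ideal[OF r12(1,3)] unfolding in_ideal_def by blast
  obtain a2 c2 where 2: "holomorphic_at a2 0" "holomorphic_at c2 0" "\<forall>\<^sub>F z in nhds 0. r2 z = a2 z * P z + c2 z * g z"
    using ideal[OF r12(2,4)] unfolding in_ideal_def by blast
  from r12(5) 1(3) 2(3) have "\<forall>\<^sub>F z in nhds 0. r z =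
      (z $ 1 * a1 z + z $ 2 * a2 z) * P z + (z $ 1 * c1 z + z $ 2 * c2 z) * g z"
    by eventually_elim (simp add: algebra_simps)
  moreover have "holomorphic_at (\<lambda>z. z $ 1 * a1 z + z $ 2 * a2 z) 0" "holomorphic_at (\<lambda>z. z $ 1 * c1 z + z $ 2 * c2 z) 0"
    by (intro holomorphic_at_add holomorphic_at_mult holomorphic_at_nth 1 2)+
  ultimately show ?thesis by (intro that[of "\<lambda>z. z $ 1 * a1 z + z $ 2 * a2 z" "\<lambda>z. z $ 1 * c1 z + z $ 2 * c2 z"]) simp_all
qed

text \<open>A holomorphic \<open>f\<close> is Lipschitz near the origin; it is padded to the map
  \<open>pt (f z) 0\<close> so that \<open>map_lipschitz_local\<close> applies.\<close>

lemma vanish_comp_diff: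
  fixes F G :: "complex^2 \<Rightarrow> complex^2"
  assumes f: "holomorphic_at f 0" and F: "isCont F 0" "F 0 = 0" and G: "isCont G 0" "G 0 = 0"
    and v: "vanish k (\<lambda>z. F z - G z)"
  shows "vanish k (\<lambda>z. f (F z) - f (G z))"
proof -
  have "holomorphic_map_at (\<lambda>z. pt (f z) 0) 0" by (intro holomorphic_map_at_pt f holomorphic_at_const)
  then obtain r L where rL: "r > 0" "L \<ge> 0"
    "\<And>x y. x \<in> ball 0 r \<Longrightarrow> y \<in> ball 0 r \<Longrightarrow> norm (pt (f x) 0 - pt (f y) 0) \<le> L * norm (x - y)"
    by (rule map_lipschitz_local) blast
  have "\<forall>\<^sub>F z in nhds 0. F z \<in> ball 0 r" "\<forall>\<^sub>F z in nhds 0. G z \<in> ball 0 r"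
    using eventually_nhds_compose[OF F(1), of "\<lambda>z. z \<in> ball 0 r"] eventually_nhds_compose[OF G(1), of "\<lambda>z. z \<in> ball 0 r"]
      eventually_nhds_in_open[of "ball (0::complex^2) r" 0] rL(1) F(2) G(2) by simp_all
  hence "\<forall>\<^sub>F z in nhds 0. norm (f (F z) - f (G z)) \<le> L * norm (F z - G z)"
  proof eventually_elim
    case (elim z)
    have "norm (f (F z) - f (G z)) = norm ((pt (f (F z)) 0 - pt (f (G z)) 0) $ 1)" by simp
    also have "\<dots> \<le> norm (pt (f (F z)) 0 - pt (f (G z)) 0)" by (rule Finite_Cartesian_Product.norm_nth_le)
    also have "\<dots> \<le> L * norm (F z - G z)" by (rule rL(3)[OF elim])
    finally show ?case .
  qed
  thus ?thesis by (rule vanish_bound[OF v]) (rule rL(2))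
qed

text \<open>The branch and its image under the inverse of \<kappa> are compared through their
  equations: \<open>z\<close> lies on the first exactly if \<open>exp_vf X z\<close> lies on the
  second. In this form unit factors are harmless.\<close>

lemma nilpotent_flow_realizes:
  assumes irr: "irreducible_germ f" and \<kappa>: "biholomorphism_germ \<kappa>" "vanish 2 (\<lambda>z. \<kappa> z - z)"
  obtains X where "holomorphic_map_at X 0" "vanish 2 X"
    "\<forall>\<^sub>F z in nhds 0. f (\<kappa> (exp_vf X z)) = 0 \<longleftrightarrow> f z = 0"
proof -
  have f: "holomorphic_at f 0" "f 0 = 0" using irr by (auto simp: irreducible_germ_def unit_germ_iff)
  have \<kappa>': "holomorphic_map_at \<kappa> 0" "\<kappa> 0 = 0" using \<kappa>(1) by (auto simp: biholomorphism_germ_def)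
  define P where "P = (\<lambda>z. f (\<kappa> z))"
  have irrP: "irreducible_germ P" unfolding P_def by (rule irreducible_compose[OF \<kappa>(1) irr])
  have P: "holomorphic_at P 0" "P 0 = 0" using irrP by (auto simp: irreducible_germ_def unit_germ_iff)
  show ?thesis
  proof (cases "\<exists>a. holomorphic_at a 0 \<and> (\<forall>\<^sub>F z in nhds 0. f z = a z * P z)")
    case True
    then obtain a where a: "holomorphic_at a 0" "\<forall>\<^sub>F z in nhds 0. f z = a z * P z" by blast
    \<comment> \<open>\<open>P\<close> vanishes at the origin and is no unit, so irreducibility of
      \<open>f\<close> makes the cofactor a unit and the two zero sets coincide.\<close>
    with irr P have "unit_germ a" by (auto simp: irreducible_germ_def unit_germ_iff)
    then obtain b where b: "\<forall>\<^sub>F z in nhds 0. a z * b z = 1" unfolding unit_germ_def by blast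
    have "\<forall>\<^sub>F z in nhds 0. f (\<kappa> (exp_vf (\<lambda>_. 0) z)) = 0 \<longleftrightarrow> f z = 0"
      using a(2) b by eventually_elim (auto simp: exp_vf_0 P_def)
    moreover have "holomorphic_map_at (\<lambda>_. 0) 0" by (auto simp: holomorphic_map_at_def)
    moreover have "vanish 2 (\<lambda>_::complex^2. 0 :: complex^2)" by (rule vanishI[of 1 _ 0]) auto
    ultimately show ?thesis using that by blast
  next
    case False
    obtain e K where K: "\<And>r. holomorphic_at r 0 \<Longrightarrow> vanish K r \<Longrightarrow> in_ideal P (\<lambda>z. f z * ddir e P z) r"
      by (rule irreducible_jacobian_ideal[OF irrP f(1)]) (use False in blast)+
    \<comment> \<open>Order \<open>K + 2\<close>, because \<open>ideal_split\<close> asks for order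
      \<open>K + 1\<close> of both \<open>r\<close> and \<open>f * ddir e r\<close>, and the
      derivative costs one order.\<close>
    obtain X where X: "holomorphic_map_at X 0" "vanish 2 X" "vanish (K + 2) (\<lambda>z. exp_vf X z - \<kappa> z)"
      using exp_vf_approx[OF \<kappa>'(1) \<kappa>(2)] by blast
    note E = exp_vf_holomorphic[OF X(1,2)]
    define r where "r = (\<lambda>z. f (exp_vf X z) - f (\<kappa> z))"
    have r: "holomorphic_at r 0"
      unfolding r_def using holomorphic_at_compose[of f "exp_vf X" 0] holomorphic_at_compose[of f \<kappa> 0] f E \<kappa>'
      by (intro holomorphic_at_diff) simp_all
    have rv: "vanish (Suc (Suc K)) r"
      unfolding r_def
      using vanish_comp_diff[OF f(1) holomorphic_map_at_isCont[OF E(1)] E(2) holomorphic_map_at_isCont[OF \<kappa>'(1)] \<kappa>'(2) X(3)]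
      by simp
    obtain a c where ac: "holomorphic_at a 0" "a 0 = 0" "holomorphic_at c 0" "c 0 = 0"
      "\<forall>\<^sub>F z in nhds 0. r z = a z * P z + c z * (f z * ddir e P z)"
      by (rule ideal_split[OF K r vanish_mono[OF rv]]) auto
    have v2: "vanish (Suc K) (\<lambda>z. f z * ddir e r z)"
      using vanish_mult[OF vanish_0[OF holomorphic_at_isCont[OF f(1)]] vanish_ddir[OF r rv, of e]] unfolding add_0 .
    obtain a' c' where ac': "holomorphic_at a' 0" "a' 0 = 0" "holomorphic_at c' 0" "c' 0 = 0"
      "\<forall>\<^sub>F z in nhds 0. f z * ddir e r z = a' z * P z + c' z * (f z * ddir e P z)"
      by (rule ideal_split[OF K holomorphic_at_mult[OF f(1) holomorphic_at_ddir[OF r]] v2]) auto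
    obtain \<theta> where \<theta>: "holomorphic_map_at \<theta> 0" "vanish 2 (\<lambda>z. \<theta> z - z)"
      "\<forall>\<^sub>F z in nhds 0. (f (\<theta> z) = 0 \<longleftrightarrow> f z = 0) \<and> (P (\<theta> z) + r (\<theta> z) = 0 \<longleftrightarrow> P z = 0)"
      by (rule path_equivalence[OF f P(1) r ac(1-4) ac'(1-4) ac(5) ac'(5)])
    have \<theta>0: "\<theta> 0 = 0" using vanish_zero[OF \<theta>(2)] by simp
    have mX: "holomorphic_map_at (\<lambda>z. - X z) 0" "vanish 2 (\<lambda>z. - X z)"
      using holomorphic_map_at_minus[OF X(1)] vanish_minus[OF X(2)] by auto
    \<comment> \<open>If \<open>f z = 0\<close>, then \<open>f (\<theta> z) = 0\<close>, so the
      image of \<open>\<theta> z\<close> under \<open>exp_vf (- X)\<close> is a zero of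
      \<open>f\<close> composed with \<open>exp_vf X\<close>, which is \<open>P + r\<close>. This
      image is \<open>\<theta> (exp_vf V z)\<close>, and \<theta> matches the zeros of
      \<open>P\<close> with those of \<open>P + r\<close>.\<close>
    obtain V where V: "holomorphic_map_at V 0" "vanish 2 V"
      "\<forall>\<^sub>F z in nhds 0. \<theta> (exp_vf V z) = exp_vf (\<lambda>z. - X z) (\<theta> z)"
      by (rule conjugate_flow[OF \<theta>(1,2) mX])
    have "\<forall>\<^sub>F z in nhds 0. exp_vf X (exp_vf (\<lambda>z. - X z) z) = z"
      using exp_vf_minus[OF mX] by simp
    hence inv: "\<forall>\<^sub>F z in nhds 0. exp_vf X (exp_vf (\<lambda>z. - X z) (\<theta> z)) = \<theta> z"
      by (intro eventually_nhds_compose[OF holomorphic_map_at_isCont[OF \<theta>(1)]]) (simp add: \<theta>0)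
    have \<theta>V: "\<forall>\<^sub>F z in nhds 0. P (\<theta> (exp_vf V z)) + r (\<theta> (exp_vf V z)) = 0 \<longleftrightarrow> P (exp_vf V z) = 0"
      using eventually_nhds_compose[OF holomorphic_map_at_isCont[OF exp_vf_holomorphic(1)[OF V(1,2)]], of
          "\<lambda>z. P (\<theta> z) + r (\<theta> z) = 0 \<longleftrightarrow> P z = 0"] \<theta>(3) exp_vf_holomorphic(2)[OF V(1,2)]
      by (simp add: eventually_conj_iff)
    from \<theta>(3) V(3) inv \<theta>V have "\<forall>\<^sub>F z in nhds 0. f (\<kappa> (exp_vf V z)) = 0 \<longleftrightarrow> f z = 0"
    proof eventually_elim
      case (elim z)
      have "P (\<theta> (exp_vf V z)) + r (\<theta> (exp_vf V z)) = f (exp_vf X (\<theta> (exp_vf V z)))" by (simp add: P_def r_def)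
      also have "\<dots> = f (\<theta> z)" using elim(2,3) by simp
      finally show ?case using elim(1,4) by (simp add: P_def)
    qed
    with V(1,2) show ?thesis by (rule that)
  qed
qed

text \<open>Every \<open>z\<close> near the origin is \<open>h (g z)\<close>, so a property known at
  the points \<open>h z\<close> is carried to all points by substituting \<open>g z\<close>. The
  other direction composes with \<open>h\<close>.\<close>

lemma filtermap_set_germ_invariant:
  assumes h: "isCont h 0" "h 0 = 0" and g: "isCont g 0" "g 0 = 0"
    and hg: "\<forall>\<^sub>F z in nhds 0. h (g z) = z" and A: "\<forall>\<^sub>F z in nhds 0. h z \<in> A \<longleftrightarrow> z \<in> A"
  shows "filtermap h (set_germ A) = set_germ A"
  unfolding set_germ_def filter_eq_iff eventually_filtermap eventually_inf_principal
proof (intro allI iffI)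
  fix Q
  assume "\<forall>\<^sub>F z in nhds 0. z \<in> A \<longrightarrow> Q (h z)"
  with A have "\<forall>\<^sub>F z in nhds 0. h z \<in> A \<longrightarrow> Q (h z)" by eventually_elim blast
  hence "\<forall>\<^sub>F z in nhds 0. h (g z) \<in> A \<longrightarrow> Q (h (g z))"
    by (intro eventually_nhds_compose[OF g(1)]) (simp add: g(2))
  with hg show "\<forall>\<^sub>F z in nhds 0. z \<in> A \<longrightarrow> Q z" by eventually_elim simp
next
  fix Q
  assume "\<forall>\<^sub>F z in nhds 0. z \<in> A \<longrightarrow> Q z"
  hence "\<forall>\<^sub>F z in nhds 0. h z \<in> A \<longrightarrow> Q (h z)"
    by (intro eventually_nhds_compose[OF h(1)]) (simp add: h(2))
  with A show "\<forall>\<^sub>F z in nhds 0. z \<in> A \<longrightarrow> Q (h z)" by eventually_elim blast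
qed

section \<open>Reduction to a conjugacy tangent to the identity\<close>

lemma linear_part:
  assumes \<phi>: "holomorphic_map_at \<phi> 0"
  obtains A :: "complex^2^2" where "(\<phi> has_derivative (\<lambda>h. A *v h)) (at 0)"
proof -
  obtain R where R: "R > 0" "\<And>i. holo (\<lambda>z. \<phi> z $ i) (ball 0 R)"
    using holomorphic_map_atE[OF \<phi>] by blast
  define A :: "complex^2^2" where "A = (\<chi> i j. if j = 1 then ddir ex (\<lambda>z. \<phi> z $ i) 0 else ddir ey (\<lambda>z. \<phi> z $ i) 0)"
  have "(\<lambda>h. \<chi> i. ddir ex (\<lambda>z. \<phi> z $ i) 0 * h $ 1 + ddir ey (\<lambda>z. \<phi> z $ i) 0 * h $ 2) = (\<lambda>h. A *v h)"
    by (auto simp: fun_eq_iff vec_eq_iff matrix2_mult_vec A_def)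
  with map_has_derivative[of \<phi>, OF R(2), of 0] R(1) show ?thesis by (intro that[of A]) simp
qed

text \<open>The differential of \<kappa> minus the identity vanishes at the origin, so its partial
  derivatives have order one and integration gives order two.\<close>

lemma tangent_to_identity:
  assumes \<kappa>: "holomorphic_map_at \<kappa> 0" "\<kappa> 0 = 0" and d: "(\<kappa> has_derivative (\<lambda>h. h)) (at 0)"
  shows "vanish 2 (\<lambda>z. \<kappa> z - z)"
proof (rule vanish_vecI)
  fix i :: 2
  define g where "g = (\<lambda>z. \<kappa> z $ i - z $ i)"
  have g: "holomorphic_at g 0" "g 0 = 0"
    using \<kappa> unfolding g_def by (auto simp: holomorphic_map_at_def)
  obtain R where R: "R > 0" "holo g (ball 0 R)" using holomorphic_atE[OF g(1)] by blast
  have "(g has_derivative (\<lambda>h. h $ i - h $ i)) (at 0)"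
    unfolding g_def
    by (intro has_derivative_diff bounded_linear.has_derivative[OF bounded_linear_vec_nth] d has_derivative_ident)
  moreover have "(g has_derivative (\<lambda>h. ddir h g 0)) (at 0)"
    by (rule holo_has_derivative[OF R(2)]) (use R(1) in simp)
  ultimately have "(\<lambda>h. ddir h g 0) = (\<lambda>h. h $ i - h $ i)" by (rule has_derivative_unique[rotated])
  hence "ddir v g 0 = 0" for v by (simp add: fun_eq_iff)
  hence "vanish 1 (ddir v g)" for v by (intro vanish_1I holomorphic_at_ddir g(1))
  hence "vanish (Suc 1) g" by (intro vanish_integrate g)
  thus "vanish 2 (\<lambda>z. (\<kappa> z - z) $ i)" by (simp add: g_def numeral_2_eq_2)
qed

theorem corollary10:
  fixes \<Gamma> \<Gamma>' :: "(complex^2) filter"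
  assumes "plane_branch \<Gamma>" and "plane_branch \<Gamma>'"
    and "analytically_conjugate \<Gamma> \<Gamma>'"
  shows "\<exists>X Y. nilpotent_vector_field X \<and> linear_vector_field Y \<and>
           filtermap (exp_vf Y \<circ> exp_vf X) \<Gamma> = \<Gamma>'"
proof -
  from assms(1) obtain f where f: "irreducible_germ f" "\<Gamma> = set_germ {z. f z = 0}"
    unfolding plane_branch_def by blast
  from assms(3) obtain \<phi> \<psi> where \<phi>: "holomorphic_map_at \<phi> 0" "\<phi> 0 = 0" and \<phi>\<Gamma>: "filtermap \<phi> \<Gamma> = \<Gamma>'"
    and \<psi>: "holomorphic_map_at \<psi> 0" "\<psi> 0 = 0"
    and inv: "\<forall>\<^sub>F z in nhds 0. \<psi> (\<phi> z) = z" "\<forall>\<^sub>F z in nhds 0. \<phi> (\<psi> z) = z"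
    unfolding analytically_conjugate_def biholomorphism_germ_def by blast
  obtain A where A: "(\<phi> has_derivative (\<lambda>h. A *v h)) (at 0)" by (rule linear_part[OF \<phi>(1)])
  obtain A' where A': "(\<psi> has_derivative (\<lambda>h. A' *v h)) (at 0)" by (rule linear_part[OF \<psi>(1)])
  have "((\<lambda>z. \<psi> (\<phi> z)) has_derivative (\<lambda>h. A' *v (A *v h))) (at 0)"
    by (rule has_derivative_compose[OF A]) (simp add: \<phi>(2) A')
  moreover have "((\<lambda>z. \<psi> (\<phi> z)) has_derivative (\<lambda>h. h)) (at 0)"
  proof -
    obtain R where R: "R > 0" "\<And>z. z \<in> ball 0 R \<Longrightarrow> \<psi> (\<phi> z) = z"
      using inv(1) by (rule eventually_nhds_ballE) blast
    show ?thesis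
      by (rule has_derivative_transform_within_open[OF has_derivative_ident, of "ball 0 R"]) (use R in auto)
  qed
  ultimately have A'A: "A' *v (A *v h) = h" for h
    using has_derivative_unique by (metis (no_types, lifting))
  hence "A' ** A = mat 1" by (simp add: matrix_eq matrix_vector_mul_assoc)
  hence AA': "A ** A' = mat 1" by (simp add: matrix_left_right_inverse)
  have "det A \<noteq> 0" using \<open>A' ** A = mat 1\<close> by (metis det_I det_mul mult_zero_right zero_neq_one)
  then obtain B where B: "\<And>p. exp_vf (\<lambda>z. B *v z) p = A *v p" by (rule matrix_exponential_surj) blast
  \<comment> \<open>The factor of \<phi> tangent to the identity is
    \<open>\<kappa>' = A' \<phi>\<close>, with \<open>A'\<close> inverse to \<open>A\<close>;
    \<kappa> is the inverse germ of this factor.\<close>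
  define \<kappa> where "\<kappa> = (\<lambda>z. \<psi> (A *v z))"
  have lin: "isCont (\<lambda>z. A *v z) 0" "isCont (\<lambda>z. A' *v z) 0"
    by (intro holomorphic_map_at_isCont holomorphic_map_at_matrix)+
  have \<kappa>h: "holomorphic_map_at \<kappa> 0"
    unfolding \<kappa>_def by (rule holomorphic_map_at_compose) (use \<psi> holomorphic_map_at_matrix in simp_all)
  have \<kappa>0: "\<kappa> 0 = 0" by (simp add: \<kappa>_def \<psi>(2))
  define \<kappa>' where "\<kappa>' = (\<lambda>z. A' *v \<phi> z)"
  have \<kappa>'h: "holomorphic_map_at \<kappa>' 0"
    unfolding \<kappa>'_def by (rule holomorphic_map_at_compose[OF holomorphic_map_at_matrix \<phi>(1)])
  have \<kappa>'0: "\<kappa>' 0 = 0" by (simp add: \<kappa>'_def \<phi>(2))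
  have \<kappa>\<kappa>': "\<forall>\<^sub>F z in nhds 0. \<kappa> (\<kappa>' z) = z"
    using inv(1) by eventually_elim (simp add: \<kappa>_def \<kappa>'_def matrix_vector_mul_assoc AA')
  have \<phi>\<kappa>: "\<forall>\<^sub>F z in nhds 0. \<phi> (\<kappa> z) = A *v z"
    unfolding \<kappa>_def by (rule eventually_nhds_compose[OF lin(1)]) (simp add: inv(2))
  hence \<kappa>'\<kappa>: "\<forall>\<^sub>F z in nhds 0. \<kappa>' (\<kappa> z) = z"
    by eventually_elim (simp add: \<kappa>'_def A'A)
  have bi: "biholomorphism_germ \<kappa>"
    unfolding biholomorphism_germ_def using \<kappa>h \<kappa>0 \<kappa>'h \<kappa>'0 \<kappa>\<kappa>' \<kappa>'\<kappa> by blast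
  have "(\<kappa> has_derivative (\<lambda>h. A' *v (A *v h))) (at 0)"
    unfolding \<kappa>_def
    by (rule has_derivative_compose[OF bounded_linear_imp_has_derivative]) (simp_all add: A' matrix_vector_mul_bounded_linear)
  hence "(\<kappa> has_derivative (\<lambda>h. h)) (at 0)" by (simp add: A'A)
  note \<kappa>v = tangent_to_identity[OF \<kappa>h \<kappa>0 this]
  obtain X where X: "holomorphic_map_at X 0" "vanish 2 X" "\<forall>\<^sub>F z in nhds 0. f (\<kappa> (exp_vf X z)) = 0 \<longleftrightarrow> f z = 0"
    by (rule nilpotent_flow_realizes[OF f(1) bi \<kappa>v])
  note E = exp_vf_holomorphic[OF X(1,2)]
  have mX: "holomorphic_map_at (\<lambda>z. - X z) 0" "vanish 2 (\<lambda>z. - X z)"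
    using holomorphic_map_at_minus[OF X(1)] vanish_minus[OF X(2)] by auto
  note E' = exp_vf_holomorphic[OF mX]
  \<comment> \<open>\<open>h\<close> will preserve the branch, and \<phi> composed with
    \<open>h\<close> is \<open>A\<close> composed with \<open>exp_vf X\<close>, since \<phi>
    composed with \<kappa> is \<open>A\<close>. So the composition of the two flows acts on \<Gamma>
    as \<phi> does.\<close>
  define h where "h = (\<lambda>z. \<kappa> (exp_vf X z))"
  define g where "g = (\<lambda>z. exp_vf (\<lambda>z. - X z) (\<kappa>' z))"
  have "holomorphic_map_at h 0"
    unfolding h_def by (rule holomorphic_map_at_compose[OF _ E(1)]) (simp add: E(2) \<kappa>h)
  hence hc: "isCont h 0" "h 0 = 0"
    by (auto simp: h_def E(2) \<kappa>0 intro: holomorphic_map_at_isCont)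
  have "holomorphic_map_at g 0"
    unfolding g_def by (rule holomorphic_map_at_compose[OF _ \<kappa>'h]) (simp add: E'(1) \<kappa>'0)
  hence gc: "isCont g 0" "g 0 = 0"
    by (auto simp: g_def E'(2) \<kappa>'0 intro: holomorphic_map_at_isCont)
  have "\<forall>\<^sub>F z in nhds 0. exp_vf X (exp_vf (\<lambda>z. - X z) z) = z" using exp_vf_minus[OF mX] by simp
  hence "\<forall>\<^sub>F z in nhds 0. exp_vf X (exp_vf (\<lambda>z. - X z) (\<kappa>' z)) = \<kappa>' z"
    by (intro eventually_nhds_compose[OF holomorphic_map_at_isCont[OF \<kappa>'h]]) (simp add: \<kappa>'0)
  with \<kappa>\<kappa>' have hg: "\<forall>\<^sub>F z in nhds 0. h (g z) = z" by eventually_elim (simp add: h_def g_def)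
  have "\<forall>\<^sub>F z in nhds 0. h z \<in> {z. f z = 0} \<longleftrightarrow> z \<in> {z. f z = 0}" using X(3) by (simp add: h_def)
  from filtermap_set_germ_invariant[OF hc gc hg this] have h\<Gamma>: "filtermap h \<Gamma> = \<Gamma>" by (simp add: f(2))
  have "\<forall>\<^sub>F z in nhds 0. \<phi> (\<kappa> (exp_vf X z)) = A *v exp_vf X z"
    by (rule eventually_nhds_compose[OF holomorphic_map_at_isCont[OF E(1)]]) (simp add: E(2) \<phi>\<kappa>)
  hence "\<forall>\<^sub>F z in nhds 0. (exp_vf (\<lambda>z. B *v z) \<circ> exp_vf X) z = \<phi> (h z)"
    by eventually_elim (simp add: B h_def)
  hence "\<forall>\<^sub>F z in \<Gamma>. (exp_vf (\<lambda>z. B *v z) \<circ> exp_vf X) z = \<phi> (h z)"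
    by (rule filter_leD[rotated]) (simp add: f(2) set_germ_def)
  \<comment> \<open>Maps that agree eventually along \<Gamma> have the same image filter, and
    \<Gamma> is finer than \<open>nhds 0\<close>.\<close>
  hence "filtermap (exp_vf (\<lambda>z. B *v z) \<circ> exp_vf X) \<Gamma> = filtermap (\<lambda>z. \<phi> (h z)) \<Gamma>"
    unfolding filter_eq_iff eventually_filtermap
    by (intro allI eventually_subst) (auto elim: eventually_mono)
  also have "\<dots> = filtermap \<phi> (filtermap h \<Gamma>)" by (simp add: filtermap_filtermap)
  also have "\<dots> = \<Gamma>'" by (simp add: h\<Gamma> \<phi>\<Gamma>)
  finally show ?thesis
    using nilpotent_of_vanish[OF X(1,2)] unfolding linear_vector_field_def by blast
qed

end
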